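(* Let $\Omega\subset\mathbb R^3$ be a bounded domain with sufficiently regular boundary and outward unit normal $\vec n$. Let $(c,\vec u,p)$ be a sufficiently smooth solution in $\Omega$ of $$c_t+\nabla\cdot(c\vec u)=M_0\nabla^2\mu,\qquad \mu=f_0'(c)-\tfrac32\sigma\varepsilon\nabla^2c,$$ $$\sqrt\rho\,(\sqrt\rho\,\vec u)_t+\nabla\cdot\left(\tfrac12\rho\,\vec u\,\vec u\right)+\tfrac12\rho\,\vec u\cdot\nabla\vec u+c\nabla\mu=-\nabla p+\nabla\cdot\left(2\eta\,\mathsf S\right),$$ $$p_t+\rho_0c_0^2\,\nabla\cdot\vec u=0,$$ with the Cahn--Hilliard boundary conditions $$-\tfrac32\sigma\varepsilon\,\frac{\partial c}{\partial\vec n}=f_w'(c),\qquad \frac{\partial\mu}{\partial\vec n}=0\quad\text{on }\partial\Omega,$$ and, for the momentum equation, either the free-slip wall condition (zero normal velocity $\vec u\cdot\vec n=0$ and zero normal stress $\mathsf S\cdot\vec n=0$) or the no-slip wall condition ($\vec u=0$) on $\partial\Omega$. Then $$\frac{d}{dt}\left(\int_\Omega\mathcal E\,d\vec x+\int_{\partial\Omega}f_w(c)\,dS\right)=-\int_\Omega\left(M_0|\nabla\mu|^2+2\eta\,\mathsf S:\mathsf S\right)d\vec x\ \leq\ 0,$$ where $$\mathcal E=f_0(c)+\tfrac34\sigma\varepsilon|\nabla c|^2+\tfrac12\rho|\vec u|^2+\frac{p^2}{2\rho_0c_0^2}.$$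
   Context: The unknowns are the concentration $c(\vec x,t)$ of two fluids 1 and 2, the velocity $\vec u(\vec x,t)\in\mathbb R^3$ and the (auxiliary) pressure $p(\vec x,t)$. The interface tension coefficient $\sigma$, the interface width $\varepsilon$ and the mobility $M_0$ are positive constants; $\rho_1,\rho_2$ are the constant densities and $\eta_1,\eta_2$ the viscosities of fluids 1 and 2; $c_0$ is the artificial sound speed, and $\rho_0=\max(\rho_1,\rho_2)$. The chemical free energy is $f_0(c)=\frac{12\sigma}{\varepsilon}c^2(1-c)^2$, and $\mu$ is the chemical potential. The density is $\rho=\rho_1\hat c+\rho_2(1-\hat c)$ with the cutoff $\hat c=\min(\max(c,0),1)$, which ensures the assumed positivity of $\rho$. The viscosity is $\eta=\eta_1c+\eta_2(1-c)$. $\mathsf S=\frac12(\nabla\vec u+\nabla\vec u^T)$ is the strain tensor; $\nabla\cdot(\frac12\rho\vec u\vec u)$ has $i$-th component $\nabla\cdot(\frac12\rho u_i\vec u)$ and $\vec u\cdot\nabla\vec u$ has $i$-th component $\vec u\cdot\nabla u_i$. Subscript $t$ denotes the time derivative. $f_w$ is a (differentiable) boundary free-energy function controlling the wall contact angle; one choice is $f_w(c)=\frac12\sigma\cos\theta_w(2c-1)(1+2c-2c^2)$, for which $f_w'(c)=6\sigma\cos\theta_w\,c(1-c)$, where $\theta_w$ is the imposed contact angle with the wall.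
   Formalization: The final inequality "≤ 0" is proved at each time under the added condition η ≥ 0 in Ω, since η = η₁c+η₂(1−c) has no cutoff and may be negative, in which case the inequality can fail; the energy identity itself is unconditional. *)

theory Defs
  imports "HOL-Analysis.Analysis"
begin

text \<open>Continuous differentiability of order \<open>k\<close> on an open set.\<close>

primrec Ck_on :: "nat \<Rightarrow> ('a::euclidean_space \<Rightarrow> 'b::real_normed_vector) \<Rightarrow> 'a set \<Rightarrow> bool" where
  "Ck_on 0 f W \<longleftrightarrow> continuous_on W f"
| "Ck_on (Suc k) f W \<longleftrightarrow>
     (\<forall>x\<in>W. f differentiable (at x)) \<and> (\<forall>v. Ck_on k (\<lambda>x. frechet_derivative f (at x) v) W)"

definition grad :: "(real^'n \<Rightarrow> real) \<Rightarrow> real^'n \<Rightarrow> real^'n" where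
  "grad f x = (\<chi> i. frechet_derivative f (at x) (axis i 1))"

definition divergence :: "(real^'n \<Rightarrow> real^'n) \<Rightarrow> real^'n \<Rightarrow> real" where
  "divergence F x = (\<Sum>i\<in>UNIV. frechet_derivative F (at x) (axis i 1) $ i)"

definition laplacian :: "(real^'n \<Rightarrow> real) \<Rightarrow> real^'n \<Rightarrow> real" where
  "laplacian f x = divergence (grad f) x"

definition strain :: "(real^3 \<Rightarrow> real^3) \<Rightarrow> real^3 \<Rightarrow> real^3^3" where
  "strain u x = (1/2) *\<^sub>R
     (matrix (frechet_derivative u (at x)) + transpose (matrix (frechet_derivative u (at x))))"

text \<open>
  Domains with \<open>C\<^sup>1\<close> boundary: near every boundary point, after relabelling and reorienting the
  coordinate axes, the domain is the region below the graph of a \<open>C\<^sup>1\<close> function. The index \<open>i\<close> is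
  the direction over which the boundary is a graph, \<open>s = 1\<close> or \<open>s = -1\<close> its orientation. The
  index type \<open>3\<close> has arithmetic modulo 3, so \<open>i\<close>, \<open>i + 1\<close>, \<open>i + 2\<close> are the three axes.
\<close>

definition drop_axis :: "3 \<Rightarrow> real^3 \<Rightarrow> real^2" where
  "drop_axis i x = vector [x $ (i + 1), x $ (i + 2)]"

definition graph_patch ::
    "(real^3) set \<Rightarrow> (real^3) set \<Rightarrow> 3 \<Rightarrow> real \<Rightarrow> (real^2 \<Rightarrow> real) \<Rightarrow> bool" where
  "graph_patch \<Omega> U i s \<phi> \<longleftrightarrow>
     open U \<and> (s = 1 \<or> s = -1) \<and> Ck_on 1 \<phi> UNIV \<and>
     \<Omega> \<inter> U = {x \<in> U. s * x $ i < s * \<phi> (drop_axis i x)}"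

definition C1_domain :: "(real^3) set \<Rightarrow> bool" where
  "C1_domain \<Omega> \<longleftrightarrow>
     open \<Omega> \<and> connected \<Omega> \<and> \<Omega> \<noteq> {} \<and>
     (\<forall>x\<in>frontier \<Omega>. \<exists>U i s \<phi>. x \<in> U \<and> graph_patch \<Omega> U i s \<phi>)"

text \<open>
  The surface measure \<open>dS\<close> of \<open>\<partial>\<Omega>\<close>: the Borel measure carried by \<open>\<partial>\<Omega>\<close> which on every graph patch
  is given by the area element \<open>sqrt (1 + |\<nabla>\<phi>|\<^sup>2) dy\<close>. For a bounded \<open>C\<^sup>1\<close> domain these conditions
  determine it uniquely.
\<close>

definition surface_measure :: "(real^3) set \<Rightarrow> (real^3) measure \<Rightarrow> bool" where
  "surface_measure \<Omega> S \<longleftrightarrow>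
     sets S = sets borel \<and> emeasure S (- frontier \<Omega>) = 0 \<and>
     (\<forall>U i s \<phi>. graph_patch \<Omega> U i s \<phi> \<longrightarrow>
        (\<forall>A\<in>sets borel. A \<subseteq> frontier \<Omega> \<inter> U \<longrightarrow>
           emeasure S A =
             (\<integral>\<^sup>+y\<in>drop_axis i ` A. ennreal (sqrt (1 + (norm (grad \<phi> y))\<^sup>2)) \<partial>lborel)))"

text \<open>
  \<open>\<nu>\<close> is the outward unit normal at \<open>x \<in> \<partial>\<Omega>\<close>: to first order at \<open>x\<close>, the set \<open>\<Omega>\<close> is the half-space
  of directions \<open>v\<close> with \<open>v \<bullet> \<nu> < 0\<close>. At most one \<open>\<nu>\<close> satisfies this.
\<close>

definition outward_unit_normal :: "(real^3) set \<Rightarrow> real^3 \<Rightarrow> real^3 \<Rightarrow> bool" where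
  "outward_unit_normal \<Omega> x \<nu> \<longleftrightarrow>
     norm \<nu> = 1 \<and>
     (\<forall>v. v \<bullet> \<nu> < 0 \<longrightarrow> (\<forall>\<^sub>F h in at_right 0. x + h *\<^sub>R v \<in> \<Omega>)) \<and>
     (\<forall>v. v \<bullet> \<nu> > 0 \<longrightarrow> (\<forall>\<^sub>F h in at_right 0. x + h *\<^sub>R v \<notin> \<Omega>))"

definition f0 :: "real \<Rightarrow> real \<Rightarrow> real \<Rightarrow> real" where
  "f0 \<sigma> \<epsilon> c = 12 * \<sigma> / \<epsilon> * c\<^sup>2 * (1 - c)\<^sup>2"

definition cutoff :: "real \<Rightarrow> real" where
  "cutoff c = min (max c 0) 1"

definition density_mix :: "real \<Rightarrow> real \<Rightarrow> real \<Rightarrow> real" where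
  "density_mix \<rho>\<^sub>1 \<rho>\<^sub>2 c = \<rho>\<^sub>1 * cutoff c + \<rho>\<^sub>2 * (1 - cutoff c)"

definition viscosity_mix :: "real \<Rightarrow> real \<Rightarrow> real \<Rightarrow> real" where
  "viscosity_mix \<eta>\<^sub>1 \<eta>\<^sub>2 c = \<eta>\<^sub>1 * c + \<eta>\<^sub>2 * (1 - c)"

end

theory Submission
  imports Defs
begin

text \<open>
  Test the equations with \<open>\<mu>\<close>, \<open>u\<close> and \<open>p\<close>: in \<open>\<Omega>\<close> the rate of change of the energy density plus the
  dissipation is the divergence of a flux \<open>F\<close>, and on the wall \<open>F \<bullet> n = - f\<^sub>w'(c) c\<^sub>t\<close>, which the divergence
  theorem matches with the rate of change of the wall energy.

  Because of the cutoff in the density, \<open>F\<close> is only Lipschitz near the closure of \<open>\<Omega>\<close> and differentiable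
  in \<open>\<Omega>\<close>, with a derivative that need not be continuous. The divergence theorem is therefore obtained
  for such fields: by a partition into pieces supported in graph patches, each piece being treated by
  differentiating its integral along translations.
\<close>

subsection \<open>Differentiation under the integral sign\<close>

text \<open>The density is never differentiated on its own. No continuity equation for
  \<open>\<rho>\<close> is available, and the cutoff puts kinks at the concentrations 0 and 1. The
  form of the momentum equation is adapted to this: the kinetic energy is half the square of
  \<open>sqrt \<rho> * u\<close>, the very quantity whose time derivative stands in the equation,
  and the two convective terms, tested with a velocity component \<open>u_i\<close>, are the two
  summands of the product rule for the divergence of \<open>u_i (1/2 \<rho> u_i u)\<close>.
  Convection thus leaves nothing but a flux. What remains of the kinks is a flux of low regularity:
  \<open>smooth_momentum\<close> makes it differentiable at the points of \<open>\<Omega>\<close>,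
  and the Lipschitz bound comes from \<open>\<rho>\<close> being a Lipschitz function of the smooth
  \<open>c\<close>. Lipschitz bounds then replace continuity of derivatives throughout: they
  dominate the difference quotients, both when an integral is differentiated along a translation and
  when the energy is differentiated in time.\<close>

lemma has_real_derivative_integral:
  fixes f :: "real \<Rightarrow> 'a \<Rightarrow> real"
  assumes e: "e > 0"
    and int: "\<And>t. \<bar>t - \<tau>\<bar> < e \<Longrightarrow> integrable M (f t)"
    and der: "\<And>x. x \<in> space M \<Longrightarrow> ((\<lambda>t. f t x) has_real_derivative f' x) (at \<tau>)"
    and k: "integrable M k"
    and dom: "\<And>t x. \<bar>t - \<tau>\<bar> < e \<Longrightarrow> x \<in> space M \<Longrightarrow> \<bar>f t x - f \<tau> x\<bar> \<le> k x * \<bar>t - \<tau>\<bar>"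
  shows "integrable M f'"
    and "((\<lambda>t. LINT x|M. f t x) has_real_derivative (LINT x|M. f' x)) (at \<tau>)"
proof -
  define q where "q h x = (f (\<tau> + h) x - f \<tau> x) / h" for h x
  \<comment> \<open>Dominated convergence works with sequences, so the derivative is tested along
    sequences \<open>h\<close> of nonzero increments. The dominating function comes from
    \<open>dom\<close>, which compares with time \<open>\<tau>\<close> only; no derivative at other
    times enters.\<close>
  have key: "integrable M f' \<and> (\<lambda>n. LINT x|M. q (h n) x) \<longlonglongrightarrow> (LINT x|M. f' x)"
    if h: "h \<longlonglongrightarrow> 0" and h0: "\<And>n. h n \<noteq> 0" and he: "\<And>n. \<bar>h n\<bar> < e" for h :: "nat \<Rightarrow> real"
  proof -
    have lim: "(\<lambda>n. q (h n) x) \<longlonglongrightarrow> f' x" if "x \<in> space M" for x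
      using der[OF that] h h0 unfolding DERIV_def q_def LIMSEQ_SEQ_conv[symmetric] by blast
    have meas: "q (h n) \<in> borel_measurable M" for n
      using int[of "\<tau> + h n"] int[of \<tau>] he[of n] e unfolding q_def
      by (intro borel_measurable_divide borel_measurable_diff) auto
    have f'_meas: "f' \<in> borel_measurable M"
      by (rule borel_measurable_LIMSEQ_real[OF lim meas])
    have bound: "norm (q (h n) x) \<le> k x" if "x \<in> space M" for n x
      using dom[of "\<tau> + h n" x] that he[of n] h0[of n] unfolding q_def
      by (simp add: divide_le_eq abs_divide)
    have "integrable M f'"
      by (rule integrable_dominated_convergence[where s = "\<lambda>n. q (h n)" and w = k])
        (use f'_meas meas k lim bound in auto)
    moreover have "(\<lambda>n. LINT x|M. q (h n) x) \<longlonglongrightarrow> (LINT x|M. f' x)"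
      by (rule integral_dominated_convergence[where w = k])
        (use f'_meas meas k lim bound in auto)
    ultimately show ?thesis by blast
  qed
  \<comment> \<open>One explicit null sequence with nonzero terms below \<open>e\<close> already
    yields the integrability of \<open>f'\<close>.\<close>
  have "(\<lambda>n. e / 2 * inverse (real (Suc n))) \<longlonglongrightarrow> 0"
    using tendsto_mult_right_zero[OF LIMSEQ_inverse_real_of_nat] by blast
  moreover have "\<bar>e / 2 * inverse (real (Suc n))\<bar> < e" for n
    using e by (simp add: abs_mult field_simps add_strict_increasing)
  ultimately show "integrable M f'"
    using e by (intro conjunct1[OF key[of "\<lambda>n. e / 2 * inverse (real (Suc n))"]]) auto
  show "((\<lambda>t. LINT x|M. f t x) has_real_derivative (LINT x|M. f' x)) (at \<tau>)"
    unfolding DERIV_def LIMSEQ_SEQ_conv[symmetric]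
  proof (intro allI impI, elim conjE)
    fix h :: "nat \<Rightarrow> real" assume h0: "\<forall>n. h n \<noteq> 0" and h: "h \<longlonglongrightarrow> 0"
    obtain N where N: "\<And>n. n \<ge> N \<Longrightarrow> \<bar>h n\<bar> < e"
      using LIMSEQ_D[OF h e] by auto
    \<comment> \<open>\<open>key\<close> wants every increment below \<open>e\<close>, hence the
      shift by \<open>N\<close>; \<open>LIMSEQ_offset\<close> undoes it.\<close>
    have "(\<lambda>n. LINT x|M. q (h (n + N)) x) \<longlonglongrightarrow> (LINT x|M. f' x)"
      by (rule conjunct2[OF key]) (use h h0 N in \<open>auto intro: LIMSEQ_ignore_initial_segment\<close>)
    moreover have "(LINT x|M. q (h n) x) = ((LINT x|M. f (\<tau> + h n) x) - (LINT x|M. f \<tau> x)) / h n"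
      if "n \<ge> N" for n
      using int[of "\<tau> + h n"] int[of \<tau>] e N[OF that] unfolding q_def by simp
    ultimately have "(\<lambda>n. ((LINT x|M. f (\<tau> + h (n + N)) x) - (LINT x|M. f \<tau> x)) / h (n + N))
        \<longlonglongrightarrow> (LINT x|M. f' x)"
      by simp
    then show "(\<lambda>n. ((LINT x|M. f (\<tau> + h n) x) - (LINT x|M. f \<tau> x)) / h n) \<longlonglongrightarrow> (LINT x|M. f' x)"
      by (rule LIMSEQ_offset)
  qed
qed

text \<open>Passing to \<open>restrict_space\<close> weakens the pointwise hypotheses to points of
  \<open>A\<close>, where alone the fields are controlled.\<close>

lemma has_real_derivative_set_integral:
  fixes f :: "real \<Rightarrow> 'a \<Rightarrow> real"
  assumes A: "A \<in> sets M" and e: "e > 0"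
    and int: "\<And>t. \<bar>t - \<tau>\<bar> < e \<Longrightarrow> set_integrable M A (f t)"
    and der: "\<And>x. x \<in> A \<Longrightarrow> ((\<lambda>t. f t x) has_real_derivative f' x) (at \<tau>)"
    and k: "set_integrable M A k"
    and dom: "\<And>t x. \<bar>t - \<tau>\<bar> < e \<Longrightarrow> x \<in> A \<Longrightarrow> \<bar>f t x - f \<tau> x\<bar> \<le> k x * \<bar>t - \<tau>\<bar>"
  shows "set_integrable M A f'"
    and "((\<lambda>t. LINT x:A|M. f t x) has_real_derivative (LINT x:A|M. f' x)) (at \<tau>)"
proof -
  have A': "A \<inter> space M \<in> sets M" using A by auto
  note * = integrable_restrict_space[OF A', where 'b = real]
    integral_restrict_space[OF A', where 'b = real]
  note D = has_real_derivative_integral[OF e, where M = "restrict_space M A" and k = k,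
      of \<tau> f f', unfolded *, folded set_integrable_def set_lebesgue_integral_def]
  show "set_integrable M A f'"
    by (rule D(1)) (use int der k dom in \<open>auto simp: space_restrict_space\<close>)
  show "((\<lambda>t. LINT x:A|M. f t x) has_real_derivative (LINT x:A|M. f' x)) (at \<tau>)"
    by (rule D(2)) (use int der k dom in \<open>auto simp: space_restrict_space\<close>)
qed

lemma integrable_continuous_bounded_support:
  fixes g :: "'a::euclidean_space \<Rightarrow> real"
  assumes "continuous_on UNIV g" and "\<And>z. z \<notin> cball 0 R \<Longrightarrow> g z = 0"
  shows "integrable lborel g"
proof -
  have "set_integrable lborel (cball 0 R) g"
    unfolding set_integrable_def
    by (rule borel_integrable_compact) (use assms(1) continuous_on_subset in auto)
  moreover have "(\<lambda>x. indicator (cball 0 R) x *\<^sub>R g x) = g"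
    using assms(2) by (auto simp: fun_eq_iff indicator_def)
  ultimately show ?thesis by (simp add: set_integrable_def)
qed

text \<open>Fundamental theorem of calculus with lower limit minus infinity; the bounded support
  lets a finite \<open>a\<close> take its place.\<close>

lemma set_integral_lessThan_has_derivative:
  fixes g :: "real \<Rightarrow> real"
  assumes g: "continuous_on UNIV g" and supp: "\<And>z. \<bar>z\<bar> > R \<Longrightarrow> g z = 0"
  shows "((\<lambda>b. LINT z:{..<b}|lborel. g z) has_real_derivative g b0) (at b0)"
proof -
  \<comment> \<open>Strictly below the support and below \<open>b0\<close>, so that
    \<open>b0\<close> is interior to \<open>{a..b0 + 1}\<close> and the derivative within that
    interval is a full one.\<close>
  define a where "a = min (-R) b0 - 1"
  have eq: "(LINT z:{..<b}|lborel. g z) = integral {a..b} g" if "b > a" for b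
  proof -
    have "(LINT z:{..<b}|lborel. g z) = (LINT z:{a..b}|lborel. g z)"
      unfolding set_lebesgue_integral_def
    proof (rule integral_cong_AE)
      have *: "g \<in> borel_measurable borel" using g by (rule borel_measurable_continuous_onI)
      show "(\<lambda>x. indicat_real {..<b} x *\<^sub>R g x) \<in> borel_measurable lborel"
        "(\<lambda>x. indicat_real {a..b} x *\<^sub>R g x) \<in> borel_measurable lborel"
        using * by measurable
      show "AE x in lborel. indicat_real {..<b} x *\<^sub>R g x = indicat_real {a..b} x *\<^sub>R g x"
        using AE_lborel_singleton[of b]
      proof eventually_elim
        case (elim x)
        moreover have "g x = 0" if "x < a"
          using that by (intro supp) (auto simp: a_def)
        ultimately show ?case by (cases "x < a") (auto simp: indicator_def)
      qed
    qed
    also have "\<dots> = integral {a..b} g"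
    proof (rule set_borel_integral_eq_integral)
      show "set_integrable lborel {a..b} g"
        unfolding set_integrable_def
        by (rule borel_integrable_compact) (use g continuous_on_subset in auto)
    qed
    finally show ?thesis .
  qed
  have "((\<lambda>b. integral {a..b} g) has_real_derivative g b0) (at b0 within {a..b0 + 1})"
    by (rule integral_has_real_derivative) (use g continuous_on_subset in \<open>auto simp: a_def\<close>)
  then have "((\<lambda>b. integral {a..b} g) has_real_derivative g b0) (at b0)"
    by (subst (asm) at_within_interior) (auto simp: a_def)
  then show ?thesis
    by (rule has_field_derivative_transform_within_open[where S = "{a<..}"])
      (auto simp: a_def eq[unfolded a_def])
qed

text \<open>The sign \<open>s\<close> covers both orientations of a patch: from \<open>b h\<close>
  the half-line extends downwards for \<open>s = 1\<close> and upwards for \<open>s = -1\<close>.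
  The reflection \<open>z \<mapsto> - z\<close> reduces the second case to the first.\<close>

lemma half_line_integral_has_derivative:
  fixes g :: "real \<Rightarrow> real"
  assumes s: "s = 1 \<or> s = -1"
    and g: "continuous_on UNIV g" and supp: "\<And>z. \<bar>z\<bar> > R \<Longrightarrow> g z = 0"
    and b: "(b has_real_derivative b') (at h0)"
  shows "((\<lambda>h. LINT z:{z. s * z < s * b h}|lborel. g z) has_real_derivative s * g (b h0) * b') (at h0)"
  using s
proof
  assume s: "s = 1"
  show ?thesis
    using DERIV_chain[OF set_integral_lessThan_has_derivative[OF g supp] b]
    by (simp add: s o_def lessThan_def)
next
  assume s: "s = -1"
  have "(LINT z:{z. s * z < s * b h}|lborel. g z) = (LINT z:{..<- b h}|lborel. g (- z))" for h
    unfolding set_lebesgue_integral_def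
    by (subst lborel_integral_real_affine[where c = "-1" and t = 0]) (auto simp: s indicator_def)
  moreover have "((\<lambda>h. LINT z:{..<- b h}|lborel. g (- z)) has_real_derivative g (- (- b h0)) * (- b')) (at h0)"
    using DERIV_chain[OF set_integral_lessThan_has_derivative[of "\<lambda>z. g (- z)" R] DERIV_minus[OF b]]
      supp continuous_on_compose2[OF g, of UNIV uminus] by (simp add: o_def continuous_on_minus)
  ultimately show ?thesis by (simp add: s)
qed

text \<open>Mean value bound for the end point of the half-line; it supplies the dominating function
  when slices of a shifted domain are differentiated.\<close>

lemma half_line_integral_diff_le:
  fixes g :: "real \<Rightarrow> real"
  assumes s: "s = 1 \<or> s = -1"
    and g: "continuous_on UNIV g" and supp: "\<And>z. \<bar>z\<bar> > R \<Longrightarrow> g z = 0"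
    and B: "\<And>z. \<bar>g z\<bar> \<le> B"
  shows "\<bar>(LINT z:{z. s * z < s * b1}|lborel. g z) - (LINT z:{z. s * z < s * b2}|lborel. g z)\<bar> \<le> B * \<bar>b1 - b2\<bar>"
proof -
  have "norm ((LINT z:{z. s * z < s * b1}|lborel. g z) - (LINT z:{z. s * z < s * b2}|lborel. g z)) \<le> B * norm (b1 - b2)"
    by (rule field_differentiable_bound[where S = UNIV and f' = "\<lambda>b. s * g b"])
      (use half_line_integral_has_derivative[OF s g supp DERIV_ident] B s in auto)
  then show ?thesis by simp
qed

subsection \<open>The Gauss--Green formula below a graph\<close>

text \<open>Inverse of splitting \<open>x\<close> into \<open>drop_axis i x\<close> and
  \<open>x $ i\<close>. The graph of \<open>\<phi>\<close> is parametrised by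
  \<open>y \<mapsto> insert_axis i y (\<phi> y)\<close>.\<close>

definition insert_axis :: "3 \<Rightarrow> real^2 \<Rightarrow> real \<Rightarrow> real^3" where
  "insert_axis i y z = (\<chi> j. if j = i then z else if j = i + 1 then y $ 1 else y $ 2)"

lemma axes_distinct [simp]:
  fixes i :: 3
  shows "i + 1 \<noteq> i" "i + 2 \<noteq> i" "i + 2 \<noteq> i + 1" "i \<noteq> i + 1" "i \<noteq> i + 2" "i + 1 \<noteq> i + 2"
  using exhaust_3[of i] by auto

lemma axes_cases:
  fixes i j :: 3
  obtains "j = i" | "j = i + 1" | "j = i + 2"
  using exhaust_3[of i] exhaust_3[of j] by auto

lemma UNIV_axes: "(UNIV :: 3 set) = {i, i + 1, i + 2}"
proof -
  have "j \<in> {i, i + 1, i + 2}" for j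
    by (cases j i rule: axes_cases) auto
  then show ?thesis by blast
qed

lemma sum_axes: "sum f (UNIV :: 3 set) = f i + f (i + 1) + (f (i + 2) :: real)"
  by (subst UNIV_axes[of i]) auto

lemma drop_axis_nth [simp]: "drop_axis i x $ 1 = x $ (i + 1)" "drop_axis i x $ 2 = x $ (i + 2)"
  by (simp_all add: drop_axis_def)

lemma insert_axis_nth [simp]:
  "insert_axis i y z $ i = z" "insert_axis i y z $ (i + 1) = y $ 1" "insert_axis i y z $ (i + 2) = y $ 2"
  by (simp_all add: insert_axis_def)

lemma drop_axis_insert_axis [simp]: "drop_axis i (insert_axis i y z) = y"
  by (simp add: vec_eq_iff forall_2)

lemma insert_axis_drop_axis [simp]: "insert_axis i (drop_axis i x) (x $ i) = x"
proof -
  have "insert_axis i (drop_axis i x) (x $ i) $ j = x $ j" for j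
    by (cases j i rule: axes_cases) auto
  then show ?thesis by (simp add: vec_eq_iff)
qed

lemma bounded_linear_drop_axis: "bounded_linear (drop_axis i)"
  by (intro linear_conv_bounded_linear[THEN iffD1] linearI) (simp_all add: vec_eq_iff forall_2)

lemma bounded_linear_insert_axis: "bounded_linear (\<lambda>(y, z). insert_axis i y z)"
  by (intro linear_conv_bounded_linear[THEN iffD1] linearI) (auto simp: vec_eq_iff insert_axis_def)

lemmas continuous_on_drop_axis [continuous_intros] =
  bounded_linear.continuous_on[OF bounded_linear_drop_axis]

lemma continuous_on_insert_axis [continuous_intros]:
  assumes "continuous_on S f" "continuous_on S g"
  shows "continuous_on S (\<lambda>x. insert_axis i (f x) (g x))"
  using bounded_linear.continuous_on[OF bounded_linear_insert_axis continuous_on_Pair[OF assms], of i]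
  by simp

lemma measurable_insert_axis [measurable]:
  "(\<lambda>(y, z). insert_axis i y z) \<in> borel \<Otimes>\<^sub>M borel \<rightarrow>\<^sub>M borel"
  unfolding borel_prod
  by (rule borel_measurable_continuous_onI) (auto intro!: continuous_intros simp: case_prod_beta)

lemma inner_axes: "(x::real^3) \<bullet> y = x $ i * y $ i + drop_axis i x \<bullet> drop_axis i y"
  by (simp add: inner_vec_def sum_axes[of _ i] sum_2)

lemma norm_axes: "(norm (x::real^3))\<^sup>2 = (x $ i)\<^sup>2 + (norm (drop_axis i x))\<^sup>2"
  by (simp only: power2_norm_eq_inner inner_axes[of x x i]) (simp add: power2_eq_square)

lemma norm_drop_axis_le: "norm (drop_axis i x) \<le> norm x"
  by (rule power2_le_imp_le) (auto simp: norm_axes[of x i])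

text \<open>Lebesgue measure is determined by its values on boxes, and the preimage of a box under
  \<open>insert_axis\<close> is a product of boxes with the same side lengths.\<close>

lemma lborel_insert_axis:
  "(lborel :: (real^3) measure) = distr (lborel \<Otimes>\<^sub>M lborel) borel (\<lambda>(y, z). insert_axis i y z)"
proof (rule lborel_eqI)
  fix l u :: "real^3" assume lu: "\<And>b. b \<in> Basis \<Longrightarrow> l \<bullet> b \<le> u \<bullet> b"
  have lu': "l $ j \<le> u $ j" for j
    using lu[of "axis j 1"] by (simp add: inner_axis)
  have "(\<lambda>(y, z). insert_axis i y z) -` box l u
      = box (drop_axis i l) (drop_axis i u) \<times> box (l $ i) (u $ i)"
  proof -
    have all: "(\<forall>j. P j) \<longleftrightarrow> P i \<and> P (i + 1) \<and> P (i + 2)" for P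
      using UNIV_axes[of i] by (metis UNIV_I insertE singletonD)
    have "insert_axis i y z \<in> box l u \<longleftrightarrow> y \<in> box (drop_axis i l) (drop_axis i u) \<and> z \<in> box (l $ i) (u $ i)" for y z
      unfolding mem_box_cart forall_2 all by (simp add: mem_box) blast
    then show ?thesis by (simp add: set_eq_iff)
  qed
  then have "emeasure (distr (lborel \<Otimes>\<^sub>M lborel) borel (\<lambda>(y, z). insert_axis i y z)) (box l u)
      = emeasure lborel (box (drop_axis i l) (drop_axis i u)) * emeasure lborel (box (l $ i) (u $ i))"
    by (subst emeasure_distr) (auto simp: space_pair_measure lborel.emeasure_pair_measure_Times)
  also have "\<dots> = ennreal (\<Prod>b\<in>Basis. (u - l) \<bullet> b)"
  proof -
    have B3: "(\<Prod>b\<in>Basis. (u - l) \<bullet> b) = (u $ i - l $ i) * (u $ (i+1) - l $ (i+1)) * (u $ (i+2) - l $ (i+2))"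
    proof -
      have "(\<Prod>b\<in>Basis. (u - l) \<bullet> b) = (\<Prod>j\<in>UNIV. (u - l) $ j)"
        by (simp add: Basis_vec_def UNION_singleton_eq_range prod.reindex inj_on_def axis_eq_axis inner_axis o_def)
      then show ?thesis by (subst (asm) UNIV_axes[of i]) (simp add: mult.assoc)
    qed
    have B2: "(\<Prod>b\<in>Basis. (w::real^2) \<bullet> b) = w $ 1 * w $ 2" for w
      by (simp add: Basis_vec_def UNION_singleton_eq_range prod.reindex inj_on_def axis_eq_axis inner_axis o_def UNIV_2)
    have le: "drop_axis i l \<bullet> b \<le> drop_axis i u \<bullet> b" if "b \<in> Basis" for b
    proof -
      from that obtain k where "b = axis k 1" by (auto simp: Basis_vec_def)
      moreover have "drop_axis i l $ k \<le> drop_axis i u $ k"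
        using lu' exhaust_2[of k] by auto
      ultimately show ?thesis by (simp add: inner_axis)
    qed
    have "emeasure lborel (box (drop_axis i l) (drop_axis i u))
        = ennreal ((u $ (i+1) - l $ (i+1)) * (u $ (i+2) - l $ (i+2)))"
      using le by (simp add: emeasure_lborel_box_eq B2)
    moreover have "emeasure lborel (box (l $ i) (u $ i)) = ennreal (u $ i - l $ i)"
      using lu'[of i] by (simp add: emeasure_lborel_box_eq)
    ultimately show ?thesis
      unfolding B3 using lu' by (simp add: mult_ac flip: ennreal_mult)
  qed
  finally show "emeasure (distr (lborel \<Otimes>\<^sub>M lborel) borel (\<lambda>(y, z). insert_axis i y z)) (box l u)
      = ennreal (\<Prod>b\<in>Basis. (u - l) \<bullet> b)" .
qed simp

text \<open>Fubini with the inner integral along axis \<open>i\<close>, the direction in which a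
  patch is cut off by its graph.\<close>

lemma integral_insert_axis:
  fixes f :: "real^3 \<Rightarrow> real"
  assumes f: "integrable lborel f"
  shows "integrable lborel (\<lambda>y. LINT z|lborel. f (insert_axis i y z))"
    and "(LINT x|lborel. f x) = (LINT y|lborel. LINT z|lborel. f (insert_axis i y z))"
proof -
  have f_meas: "f \<in> borel_measurable borel" using f by auto
  have m: "(\<lambda>(y, z). insert_axis i y z) \<in> lborel \<Otimes>\<^sub>M lborel \<rightarrow>\<^sub>M borel"
    using measurable_insert_axis by (simp cong: measurable_cong_sets)
  have "integrable (lborel \<Otimes>\<^sub>M lborel) (\<lambda>p. f (case p of (y, z) \<Rightarrow> insert_axis i y z))"
    using f by (subst (asm) lborel_insert_axis[of i]) (subst (asm) integrable_distr_eq[OF m f_meas])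
  then have *: "integrable (lborel \<Otimes>\<^sub>M lborel) (\<lambda>(y, z). f (insert_axis i y z))"
    by (simp add: case_prod_beta')
  show "integrable lborel (\<lambda>y. LINT z|lborel. f (insert_axis i y z))"
    using lborel_pair.integrable_fst'[OF *] by simp
  have "(LINT x|lborel. f x) = integral\<^sup>L (lborel \<Otimes>\<^sub>M lborel) (\<lambda>p. f (case p of (y, z) \<Rightarrow> insert_axis i y z))"
    by (subst lborel_insert_axis[of i]) (rule integral_distr[OF m f_meas])
  also have "\<dots> = integral\<^sup>L (lborel \<Otimes>\<^sub>M lborel) (\<lambda>(y, z). f (insert_axis i y z))"
    by (simp add: case_prod_beta')
  finally show "(LINT x|lborel. f x) = (LINT y|lborel. LINT z|lborel. f (insert_axis i y z))"
    using lborel_pair.integral_fst'[OF *] by simp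
qed

section \<open>Functions of class C^1: gradient and local Lipschitz constants\<close>

lemma Ck_on_1_iff:
  "Ck_on 1 f W \<longleftrightarrow> (\<forall>x\<in>W. f differentiable (at x)) \<and> (\<forall>v. continuous_on W (\<lambda>x. frechet_derivative f (at x) v))"
  by simp

lemma Ck_on_1_continuous_on:
  assumes "Ck_on 1 f W" shows "continuous_on W f"
  using assms unfolding Ck_on_1_iff
  by (auto intro!: differentiable_imp_continuous_on simp: differentiable_on_def differentiable_at_withinI)

lemma frechet_derivative_eq_grad:
  fixes f :: "real^'n \<Rightarrow> real"
  assumes "f differentiable (at x)"
  shows "frechet_derivative f (at x) v = grad f x \<bullet> v"
proof -
  interpret linear "frechet_derivative f (at x)"
    using assms by (rule linear_frechet_derivative)
  have "frechet_derivative f (at x) v = frechet_derivative f (at x) (\<Sum>i\<in>UNIV. v $ i *\<^sub>R axis i 1)"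
    using basis_expansion[of v] by (simp add: scalar_mult_eq_scaleR)
  also have "\<dots> = (\<Sum>i\<in>UNIV. v $ i * frechet_derivative f (at x) (axis i 1))"
    by (simp add: sum scale)
  finally show ?thesis by (simp add: grad_def inner_vec_def mult.commute)
qed

lemma Ck_on_1_continuous_on_grad:
  "Ck_on 1 f W \<Longrightarrow> continuous_on W (grad f)"
  unfolding grad_def Ck_on_1_iff by (intro continuous_on_vec_lambda) blast

text \<open>\<open>Ck_on 1\<close> speaks of one direction at a time. Compactness bounds the
  derivative along each basis vector, the sum of these bounds dominates the operator norm, and
  convexity turns it into a Lipschitz constant.\<close>

lemma Ck_on_1_lipschitz_on_compact_convex:
  fixes f :: "'a::euclidean_space \<Rightarrow> 'b::real_normed_vector"
  assumes f: "Ck_on 1 f W" and K: "compact K" "convex K" "K \<subseteq> W"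
  shows "\<exists>L. L-lipschitz_on K f"
proof -
  have "\<exists>B\<ge>0. \<forall>x\<in>K. norm (frechet_derivative f (at x) b) \<le> B" for b
  proof -
    have "continuous_on K (\<lambda>x. frechet_derivative f (at x) b)"
      using f K(3) continuous_on_subset unfolding Ck_on_1_iff by blast
    then have "bounded ((\<lambda>x. frechet_derivative f (at x) b) ` K)"
      by (intro compact_imp_bounded compact_continuous_image K)
    then show ?thesis
      unfolding bounded_pos by (auto intro: less_imp_le)
  qed
  then obtain B where B0: "\<And>b. B b \<ge> 0"
    and B: "\<And>b x. x \<in> K \<Longrightarrow> norm (frechet_derivative f (at x) b) \<le> B b" by metis
  have "(\<Sum>b\<in>Basis. B b)-lipschitz_on K f"
  proof (rule bounded_derivative_imp_lipschitz[OF _ K(2)])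
    show "(f has_derivative frechet_derivative f (at x)) (at x within K)" if "x \<in> K" for x
      using f K(3) that unfolding Ck_on_1_iff
      by (meson frechet_derivative_works has_derivative_at_withinI subsetD)
    show "onorm (frechet_derivative f (at x)) \<le> (\<Sum>b\<in>Basis. B b)" if "x \<in> K" for x
    proof (rule onorm_bound)
      have "linear (frechet_derivative f (at x))"
        using f K(3) that unfolding Ck_on_1_iff by (meson linear_frechet_derivative subsetD)
      then interpret linear "frechet_derivative f (at x)" .
      fix v
      have "norm (frechet_derivative f (at x) v) = norm (\<Sum>b\<in>Basis. (v \<bullet> b) *\<^sub>R frechet_derivative f (at x) b)"
        by (subst euclidean_representation[of v, symmetric]) (simp add: sum scale)
      also have "\<dots> \<le> (\<Sum>b\<in>Basis. norm v * B b)"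
        by (intro sum_norm_le) (auto intro!: mult_mono B that simp: Basis_le_norm)
      finally show "norm (frechet_derivative f (at x) v) \<le> (\<Sum>b\<in>Basis. B b) * norm v"
        by (simp add: sum_distrib_left mult.commute)
    qed (simp add: B0 sum_nonneg)
  qed (simp add: B0 sum_nonneg)
  then show ?thesis by blast
qed

lemma lborel_integral_translate:
  fixes f :: "'a::euclidean_space \<Rightarrow> real"
  assumes "f \<in> borel_measurable borel"
  shows "(LINT x|lborel. f (a + x)) = (LINT x|lborel. f x)"
proof -
  have "(LINT x|lborel. f x) = (LINT x|distr lborel borel ((+) a). f x)"
    by (simp add: lborel_distr_plus)
  also have "\<dots> = (LINT x|lborel. f (a + x))"
    using assms by (subst integral_distr) auto
  finally show ?thesis ..
qed

text \<open>
  Differentiate \<open>h \<mapsto> \<integral>\<^sub>D g (x + h v) dx\<close> at \<open>h = 0\<close> in two ways: under the integral sign, and after a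
  translation, where only the boundary of the shifted domain depends on \<open>h\<close>. No continuity of the
  derivative of \<open>g\<close> is needed.
\<close>

lemma graph_gauss_green:
  fixes g :: "real^3 \<Rightarrow> real" and \<phi> :: "real^2 \<Rightarrow> real"
  assumes s: "s = 1 \<or> s = -1" and \<phi>: "Ck_on 1 \<phi> UNIV"
    and lip: "L-lipschitz_on UNIV g" and supp: "\<And>x. x \<notin> cball 0 R \<Longrightarrow> g x = 0"
    and D: "D = {x. s * x $ i < s * \<phi> (drop_axis i x)}"
    and diff: "\<And>x. x \<in> D \<Longrightarrow> g differentiable (at x)"
  shows "set_integrable lborel D (\<lambda>x. frechet_derivative g (at x) v)"
    and "(LINT x:D|lborel. frechet_derivative g (at x) v)
      = (LINT y|lborel. s * g (insert_axis i y (\<phi> y)) * (v $ i - grad \<phi> y \<bullet> drop_axis i v))"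
proof -
  \<comment> \<open>\<open>A h\<close> integrates the translated function. Undoing the translation
    moves the domain instead: its boundary becomes the graph shifted by \<open>h v\<close>, whose
    height over \<open>y\<close> is \<open>b y h\<close>, and \<open>C h y\<close> is the integral
    over the slice above \<open>y\<close>.\<close>
  define A where "A h = (LINT x:D|lborel. g (x + h *\<^sub>R v))" for h
  define b where "b y h = \<phi> (y - h *\<^sub>R drop_axis i v) + h * v $ i" for y h
  define C where "C h y = (LINT z:{z. s * z < s * b y h}|lborel. g (insert_axis i y z))" for h y
  have \<phi>_cont: "continuous_on S \<phi>" for S
    using Ck_on_1_continuous_on[OF \<phi>] continuous_on_subset by blast
  have g_cont: "continuous_on S g" for S
    using lipschitz_on_continuous_on[OF lip] continuous_on_subset by blast
  then have g_meas: "g \<in> borel_measurable borel" by (intro borel_measurable_continuous_onI)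
  have "open D"
    unfolding D by (intro open_Collect_less continuous_intros continuous_on_compose2[OF \<phi>_cont[of UNIV]]) auto
  then have D_meas: "D \<in> sets borel" by simp
  have L0: "L \<ge> 0" using lip by (rule lipschitz_on_nonneg)
  have g_lip: "\<bar>g x - g y\<bar> \<le> L * norm (x - y)" for x y
    using lipschitz_onD[OF lip, of x y] by (simp add: dist_norm)
  obtain B where B: "\<And>x. \<bar>g x\<bar> \<le> B" and B0: "B \<ge> 0"
  proof -
    have "bounded (g ` cball 0 R)"
      by (intro compact_imp_bounded compact_continuous_image g_cont) simp
    then obtain B where B: "B > 0" "\<And>x. x \<in> cball 0 R \<Longrightarrow> \<bar>g x\<bar> \<le> B"
      unfolding bounded_pos by auto
    have "\<bar>g x\<bar> \<le> B" for x
      using B supp[of x] by (cases "x \<in> cball 0 R") auto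
    then show ?thesis using that[of B] B(1) by auto
  qed
  have ins_supp: "g (insert_axis i y z) = 0" if "norm y > R \<or> \<bar>z\<bar> > R" for y z
  proof (rule supp)
    have "norm y \<le> norm (insert_axis i y z)" "\<bar>z\<bar> \<le> norm (insert_axis i y z)"
      using norm_drop_axis_le[of i "insert_axis i y z"] component_le_norm_cart[of "insert_axis i y z" i] by auto
    then show "insert_axis i y z \<notin> cball 0 R" using that by auto
  qed
  \<comment> \<open>For \<open>\<bar>t\<bar> < 1\<close> the support moves by at most
    \<open>norm v\<close>, so one ball of radius \<open>R + norm v\<close> serves for all
    shifts.\<close>
  have sup_shift: "g (x + t *\<^sub>R v) = 0" if "x \<notin> cball 0 (R + norm v)" "\<bar>t\<bar> < 1" for x t
  proof (rule supp)
    have "norm (t *\<^sub>R v) \<le> 1 * norm v"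
      using that unfolding norm_scaleR by (intro mult_right_mono) auto
    moreover have "norm x - norm (t *\<^sub>R v) \<le> norm (x + t *\<^sub>R v)"
      using norm_diff_ineq[of x "t *\<^sub>R v"] by simp
    ultimately show "x + t *\<^sub>R v \<notin> cball 0 R"
      using that by auto
  qed
  have int_shift: "integrable lborel (\<lambda>x. g (x + t *\<^sub>R v))" if "\<bar>t\<bar> < 1" for t
    by (rule integrable_continuous_bounded_support[of _ "R + norm v"])
      (use sup_shift that in \<open>auto intro!: continuous_intros continuous_on_compose2[OF g_cont[of UNIV]]\<close>)
  have int_cball: "integrable lborel (\<lambda>x. K * indicat_real (cball 0 r) (x::'c::euclidean_space))" for K r
    using emeasure_bounded_finite[of "cball (0::'c) r"]
    by (intro integrable_mult_right integrable_real_indicator) auto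

  note DA = has_real_derivative_set_integral[where M = lborel and A = D and e = 1 and \<tau> = 0
      and f = "\<lambda>t x. g (x + t *\<^sub>R v)" and f' = "\<lambda>x. frechet_derivative g (at x) v"
      and k = "\<lambda>x. L * norm v * indicator (cball 0 (R + norm v)) x"]
  have A1: "set_integrable lborel D (\<lambda>x. g (x + t *\<^sub>R v))" if "\<bar>t - 0\<bar> < 1" for t
    unfolding set_integrable_def using int_shift that D_meas by (intro integrable_mult_indicator) auto
  have A2: "((\<lambda>t. g (x + t *\<^sub>R v)) has_real_derivative frechet_derivative g (at x) v) (at 0)" if "x \<in> D" for x
  proof -
    have g': "(g has_derivative frechet_derivative g (at x)) (at (x + 0 *\<^sub>R v))"
      using diff[OF that] by (simp flip: frechet_derivative_works)
    have "((\<lambda>t. x + t *\<^sub>R v) has_derivative (\<lambda>t. t *\<^sub>R v)) (at 0)"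
      by (auto intro!: derivative_eq_intros)
    from diff_chain_at[OF this g']
    have "((\<lambda>t. g (x + t *\<^sub>R v)) has_derivative (\<lambda>t. frechet_derivative g (at x) (t *\<^sub>R v))) (at 0)"
      by (simp add: o_def)
    then show ?thesis
      unfolding has_field_derivative_def
      using linear_scale[OF linear_frechet_derivative[OF diff[OF that]]] by (simp add: mult_commute_abs)
  qed
  have A3: "set_integrable lborel D (\<lambda>x. L * norm v * indicator (cball 0 (R + norm v)) x)"
    unfolding set_integrable_def using D_meas by (intro integrable_mult_indicator int_cball) auto
  have A4: "\<bar>g (x + t *\<^sub>R v) - g (x + 0 *\<^sub>R v)\<bar> \<le> L * norm v * indicator (cball 0 (R + norm v)) x * \<bar>t - 0\<bar>"
    if "\<bar>t - 0\<bar> < 1" for x t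
  proof (cases "x \<in> cball 0 (R + norm v)")
    case True
    then show ?thesis using g_lip[of "x + t *\<^sub>R v" x] by (simp add: mult_ac)
  next
    case False
    then show ?thesis using sup_shift[of x t] sup_shift[of x 0] that by simp
  qed
  show "set_integrable lborel D (\<lambda>x. frechet_derivative g (at x) v)"
    by (rule DA(1)) (use A1 A2 A3 A4 D_meas in auto)
  have derA: "(A has_real_derivative (LINT x:D|lborel. frechet_derivative g (at x) v)) (at 0)"
    unfolding A_def by (rule DA(2)) (use A1 A2 A3 A4 D_meas in auto)

  have memD: "insert_axis i y z - h *\<^sub>R v \<in> D \<longleftrightarrow> s * z < s * b y h" for y z h
  proof -
    have "drop_axis i (insert_axis i y z - h *\<^sub>R v) = y - h *\<^sub>R drop_axis i v"
      by (simp add: vec_eq_iff forall_2)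
    then have "insert_axis i y z - h *\<^sub>R v \<in> D \<longleftrightarrow> s * (z - h * v $ i) < s * \<phi> (y - h *\<^sub>R drop_axis i v)"
      by (simp add: D)
    then show ?thesis by (simp add: b_def algebra_simps)
  qed
  have AC: "integrable lborel (C h) \<and> A h = (LINT y|lborel. C h y)" for h
  proof -
    let ?f = "\<lambda>x. indicator D (x - h *\<^sub>R v) * g x"
    have f_meas: "?f \<in> borel_measurable borel"
      using g_meas D_meas by measurable
    have "integrable lborel g"
      by (rule integrable_continuous_bounded_support[OF g_cont supp])
    then have f_int: "integrable lborel ?f"
      by (rule Bochner_Integration.integrable_bound)
         (use f_meas in \<open>auto simp: indicator_def\<close>)
    have "A h = (LINT x|lborel. ?f (h *\<^sub>R v + x))"
      unfolding A_def set_lebesgue_integral_def by (simp add: add.commute)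
    also have "\<dots> = (LINT x|lborel. ?f x)"
      by (rule lborel_integral_translate[OF f_meas])
    finally have "A h = (LINT x|lborel. ?f x)" .
    moreover have "(LINT z|lborel. ?f (insert_axis i y z)) = C h y" for y
      unfolding C_def set_lebesgue_integral_def
      by (intro Bochner_Integration.integral_cong) (auto simp: indicator_def memD)
    ultimately show ?thesis
      using integral_insert_axis[OF f_int, of i] by simp
  qed

  \<comment> \<open>\<open>\<phi>\<close> may have no global Lipschitz constant. For
    \<open>\<bar>t\<bar> < 1\<close> and \<open>y\<close> in the ball of radius \<open>R\<close>,
    both arguments of \<open>\<phi>\<close> stay in this larger ball.\<close>
  have "compact (cball (0::real^2) (R + norm v))" "convex (cball (0::real^2) (R + norm v))" by auto
  then obtain K where K: "K-lipschitz_on (cball 0 (R + norm v)) \<phi>"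
    using Ck_on_1_lipschitz_on_compact_convex[OF \<phi>] by blast
  have K0: "K \<ge> 0" using K by (rule lipschitz_on_nonneg)
  define g' where "g' y = s * g (insert_axis i y (\<phi> y)) * (v $ i - grad \<phi> y \<bullet> drop_axis i v)" for y
  note DC = has_real_derivative_integral[where M = lborel and e = 1 and \<tau> = 0 and f = C and f' = g'
      and k = "\<lambda>y. B * ((K + 1) * norm v) * indicator (cball 0 R) y"]
  have gi_cont: "continuous_on UNIV (\<lambda>z. g (insert_axis i y z))" for y
    by (intro continuous_on_compose2[OF g_cont[of UNIV]] continuous_intros) auto
  have C2: "((\<lambda>t. C t y) has_real_derivative g' y) (at 0)" for y
  proof -
    have \<phi>': "(\<phi> has_derivative (\<lambda>w. grad \<phi> y \<bullet> w)) (at (y - 0 *\<^sub>R drop_axis i v))"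
    proof -
      have "\<phi> differentiable (at y)" using \<phi> unfolding Ck_on_1_iff by blast
      then have "(\<phi> has_derivative frechet_derivative \<phi> (at y)) (at y)"
        by (simp flip: frechet_derivative_works)
      moreover have "frechet_derivative \<phi> (at y) = (\<lambda>w. grad \<phi> y \<bullet> w)"
        using \<open>\<phi> differentiable (at y)\<close> by (intro ext frechet_derivative_eq_grad)
      ultimately show ?thesis by simp
    qed
    have "((\<lambda>t. y - t *\<^sub>R drop_axis i v) has_derivative (\<lambda>t. - (t *\<^sub>R drop_axis i v))) (at 0)"
      by (auto intro!: derivative_eq_intros)
    from diff_chain_at[OF this \<phi>']
    have "((\<lambda>t. \<phi> (y - t *\<^sub>R drop_axis i v)) has_real_derivative - (grad \<phi> y \<bullet> drop_axis i v)) (at 0)"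
      unfolding o_def by (rule has_derivative_imp_has_field_derivative) simp
    then have "(b y has_real_derivative (v $ i - grad \<phi> y \<bullet> drop_axis i v)) (at 0)"
      unfolding b_def by (auto intro!: derivative_eq_intros)
    from half_line_integral_has_derivative[OF s gi_cont, of R, OF _ this, of y] ins_supp
    show ?thesis unfolding C_def g'_def by (simp add: b_def)
  qed
  \<comment> \<open>The end point \<open>b y t\<close> moves by at most
    \<open>K * norm v * \<bar>t\<bar>\<close> through \<open>\<phi>\<close> and by at most
    \<open>norm v * \<bar>t\<bar>\<close> through the added height;
    \<open>half_line_integral_diff_le\<close> contributes the factor \<open>B\<close>.\<close>
  have C4: "\<bar>C t y - C 0 y\<bar> \<le> B * ((K + 1) * norm v) * indicator (cball 0 R) y * \<bar>t - 0\<bar>"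
    if t: "\<bar>t - 0\<bar> < 1" for t y
  proof (cases "y \<in> cball 0 R")
    case False
    then have "C h y = 0" for h using ins_supp by (simp add: C_def)
    then show ?thesis using False by simp
  next
    case True
    have "norm (t *\<^sub>R drop_axis i v) \<le> \<bar>t\<bar> * norm v"
      using norm_drop_axis_le[of i v] by (simp add: mult_left_mono)
    moreover have "\<bar>t\<bar> * norm v \<le> 1 * norm v" using t by (intro mult_right_mono) auto
    ultimately have tv: "norm (t *\<^sub>R drop_axis i v) \<le> \<bar>t\<bar> * norm v" "norm (t *\<^sub>R drop_axis i v) \<le> norm v" by auto
    have "norm (y - t *\<^sub>R drop_axis i v) \<le> R + norm v"
      using norm_triangle_ineq4[of y "t *\<^sub>R drop_axis i v"] True tv by auto
    moreover have "norm y \<le> R + norm v" using True by (simp add: add_increasing2)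
    ultimately have "y - t *\<^sub>R drop_axis i v \<in> cball 0 (R + norm v)" "y \<in> cball 0 (R + norm v)"
      by (simp_all only: mem_cball dist_0_norm)
    from lipschitz_onD[OF K this]
    have "\<bar>\<phi> (y - t *\<^sub>R drop_axis i v) - \<phi> y\<bar> \<le> K * norm (t *\<^sub>R drop_axis i v)"
      by (simp add: dist_norm)
    also have "\<dots> \<le> K * (\<bar>t\<bar> * norm v)" using tv K0 by (intro mult_left_mono) auto
    finally have "\<bar>\<phi> (y - t *\<^sub>R drop_axis i v) - \<phi> y\<bar> \<le> K * (\<bar>t\<bar> * norm v)" .
    moreover have "\<bar>t * v $ i\<bar> \<le> \<bar>t\<bar> * norm v"
      using component_le_norm_cart[of v i] by (simp add: abs_mult mult_left_mono)
    ultimately have "\<bar>b y t - b y 0\<bar> \<le> (K + 1) * norm v * \<bar>t\<bar>"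
      unfolding b_def by (simp add: algebra_simps)
    then have "B * \<bar>b y t - b y 0\<bar> \<le> B * ((K + 1) * norm v * \<bar>t\<bar>)"
      using B0 by (intro mult_left_mono)
    moreover have "\<bar>C t y - C 0 y\<bar> \<le> B * \<bar>b y t - b y 0\<bar>"
      unfolding C_def using half_line_integral_diff_le[OF s gi_cont, of R] ins_supp B by blast
    ultimately show ?thesis using True by (simp add: mult_ac)
  qed
  have C3: "integrable lborel (\<lambda>y. B * ((K + 1) * norm v) * indicator (cball 0 R) (y :: real^2))"
    by (rule int_cball)
  have "((\<lambda>h. LINT y|lborel. C h y) has_real_derivative (LINT y|lborel. g' y)) (at 0)"
    by (rule DC(2)) (use AC C2 C3 C4 in auto)
  moreover have "A = (\<lambda>h. LINT y|lborel. C h y)"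
    using AC by (intro ext) simp
  ultimately have "(A has_real_derivative (LINT y|lborel. g' y)) (at 0)"
    by simp
  from DERIV_unique[OF derA this]
  show "(LINT x:D|lborel. frechet_derivative g (at x) v)
      = (LINT y|lborel. s * g (insert_axis i y (\<phi> y)) * (v $ i - grad \<phi> y \<bullet> drop_axis i v))"
    by (simp add: g'_def)
qed

subsection \<open>Normal and surface measure on graph patches\<close>

definition graph_weight :: "(real^2 \<Rightarrow> real) \<Rightarrow> real^2 \<Rightarrow> real" where
  "graph_weight \<phi> y = sqrt (1 + (norm (grad \<phi> y))\<^sup>2)"

text \<open>The normalised gradient of \<open>s * (x $ i - \<phi> (drop_axis i x))\<close>, a
  function that is negative in the patch of the domain and zero on the graph; hence it points
  outwards.\<close>

definition graph_normal :: "3 \<Rightarrow> real \<Rightarrow> (real^2 \<Rightarrow> real) \<Rightarrow> real^2 \<Rightarrow> real^3" where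
  "graph_normal i s \<phi> y = (s / graph_weight \<phi> y) *\<^sub>R insert_axis i (- grad \<phi> y) 1"

lemma graph_weight_pos: "graph_weight \<phi> y > 0"
  unfolding graph_weight_def by (simp add: add_pos_nonneg)

text \<open>Multiplied by the area element \<open>graph_weight \<phi> y\<close> and by
  \<open>g\<close>, this is exactly the boundary integrand of
  \<open>graph_gauss_green\<close>.\<close>

lemma inner_graph_normal:
  "v \<bullet> graph_normal i s \<phi> y = s / graph_weight \<phi> y * (v $ i - grad \<phi> y \<bullet> drop_axis i v)"
  unfolding graph_normal_def inner_scaleR_right
  by (subst inner_axes[of _ _ i]) (simp add: inner_commute)

lemma norm_graph_normal:
  assumes "s = 1 \<or> s = -1" shows "norm (graph_normal i s \<phi> y) = 1"
proof -
  have "(norm (insert_axis i (- grad \<phi> y) 1))\<^sup>2 = (graph_weight \<phi> y)\<^sup>2"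
    by (subst norm_axes[of _ i]) (simp add: graph_weight_def)
  then have "norm (insert_axis i (- grad \<phi> y) 1) = graph_weight \<phi> y"
    using graph_weight_pos[of \<phi> y] by (simp add: power2_eq_iff_nonneg)
  then show ?thesis
    using assms graph_weight_pos[of \<phi> y] by (auto simp: graph_normal_def)
qed

lemma continuous_on_graph_weight:
  "Ck_on 1 \<phi> UNIV \<Longrightarrow> continuous_on UNIV (graph_weight \<phi>)"
  unfolding graph_weight_def by (intro continuous_intros Ck_on_1_continuous_on_grad)

lemma continuous_on_graph_normal:
  "Ck_on 1 \<phi> UNIV \<Longrightarrow> continuous_on UNIV (graph_normal i s \<phi>)"
  unfolding graph_normal_def using graph_weight_pos[of \<phi>]
  by (intro continuous_intros continuous_on_graph_weight Ck_on_1_continuous_on_grad) (auto simp: less_le)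

text \<open>The function \<open>s * (x $ i - \<phi> (drop_axis i x))\<close> vanishes at
  \<open>x\<close> and, by the condition on \<open>v\<close>, has negative slope along
  \<open>v\<close>; inside the open set \<open>U\<close> negative values mean membership in
  \<open>\<Omega>\<close>.\<close>

lemma graph_patch_inward:
  assumes patch: "graph_patch \<Omega> U i s \<phi>" and x: "x \<in> U" "x $ i = \<phi> (drop_axis i x)"
    and v: "s * (v $ i - grad \<phi> (drop_axis i x) \<bullet> drop_axis i v) < 0"
  shows "\<forall>\<^sub>F h in at_right 0. x + h *\<^sub>R v \<in> \<Omega>"
proof -
  let ?y = "drop_axis i x" and ?w = "drop_axis i v"
  have U: "open U" and \<phi>: "\<phi> differentiable (at ?y)"
    and \<Omega>: "\<Omega> \<inter> U = {x \<in> U. s * x $ i < s * \<phi> (drop_axis i x)}"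
    using patch unfolding graph_patch_def Ck_on_1_iff by blast+
  let ?f = "\<lambda>h. s * (x $ i + h * v $ i) - s * \<phi> (?y + h *\<^sub>R ?w)"
  have "(\<phi> has_derivative frechet_derivative \<phi> (at ?y)) (at (?y + 0 *\<^sub>R ?w))"
    using \<phi> by (simp flip: frechet_derivative_works)
  moreover have "((\<lambda>h. ?y + h *\<^sub>R ?w) has_derivative (\<lambda>h. h *\<^sub>R ?w)) (at 0)"
    by (auto intro!: derivative_eq_intros)
  ultimately have "((\<lambda>h. \<phi> (?y + h *\<^sub>R ?w)) has_derivative (\<lambda>h. frechet_derivative \<phi> (at ?y) (h *\<^sub>R ?w))) (at 0)"
    using diff_chain_at unfolding o_def by fast
  then have "((\<lambda>h. \<phi> (?y + h *\<^sub>R ?w)) has_real_derivative (grad \<phi> ?y \<bullet> ?w)) (at 0)"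
    by (rule has_derivative_imp_has_field_derivative) (simp add: frechet_derivative_eq_grad[OF \<phi>])
  then have "(?f has_real_derivative (s * (v $ i - grad \<phi> ?y \<bullet> ?w))) (at 0)"
    by (auto intro!: derivative_eq_intros simp: algebra_simps)
  from DERIV_neg_dec_right[OF this v] x(2)
  obtain d where d: "d > 0" "\<And>h. 0 < h \<Longrightarrow> h < d \<Longrightarrow> ?f h < 0" by auto
  then have "\<forall>\<^sub>F h in at_right 0. ?f h < 0"
    unfolding eventually_at_right_field by blast
  moreover have "\<forall>\<^sub>F h in at_right 0. x + h *\<^sub>R v \<in> U"
  proof -
    have "((\<lambda>h. x + h *\<^sub>R v) \<longlongrightarrow> x + 0 *\<^sub>R v) (at_right 0)" by (intro tendsto_intros)
    then show ?thesis using topological_tendstoD[OF _ U] x(1) by simp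
  qed
  ultimately show ?thesis
  proof eventually_elim
    case (elim h)
    have "drop_axis i (x + h *\<^sub>R v) = ?y + h *\<^sub>R ?w" by (simp add: vec_eq_iff forall_2)
    then have "x + h *\<^sub>R v \<in> \<Omega> \<inter> U" using elim unfolding \<Omega> by simp
    then show ?case by simp
  qed
qed

text \<open>Points of \<open>U\<close> strictly beyond the graph have a neighbourhood missing
  \<open>\<Omega>\<close>. Points on the graph are limits of points of \<open>\<Omega>\<close>
  without belonging to it, the inequality in \<open>graph_patch\<close> being strict.\<close>

lemma frontier_graph_patch:
  assumes patch: "graph_patch \<Omega> U i s \<phi>" and "open \<Omega>"
  shows "frontier \<Omega> \<inter> U = {x \<in> U. x $ i = \<phi> (drop_axis i x)}"
proof (intro set_eqI iffI)
  have U: "open U" and s: "s = 1 \<or> s = -1" and \<phi>: "Ck_on 1 \<phi> UNIV"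
    and \<Omega>: "\<Omega> \<inter> U = {x \<in> U. s * x $ i < s * \<phi> (drop_axis i x)}"
    using patch unfolding graph_patch_def by blast+
  have frontier: "frontier \<Omega> = closure \<Omega> - \<Omega>"
    using \<open>open \<Omega>\<close> by (simp add: frontier_def interior_open)
  fix x
  {
    assume x: "x \<in> frontier \<Omega> \<inter> U"
    let ?V = "U \<inter> {x. s * \<phi> (drop_axis i x) < s * x $ i}"
    have "open ?V"
      by (intro open_Int U open_Collect_less continuous_intros
          continuous_on_compose2[OF Ck_on_1_continuous_on[OF \<phi>]]) auto
    moreover have "?V \<inter> \<Omega> = {}" using \<Omega> by force
    ultimately have "?V \<inter> closure \<Omega> = {}" by (simp add: open_Int_closure_eq_empty)
    then have "\<not> s * \<phi> (drop_axis i x) < s * x $ i" using x frontier by blast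
    moreover have "\<not> s * x $ i < s * \<phi> (drop_axis i x)" using x frontier \<Omega> by blast
    ultimately show "x \<in> {x \<in> U. x $ i = \<phi> (drop_axis i x)}" using x s by auto
  next
    assume x: "x \<in> {x \<in> U. x $ i = \<phi> (drop_axis i x)}"
    \<comment> \<open>Straight into the domain: the slope \<open>s * (- s)\<close> is -1 for either
      orientation.\<close>
    let ?v = "insert_axis i 0 (- s)"
    have "\<forall>\<^sub>F h in at_right 0. x + h *\<^sub>R ?v \<in> \<Omega>"
      using x s by (intro graph_patch_inward[OF patch]) auto
    then have "\<forall>\<^sub>F h in at_right 0. x + h *\<^sub>R ?v \<in> closure \<Omega>"
      by (rule eventually_mono) (use closure_subset in blast)
    moreover have "((\<lambda>h. x + h *\<^sub>R ?v) \<longlongrightarrow> x + 0 *\<^sub>R ?v) (at_right 0)" by (intro tendsto_intros)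
    ultimately have "x + 0 *\<^sub>R ?v \<in> closure \<Omega>"
      by (intro Lim_in_closed_set[OF closed_closure _ trivial_limit_at_right_real])
    moreover have "x \<notin> \<Omega> \<inter> U" unfolding \<Omega> using x by simp
    ultimately show "x \<in> frontier \<Omega> \<inter> U" using x frontier by simp
  }
qed

text \<open>Distinct unit vectors have inner product below 1. So if \<open>\<nu>\<close> differed
  from the graph normal \<open>N\<close>, the direction \<open>\<nu> - N\<close> would have negative
  product with \<open>N\<close>, leading into \<open>\<Omega>\<close>, and positive product with
  \<open>\<nu>\<close>, leading out of it.\<close>

lemma outward_unit_normal_graph_patch:
  assumes patch: "graph_patch \<Omega> U i s \<phi>" and "open \<Omega>" and x: "x \<in> frontier \<Omega> \<inter> U"
    and \<nu>: "outward_unit_normal \<Omega> x \<nu>"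
  shows "\<nu> = graph_normal i s \<phi> (drop_axis i x)" (is "\<nu> = ?N")
proof (rule ccontr)
  assume ne: "\<nu> \<noteq> ?N"
  have s: "s = 1 \<or> s = -1" using patch unfolding graph_patch_def by blast
  have norms: "\<nu> \<bullet> \<nu> = 1" "?N \<bullet> ?N = 1"
    using \<nu> norm_graph_normal[OF s] by (auto simp: outward_unit_normal_def dot_square_norm)
  have "0 < (\<nu> - ?N) \<bullet> (\<nu> - ?N)" using ne by simp
  then have less: "\<nu> \<bullet> ?N < 1"
    using norms by (simp add: inner_diff inner_commute)
  let ?v = "\<nu> - ?N"
  have "?v \<bullet> ?N < 0" using less norms by (simp add: inner_diff_left)
  then have "s * (?v $ i - grad \<phi> (drop_axis i x) \<bullet> drop_axis i ?v) < 0"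
    using graph_weight_pos[of \<phi> "drop_axis i x"] unfolding inner_graph_normal
    by (simp add: divide_less_0_iff mult_less_0_iff zero_less_mult_iff)
  then have "\<forall>\<^sub>F h in at_right 0. x + h *\<^sub>R ?v \<in> \<Omega>"
    using x frontier_graph_patch[OF patch \<open>open \<Omega>\<close>] by (intro graph_patch_inward[OF patch]) auto
  moreover have "?v \<bullet> \<nu> > 0" using less norms by (simp add: inner_diff inner_commute)
  then have "\<forall>\<^sub>F h in at_right 0. x + h *\<^sub>R ?v \<notin> \<Omega>"
    using \<nu> unfolding outward_unit_normal_def by blast
  ultimately have "\<forall>\<^sub>F h in at_right (0::real). False" by eventually_elim simp
  then show False by simp
qed

text \<open>Near each boundary point \<open>n\<close> agrees on the frontier with the normal of one
  graph, which is continuous.\<close>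

lemma continuous_on_outward_unit_normal:
  assumes \<Omega>: "C1_domain \<Omega>" and n: "\<And>x. x \<in> frontier \<Omega> \<Longrightarrow> outward_unit_normal \<Omega> x (n x)"
  shows "continuous_on (frontier \<Omega>) n"
  unfolding continuous_on_eq_continuous_within
proof
  fix x assume x: "x \<in> frontier \<Omega>"
  obtain U i s \<phi> where U: "x \<in> U" and patch: "graph_patch \<Omega> U i s \<phi>"
    using \<Omega> x unfolding C1_domain_def by blast
  have "open \<Omega>" using \<Omega> unfolding C1_domain_def by blast
  have "open U" and \<phi>: "Ck_on 1 \<phi> UNIV" using patch unfolding graph_patch_def by blast+
  have "continuous_on UNIV (\<lambda>x. graph_normal i s \<phi> (drop_axis i x))"
    by (intro continuous_on_compose2[OF continuous_on_graph_normal[OF \<phi>]] continuous_intros) auto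
  then have "continuous (at x within frontier \<Omega>) (\<lambda>x. graph_normal i s \<phi> (drop_axis i x))"
    by (meson UNIV_I continuous_on_eq_continuous_within continuous_within_subset subset_UNIV)
  moreover have "\<forall>\<^sub>F y in at x within frontier \<Omega>. graph_normal i s \<phi> (drop_axis i y) = n y"
    unfolding eventually_at_topological
    using outward_unit_normal_graph_patch[OF patch \<open>open \<Omega>\<close> _ n] \<open>open U\<close> U by (metis IntI)
  ultimately show "continuous (at x within frontier \<Omega>) n"
    using outward_unit_normal_graph_patch[OF patch \<open>open \<Omega>\<close> _ n] x U
    unfolding continuous_within by (auto elim: Lim_transform_eventually)
qed

lemma surface_measure_patchD:
  assumes "surface_measure \<Omega> S" "graph_patch \<Omega> U i s \<phi>" "A \<in> sets borel" "A \<subseteq> frontier \<Omega> \<inter> U"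
  shows "emeasure S A = (\<integral>\<^sup>+y\<in>drop_axis i ` A. ennreal (graph_weight \<phi> y) \<partial>lborel)"
  using assms unfolding surface_measure_def graph_weight_def by simp

text \<open>\<open>surface_measure\<close> speaks of images under \<open>drop_axis\<close>. That map
  is injective on the graph, so such an image is a preimage under the parametrisation and the
  measure becomes a pushforward. The indicator removes the part of the graph outside
  \<open>U\<close>, which need not lie on the frontier.\<close>

lemma surface_measure_graph_patch:
  assumes S: "surface_measure \<Omega> S" and "open \<Omega>" and patch: "graph_patch \<Omega> U i s \<phi>"
  shows "density S (indicator (frontier \<Omega> \<inter> U))
    = distr (density lborel (\<lambda>y. ennreal (graph_weight \<phi> y) * indicator U (insert_axis i y (\<phi> y))))
        borel (\<lambda>y. insert_axis i y (\<phi> y))"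
    (is "?S = distr (density lborel ?w) borel ?\<gamma>")
proof (rule measure_eqI)
  have setsS: "sets S = sets borel" using S unfolding surface_measure_def by blast
  have "open U" and \<phi>: "Ck_on 1 \<phi> UNIV" using patch unfolding graph_patch_def by blast+
  have \<gamma>_meas: "?\<gamma> \<in> borel \<rightarrow>\<^sub>M borel"
    by (intro borel_measurable_continuous_onI continuous_intros Ck_on_1_continuous_on[OF \<phi>])
  have weight_meas: "graph_weight \<phi> \<in> borel \<rightarrow>\<^sub>M borel"
    by (intro borel_measurable_continuous_onI continuous_on_graph_weight[OF \<phi>])
  have U_meas: "U \<in> sets borel" using \<open>open U\<close> by simp
  have ind_meas: "(\<lambda>y. indicator U (?\<gamma> y)) \<in> borel_measurable borel"
    using measurable_compose[OF \<gamma>_meas borel_measurable_indicator[OF U_meas]] .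
  have w_meas: "?w \<in> borel_measurable borel"
    using weight_meas by (intro borel_measurable_times_ennreal ind_meas) auto
  show "sets ?S = sets (distr (density lborel ?w) borel ?\<gamma>)" by (simp add: setsS)
  fix A assume "A \<in> sets ?S"
  then have A: "A \<in> sets borel" by (simp add: setsS)
  let ?A = "A \<inter> (frontier \<Omega> \<inter> U)"
  have fU: "frontier \<Omega> \<inter> U \<in> sets borel" using \<open>open U\<close> by auto
  have A': "?A \<in> sets borel" using A fU by auto
  have "emeasure ?S A = emeasure S ?A"
  proof -
    have "emeasure ?S A = (\<integral>\<^sup>+x. indicator (frontier \<Omega> \<inter> U) x * indicator A x \<partial>S)"
      using A fU setsS by (intro emeasure_density) auto
    also have "\<dots> = (\<integral>\<^sup>+x. indicator ?A x \<partial>S)"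
      by (intro nn_integral_cong) (auto simp: indicator_def)
    also have "\<dots> = emeasure S ?A" using A' setsS by (intro nn_integral_indicator) auto
    finally show ?thesis .
  qed
  also have "\<dots> = (\<integral>\<^sup>+y\<in>drop_axis i ` ?A. ennreal (graph_weight \<phi> y) \<partial>lborel)"
    using A' by (intro surface_measure_patchD[OF S patch]) auto
  also have "\<dots> = (\<integral>\<^sup>+y. ?w y * indicator (?\<gamma> -` A) y \<partial>lborel)"
  proof (intro nn_integral_cong)
    fix y
    have "y \<in> drop_axis i ` ?A \<longleftrightarrow> ?\<gamma> y \<in> U \<and> ?\<gamma> y \<in> A"
    proof
      assume "y \<in> drop_axis i ` ?A"
      then obtain x where x: "x \<in> A" "x \<in> frontier \<Omega> \<inter> U" "y = drop_axis i x" by blast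
      then have "?\<gamma> y = x"
        using frontier_graph_patch[OF patch \<open>open \<Omega>\<close>] insert_axis_drop_axis[of i x] by auto
      then show "?\<gamma> y \<in> U \<and> ?\<gamma> y \<in> A" using x by auto
    next
      assume "?\<gamma> y \<in> U \<and> ?\<gamma> y \<in> A"
      moreover from this have "?\<gamma> y \<in> frontier \<Omega> \<inter> U"
        unfolding frontier_graph_patch[OF patch \<open>open \<Omega>\<close>] by simp
      ultimately show "y \<in> drop_axis i ` ?A"
        by (intro image_eqI[of _ _ "?\<gamma> y"]) auto
    qed
    then show "ennreal (graph_weight \<phi> y) * indicator (drop_axis i ` ?A) y = ?w y * indicator (?\<gamma> -` A) y"
      by (auto simp: indicator_def)
  qed
  also have "\<dots> = emeasure (distr (density lborel ?w) borel ?\<gamma>) A"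
    using A \<gamma>_meas w_meas measurable_sets[OF \<gamma>_meas A]
    by (subst emeasure_distr) (auto simp: emeasure_density)
  finally show "emeasure ?S A = emeasure (distr (density lborel ?w) borel ?\<gamma>) A" .
qed

text \<open>The integrands of interest contain the normal field, which is specified on the frontier
  only. The indicator of \<open>U\<close> keeps just those graph points that lie on the frontier, so
  values of \<open>f\<close> elsewhere do not enter.\<close>

lemma surface_integral_graph_patch:
  fixes f :: "real^3 \<Rightarrow> real"
  assumes S: "surface_measure \<Omega> S" and "open \<Omega>" and patch: "graph_patch \<Omega> U i s \<phi>"
    and f: "set_borel_measurable borel (frontier \<Omega>) f"
    and f0: "\<And>x. x \<in> frontier \<Omega> - U \<Longrightarrow> f x = 0"
  shows "(LINT x:frontier \<Omega>|S. f x)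
    = (LINT y|lborel. graph_weight \<phi> y * (indicator U (insert_axis i y (\<phi> y)) * f (insert_axis i y (\<phi> y))))"
proof -
  let ?\<gamma> = "\<lambda>y. insert_axis i y (\<phi> y)"
  have setsS: "sets S = sets borel" using S unfolding surface_measure_def by blast
  have "open U" and \<phi>: "Ck_on 1 \<phi> UNIV" using patch unfolding graph_patch_def by blast+
  have \<gamma>_meas: "?\<gamma> \<in> borel \<rightarrow>\<^sub>M borel"
    by (intro borel_measurable_continuous_onI continuous_intros Ck_on_1_continuous_on[OF \<phi>])
  have weight_meas: "graph_weight \<phi> \<in> borel \<rightarrow>\<^sub>M borel"
    by (intro borel_measurable_continuous_onI continuous_on_graph_weight[OF \<phi>])
  have U_meas: "U \<in> sets borel" using \<open>open U\<close> by simp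
  let ?F = "\<lambda>x. indicator (frontier \<Omega>) x * f x"
  have F: "?F \<in> borel_measurable borel" using f unfolding set_borel_measurable_def by simp
  then have FS: "?F \<in> borel_measurable S" using setsS by (simp cong: measurable_cong_sets)
  have fU: "frontier \<Omega> \<inter> U \<in> sets S" using \<open>open U\<close> setsS by auto
  have ind: "(\<lambda>y. indicat_real U (?\<gamma> y)) \<in> borel_measurable borel"
    using measurable_compose[OF \<gamma>_meas borel_measurable_indicator[OF U_meas]] .
  have "(LINT x:frontier \<Omega>|S. f x) = (LINT x|S. indicat_real (frontier \<Omega> \<inter> U) x *\<^sub>R ?F x)"
    unfolding set_lebesgue_integral_def
    by (intro Bochner_Integration.integral_cong) (auto simp: indicator_def f0)
  also have "\<dots> = (LINT x|density S (\<lambda>x. ennreal (indicat_real (frontier \<Omega> \<inter> U) x)). ?F x)"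
    by (rule integral_density[symmetric, OF FS]) (use fU in auto)
  also have "\<dots> = (LINT x|density S (indicator (frontier \<Omega> \<inter> U)). ?F x)"
    by (simp add: ennreal_indicator)
  also have "\<dots> = (LINT x|distr (density lborel (\<lambda>y. ennreal (graph_weight \<phi> y * indicator U (?\<gamma> y)))) borel ?\<gamma>. ?F x)"
    using graph_weight_pos[of \<phi>]
    by (simp add: surface_measure_graph_patch[OF S \<open>open \<Omega>\<close> patch] ennreal_mult less_imp_le flip: ennreal_indicator)
  also have "\<dots> = (LINT y|density lborel (\<lambda>y. ennreal (graph_weight \<phi> y * indicator U (?\<gamma> y))). ?F (?\<gamma> y))"
    using \<gamma>_meas F by (intro integral_distr) auto
  also have "\<dots> = (LINT y|lborel. (graph_weight \<phi> y * indicator U (?\<gamma> y)) *\<^sub>R ?F (?\<gamma> y))"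
    using measurable_compose[OF \<gamma>_meas F] weight_meas ind graph_weight_pos[of \<phi>]
    by (intro integral_density) (auto simp: less_imp_le)
  also have "\<dots> = (LINT y|lborel. graph_weight \<phi> y * (indicator U (?\<gamma> y) * f (?\<gamma> y)))"
  proof (intro Bochner_Integration.integral_cong refl)
    fix y
    have "?\<gamma> y \<in> frontier \<Omega> \<inter> U" if "?\<gamma> y \<in> U"
      using that unfolding frontier_graph_patch[OF patch \<open>open \<Omega>\<close>] by simp
    then show "(graph_weight \<phi> y * indicat_real U (?\<gamma> y)) *\<^sub>R ?F (?\<gamma> y)
        = graph_weight \<phi> y * (indicator U (?\<gamma> y) * f (?\<gamma> y))"
      by (auto simp: indicator_def)
  qed
  finally show ?thesis .
qed

text \<open>Compactness of the frontier: a small closed ball inside a patch projects to a bounded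
  part of the plane, where the continuous area element is bounded, and finitely many such balls
  cover.\<close>

lemma surface_measure_finite:
  assumes S: "surface_measure \<Omega> S" and \<Omega>: "C1_domain \<Omega>" "bounded \<Omega>"
  shows "emeasure S (frontier \<Omega>) < \<infinity>"
proof -
  have setsS: "sets S = sets borel" using S unfolding surface_measure_def by blast
  have loc: "\<exists>r>0. emeasure S (frontier \<Omega> \<inter> cball x r) < \<infinity>" if x: "x \<in> frontier \<Omega>" for x
  proof -
    obtain U i s \<phi> where U: "x \<in> U" and patch: "graph_patch \<Omega> U i s \<phi>"
      using \<Omega> x unfolding C1_domain_def by blast
    have "open U" and \<phi>: "Ck_on 1 \<phi> UNIV" using patch unfolding graph_patch_def by blast+
    obtain r where r: "r > 0" "cball x r \<subseteq> U"
      using \<open>open U\<close> U open_contains_cball by blast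
    let ?A = "frontier \<Omega> \<inter> cball x r"
    have A: "?A \<in> sets borel" by auto
    have "bounded (drop_axis i ` cball x r)"
      using bounded_linear_image[OF bounded_cball bounded_linear_drop_axis] .
    then obtain R where R: "drop_axis i ` cball x r \<subseteq> cball 0 R"
      unfolding bounded_iff by (auto simp: subset_iff)
    have "bounded (graph_weight \<phi> ` cball 0 R)"
      using continuous_on_graph_weight[OF \<phi>] continuous_on_subset
      by (intro compact_imp_bounded compact_continuous_image) auto
    then obtain B where B: "\<And>y. y \<in> cball 0 R \<Longrightarrow> graph_weight \<phi> y \<le> B"
      unfolding bounded_real by (metis abs_le_D1 imageI)
    have "emeasure S ?A = (\<integral>\<^sup>+y\<in>drop_axis i ` ?A. ennreal (graph_weight \<phi> y) \<partial>lborel)"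
      using A r by (intro surface_measure_patchD[OF S patch]) auto
    also have "\<dots> \<le> (\<integral>\<^sup>+y. ennreal B * indicator (cball 0 R) (y :: real^2) \<partial>lborel)"
    proof (rule nn_integral_mono)
      fix y
      have "y \<in> cball 0 R" if "y \<in> drop_axis i ` ?A" using that R by blast
      then show "ennreal (graph_weight \<phi> y) * indicator (drop_axis i ` ?A) y \<le> ennreal B * indicator (cball 0 R) y"
        using ennreal_leI[OF B[of y]] by (cases "y \<in> drop_axis i ` ?A") auto
    qed
    also have "\<dots> = ennreal B * emeasure lborel (cball (0::real^2) R)"
      by (intro nn_integral_cmult_indicator) auto
    also have "\<dots> < \<infinity>"
      using emeasure_bounded_finite[of "cball (0::real^2) R"] by (simp add: ennreal_mult_less_top)
    finally show ?thesis using r by blast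
  qed
  then obtain r where r: "\<And>x. x \<in> frontier \<Omega> \<Longrightarrow> r x > 0"
    "\<And>x. x \<in> frontier \<Omega> \<Longrightarrow> emeasure S (frontier \<Omega> \<inter> cball x (r x)) < \<infinity>" by metis
  have "compact (frontier \<Omega>)" using \<Omega>(2) by (rule compact_frontier_bounded)
  moreover have "frontier \<Omega> \<subseteq> (\<Union>x\<in>frontier \<Omega>. ball x (r x))" using r(1) by force
  ultimately obtain A where A: "A \<subseteq> frontier \<Omega>" "finite A" "frontier \<Omega> \<subseteq> (\<Union>x\<in>A. ball x (r x))"
    using compactE_image[of "frontier \<Omega>" "frontier \<Omega>" "\<lambda>x. ball x (r x)"] open_ball by blast
  have sets: "frontier \<Omega> \<inter> cball x (r x) \<in> sets S" for x
    unfolding setsS by (intro sets.Int borel_closed) auto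
  have "emeasure S (frontier \<Omega>) \<le> emeasure S (\<Union>x\<in>A. frontier \<Omega> \<inter> cball x (r x))"
  proof (intro emeasure_mono)
    show "frontier \<Omega> \<subseteq> (\<Union>x\<in>A. frontier \<Omega> \<inter> cball x (r x))"
    proof
      fix y assume y: "y \<in> frontier \<Omega>"
      then obtain x where "x \<in> A" "y \<in> ball x (r x)" using A(3) by blast
      then show "y \<in> (\<Union>x\<in>A. frontier \<Omega> \<inter> cball x (r x))" using y by (auto intro!: bexI[of _ x])
    qed
    show "(\<Union>x\<in>A. frontier \<Omega> \<inter> cball x (r x)) \<in> sets S"
      using A(2) sets by (rule sets.finite_UN)
  qed
  also have "\<dots> \<le> (\<Sum>x\<in>A. emeasure S (frontier \<Omega> \<inter> cball x (r x)))"
    using sets by (intro emeasure_subadditive_finite[OF A(2)] image_subsetI)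
  also have "\<dots> < \<infinity>" using r(2) A(1) by (subst infinity_ennreal_def, subst ennreal_sum_less_top[OF A(2)]) auto
  finally show ?thesis .
qed

lemma set_integrable_frontier_continuous:
  fixes f :: "real^3 \<Rightarrow> real"
  assumes S: "surface_measure \<Omega> S" and \<Omega>: "C1_domain \<Omega>" "bounded \<Omega>"
    and f: "continuous_on (frontier \<Omega>) f"
  shows "set_integrable S (frontier \<Omega>) f"
proof -
  have setsS: "sets S = sets borel" using S unfolding surface_measure_def by blast
  have "compact (frontier \<Omega>)" using \<Omega>(2) by (rule compact_frontier_bounded)
  then have "bounded (f ` frontier \<Omega>)"
    by (intro compact_imp_bounded compact_continuous_image f)
  then obtain B where B: "\<And>x. x \<in> frontier \<Omega> \<Longrightarrow> \<bar>f x\<bar> \<le> B"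
    unfolding bounded_real by (metis imageI)
  have "set_integrable S (frontier \<Omega>) (\<lambda>_. B)"
    using surface_measure_finite[OF S \<Omega>] setsS
    by (auto simp: set_integrable_def intro!: integrable_real_indicator)
  moreover have "(\<lambda>x. indicator (frontier \<Omega>) x *\<^sub>R f x) \<in> borel_measurable borel"
    by (rule borel_measurable_continuous_on_indicator[OF _ f]) auto
  then have "set_borel_measurable S (frontier \<Omega>) f"
    unfolding set_borel_measurable_def using setsS by (simp cong: measurable_cong_sets)
  ultimately show ?thesis
    by (rule set_integrable_bound) (use B in force)
qed

subsection \<open>Lipschitz products and bump functions\<close>

lemma lipschitz_on_mult_exists:
  fixes f g :: "'a::metric_space \<Rightarrow> real"
  assumes f: "L-lipschitz_on S f" and g: "K-lipschitz_on S g" and S: "bounded S"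
  shows "\<exists>M. M-lipschitz_on S (\<lambda>x. f x * g x)"
proof -
  obtain x0 R where R: "\<And>x. x \<in> S \<Longrightarrow> dist x0 x \<le> R"
    using S unfolding bounded_def by blast
  have bound: "\<exists>B\<ge>0. \<forall>x\<in>S. \<bar>h x\<bar> \<le> B" if h: "N-lipschitz_on S h" for h :: "'a \<Rightarrow> real" and N
  proof (cases "S = {}")
    case False
    then obtain a where a: "a \<in> S" by blast
    have N: "N \<ge> 0" using h by (rule lipschitz_on_nonneg)
    have "\<bar>h x\<bar> \<le> \<bar>h a\<bar> + N * (2 * \<bar>R\<bar>)" if "x \<in> S" for x
    proof -
      have "dist x a \<le> 2 * \<bar>R\<bar>"
        using dist_triangle2[of x a x0] R[OF that] R[OF a] by (simp add: dist_commute)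
      then have "\<bar>h x - h a\<bar> \<le> N * (2 * \<bar>R\<bar>)"
        using lipschitz_onD[OF h that a] N mult_left_mono[of "dist x a" "2 * \<bar>R\<bar>" N]
        by (simp add: dist_real_def)
      then show ?thesis by linarith
    qed
    then show ?thesis using N by (intro exI[of _ "\<bar>h a\<bar> + N * (2 * \<bar>R\<bar>)"]) auto
  qed auto
  obtain B where B: "B \<ge> 0" "\<And>x. x \<in> S \<Longrightarrow> \<bar>f x\<bar> \<le> B" using bound[OF f] by blast
  obtain C where C: "C \<ge> 0" "\<And>x. x \<in> S \<Longrightarrow> \<bar>g x\<bar> \<le> C" using bound[OF g] by blast
  have "(L * C + B * K)-lipschitz_on S (\<lambda>x. f x * g x)"
  proof (rule lipschitz_onI)
    fix x y assume xy: "x \<in> S" "y \<in> S"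
    have "f x * g x - f y * g y = (f x - f y) * g x + f y * (g x - g y)" by (simp add: algebra_simps)
    then have "\<bar>f x * g x - f y * g y\<bar> \<le> \<bar>f x - f y\<bar> * \<bar>g x\<bar> + \<bar>f y\<bar> * \<bar>g x - g y\<bar>"
      using abs_triangle_ineq[of "(f x - f y) * g x" "f y * (g x - g y)"] by (simp add: abs_mult)
    also have "\<dots> \<le> (L * dist x y) * C + B * (K * dist x y)"
      using lipschitz_onD[OF f xy] lipschitz_onD[OF g xy] B C xy
        lipschitz_on_nonneg[OF f] lipschitz_on_nonneg[OF g]
      by (intro add_mono mult_mono) (auto simp: dist_real_def)
    finally show "dist (f x * g x) (f y * g y) \<le> (L * C + B * K) * dist x y"
      by (simp add: dist_real_def algebra_simps)
  qed (use B C lipschitz_on_nonneg[OF f] lipschitz_on_nonneg[OF g] in auto)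
  then show ?thesis by blast
qed

text \<open>\<open>f\<close> is uncontrolled outside \<open>S\<close>. For \<open>x\<close> in
  \<open>S\<close> and \<open>y\<close> outside, the vanishing of \<open>\<psi>\<close> at
  \<open>y\<close> bounds \<open>\<psi> x\<close> by \<open>K * dist x y\<close>, while
  \<open>f\<close> is bounded on \<open>S\<close>.\<close>

lemma lipschitz_on_UNIV_mult_support:
  fixes f \<psi> :: "'a::metric_space \<Rightarrow> real"
  assumes f: "L-lipschitz_on S f" and \<psi>: "K-lipschitz_on UNIV \<psi>" and S: "bounded S"
    and supp: "\<And>x. x \<notin> S \<Longrightarrow> \<psi> x = 0"
  shows "\<exists>M. M-lipschitz_on UNIV (\<lambda>x. \<psi> x * f x)"
proof (cases "S = {}")
  case True
  then have "\<psi> = (\<lambda>_. 0)" using supp by auto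
  then show ?thesis using lipschitz_on_constant by auto
next
  case False
  then obtain a where a: "a \<in> S" by blast
  obtain R where R: "\<And>x. x \<in> S \<Longrightarrow> dist x a \<le> R" "R \<ge> 0"
    using S unfolding bounded_any_center[of _ a] by (metis a dist_commute dist_self)
  obtain M where M: "M-lipschitz_on S (\<lambda>x. \<psi> x * f x)"
    using lipschitz_on_mult_exists[OF lipschitz_on_subset[OF \<psi>] f S] by blast
  have L0: "L \<ge> 0" and K0: "K \<ge> 0" and M0: "M \<ge> 0"
    using f \<psi> M by (auto intro: lipschitz_on_nonneg)
  define B where "B = \<bar>f a\<bar> + L * R"
  have B0: "B \<ge> 0" using L0 R by (simp add: B_def)
  have B: "\<bar>f x\<bar> \<le> B" if "x \<in> S" for x
    using lipschitz_onD[OF f that a] mult_left_mono[OF R(1)[OF that] L0]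
    by (simp add: B_def dist_real_def)
  have cross: "\<bar>\<psi> x * f x\<bar> \<le> K * B * dist x y" if "x \<in> S" "y \<notin> S" for x y
  proof -
    have "\<bar>\<psi> x\<bar> \<le> K * dist x y"
      using lipschitz_onD[OF \<psi>, of x y] supp[OF that(2)] by (simp add: dist_real_def)
    then have "\<bar>\<psi> x\<bar> * \<bar>f x\<bar> \<le> (K * dist x y) * B"
      using B[OF that(1)] K0 by (intro mult_mono) auto
    then show ?thesis by (simp add: abs_mult mult_ac)
  qed
  have "(M + K * B)-lipschitz_on UNIV (\<lambda>x. \<psi> x * f x)"
  proof (rule lipschitz_onI)
    fix x y :: 'a
    have MKB: "M * dist x y \<ge> 0" "K * B * dist x y \<ge> 0" using M0 K0 B0 by auto
    consider "x \<in> S" "y \<in> S" | "x \<in> S" "y \<notin> S" | "x \<notin> S" "y \<in> S" | "x \<notin> S" "y \<notin> S" by blast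
    then have "\<bar>\<psi> x * f x - \<psi> y * f y\<bar> \<le> M * dist x y + K * B * dist x y"
    proof cases
      case 1
      then show ?thesis using lipschitz_onD[OF M 1] MKB by (simp add: dist_real_def)
    next
      case 2
      then show ?thesis using cross[OF 2] supp[OF 2(2)] MKB by simp
    next
      case 3
      then show ?thesis using cross[OF 3(2,1)] supp[OF 3(1)] MKB by (simp add: dist_commute)
    next
      case 4
      then show ?thesis using supp MKB by simp
    qed
    then show "dist (\<psi> x * f x) (\<psi> y * f y) \<le> (M + K * B) * dist x y"
      by (simp add: dist_real_def algebra_simps)
  qed (use M0 K0 B0 in auto)
  then show ?thesis by blast
qed

text \<open>The cubic \<open>z\<^sup>2 * (3 - 2 * z)\<close> has zero slope at 0 and 1 and so
  smooths the two kinks of a clamped radial profile. The centre, where the norm is not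
  differentiable, lies where the profile is constantly 1.\<close>

lemma differentiable_bump:
  fixes a :: "'a::euclidean_space"
  assumes r: "r > 0"
  obtains \<psi> :: "'a \<Rightarrow> real" and K where "\<And>x. \<psi> differentiable (at x)" "K-lipschitz_on UNIV \<psi>"
    "\<And>x. x \<in> ball a (r / 2) \<Longrightarrow> \<psi> x = 1" "\<And>x. x \<notin> cball a r \<Longrightarrow> \<psi> x = 0"
proof
  \<comment> \<open>The unclamped profile is 1 at distance \<open>r / 2\<close> and 0 at distance
    \<open>r\<close>.\<close>
  define z where "z x = max 0 (min 1 (2 - 2 / r * norm (x - a)))" for x
  define \<psi> where "\<psi> x = (z x)\<^sup>2 * (3 - 2 * z x)" for x
  have z01: "0 \<le> z x" "z x \<le> 1" for x by (auto simp: z_def)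
  have z_lip: "\<bar>z x - z y\<bar> \<le> 2 / r * norm (x - y)" for x y
  proof -
    have "\<bar>z x - z y\<bar> \<le> \<bar>2 / r * norm (x - a) - 2 / r * norm (y - a)\<bar>"
      unfolding z_def by (auto simp: max_def min_def abs_if)
    also have "\<dots> = 2 / r * \<bar>norm (x - a) - norm (y - a)\<bar>"
      unfolding right_diff_distrib[symmetric] abs_mult using r by simp
    also have "\<dots> \<le> 2 / r * norm (x - y)"
      using r norm_triangle_ineq3[of "x - a" "y - a"] by (intro mult_left_mono) auto
    finally show ?thesis .
  qed
  have diff_eq: "\<psi> x - \<psi> y = (z x - z y) * (3 * (z x + z y) - 2 * ((z x)\<^sup>2 + z x * z y + (z y)\<^sup>2))" for x y
    unfolding \<psi>_def by (simp add: algebra_simps power2_eq_square power3_eq_cube)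
  \<comment> \<open>The Lipschitz constant \<open>2 / r\<close> of \<open>z\<close> times the bound
    6 for the second factor in \<open>diff_eq\<close>.\<close>
  have "\<bar>\<psi> x - \<psi> y\<bar> \<le> 12 / r * norm (x - y)" for x y
  proof -
    have "\<bar>3 * (p + q) - 2 * (a + b + c)\<bar> \<le> 6"
      if "0 \<le> p" "p \<le> 1" "0 \<le> q" "q \<le> 1" "0 \<le> a" "a \<le> 1" "0 \<le> b" "b \<le> 1" "0 \<le> c" "c \<le> 1"
      for p q a b c :: real
      using that by (simp add: abs_le_iff)
    from this[of "z x" "z y" "(z x)\<^sup>2" "z x * z y" "(z y)\<^sup>2"]
    have "\<bar>3 * (z x + z y) - 2 * ((z x)\<^sup>2 + z x * z y + (z y)\<^sup>2)\<bar> \<le> 6"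
      using z01[of x] z01[of y] by (simp add: power_le_one mult_le_one)
    then have "\<bar>\<psi> x - \<psi> y\<bar> \<le> \<bar>z x - z y\<bar> * 6"
      unfolding diff_eq abs_mult by (intro mult_left_mono) auto
    then show ?thesis using z_lip[of x y] by simp
  qed
  then show "(12 / r)-lipschitz_on UNIV \<psi>"
    using r by (intro lipschitz_onI) (auto simp: dist_norm)
  show "\<psi> x = 1" if "x \<in> ball a (r / 2)" for x
  proof -
    have "z x = 1" using that r by (simp add: z_def dist_norm norm_minus_commute field_simps)
    then show ?thesis by (simp add: \<psi>_def)
  qed
  show "\<psi> x = 0" if "x \<notin> cball a r" for x
  proof -
    have "2 - 2 / r * norm (x - a) \<le> 0" using that r by (simp add: dist_norm norm_minus_commute field_simps)
    then have "z x = 0" by (simp add: z_def)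
    then show ?thesis by (simp add: \<psi>_def)
  qed
  show "\<psi> differentiable (at x)" for x
  proof (cases "z x = 0 \<or> z x = 1")
    case True
    \<comment> \<open>At the values 0 and 1 the increment of the cubic is of second order in the
      increment of \<open>z\<close>. As \<open>z\<close> is Lipschitz, \<open>\<psi>\<close> has
      derivative 0 there even where \<open>z\<close> has a kink.\<close>
    have quad: "\<bar>\<psi> y - \<psi> x\<bar> \<le> 3 * (2 / r)\<^sup>2 * (norm (y - x))\<^sup>2" for y
    proof -
      have "\<bar>\<psi> y - \<psi> x\<bar> \<le> 3 * \<bar>z y - z x\<bar>\<^sup>2"
        using True
      proof
        assume "z x = 0"
        then have "\<psi> y - \<psi> x = (z y)\<^sup>2 * (3 - 2 * z y)" by (simp add: \<psi>_def)
        moreover have "(z y)\<^sup>2 * (3 - 2 * z y) \<le> (z y)\<^sup>2 * 3" "0 \<le> (z y)\<^sup>2 * (3 - 2 * z y)"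
          using z01[of y] by (intro mult_left_mono mult_nonneg_nonneg; simp)+
        ultimately show ?thesis using \<open>z x = 0\<close> by simp
      next
        assume "z x = 1"
        then have "\<psi> x - \<psi> y = (z y - z x)\<^sup>2 * (1 + 2 * z y)"
          unfolding \<psi>_def by (simp add: power2_eq_square algebra_simps)
        moreover have "(z y - z x)\<^sup>2 * (1 + 2 * z y) \<le> (z y - z x)\<^sup>2 * 3" "0 \<le> (z y - z x)\<^sup>2 * (1 + 2 * z y)"
          using z01[of y] by (intro mult_left_mono mult_nonneg_nonneg; simp)+
        ultimately show ?thesis unfolding power2_abs by (simp add: abs_minus_commute[of "\<psi> y"])
      qed
      also have "\<dots> \<le> 3 * (2 / r * norm (y - x))\<^sup>2"
        using z_lip[of y x] by (intro mult_left_mono power_mono) auto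
      finally show ?thesis by (simp only: power_mult_distrib mult.assoc)
    qed
    have "(\<psi> has_derivative (\<lambda>_. 0)) (at x)"
      unfolding has_derivative_iff_norm
    proof (intro conjI)
      show "((\<lambda>y. norm (\<psi> y - \<psi> x - 0) / norm (y - x)) \<longlongrightarrow> 0) (at x)"
      proof (rule Lim_null_comparison)
        show "\<forall>\<^sub>F y in at x. norm (norm (\<psi> y - \<psi> x - 0) / norm (y - x)) \<le> 3 * (2 / r)\<^sup>2 * norm (y - x)"
          unfolding eventually_at_filter
        proof (intro always_eventually allI impI)
          fix y assume "y \<noteq> x"
          then show "norm (norm (\<psi> y - \<psi> x - 0) / norm (y - x)) \<le> 3 * (2 / r)\<^sup>2 * norm (y - x)"
            using quad[of y] by (simp add: divide_le_eq power2_eq_square mult.assoc)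
        qed
        have "((\<lambda>y. 3 * (2 / r)\<^sup>2 * norm (y - x)) \<longlongrightarrow> 3 * (2 / r)\<^sup>2 * norm (x - x)) (at x)"
          by (intro tendsto_intros)
        then show "((\<lambda>y. 3 * (2 / r)\<^sup>2 * norm (y - x)) \<longlongrightarrow> 0) (at x)" by simp
      qed
    qed simp
    then show ?thesis by (rule differentiableI)
  next
    case False
    let ?l = "\<lambda>y. 2 - 2 / r * norm (y - a)"
    let ?O = "{y. 0 < ?l y} \<inter> {y. ?l y < 1}"
    have x: "x \<in> ?O" using False by (auto simp: z_def max_def min_def split: if_splits)
    \<comment> \<open>At the centre the unclamped profile is 2, which excludes it from
      \<open>?O\<close>; elsewhere the norm is differentiable.\<close>
    then have "x \<noteq> a" by auto
    have "open ?O" by (intro open_Int open_Collect_less continuous_intros)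
    have "(\<lambda>y. (?l y)\<^sup>2 * (3 - 2 * ?l y)) differentiable (at x)"
      using \<open>x \<noteq> a\<close> by (intro derivative_intros differentiable_compose[of norm]) (auto intro: differentiable_norm_at)
    moreover have "(?l y)\<^sup>2 * (3 - 2 * ?l y) = \<psi> y" if "y \<in> ?O" for y
    proof -
      have "z y = ?l y" using that by (auto simp: z_def)
      then show ?thesis by (simp add: \<psi>_def)
    qed
    ultimately show ?thesis
      using has_derivative_transform_within_open[OF _ \<open>open ?O\<close> x] unfolding differentiable_def by blast
  qed
qed

subsection \<open>The Gauss--Green formula on a domain\<close>

lemma frechet_derivative_zero_on_open:
  assumes "open S" "x \<in> S" "\<And>y. y \<in> S \<Longrightarrow> f y = 0"
  shows "f differentiable (at x)" "frechet_derivative f (at x) v = 0"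
proof -
  have "((\<lambda>_. 0) has_derivative (\<lambda>_. 0)) (at x)" by (rule has_derivative_const)
  then have "(f has_derivative (\<lambda>_. 0)) (at x)"
    by (rule has_derivative_transform_within_open[OF _ assms(1,2)]) (simp add: assms(3))
  then show "f differentiable (at x)" "frechet_derivative f (at x) v = 0"
    by (auto simp: differentiable_def frechet_derivative_at[symmetric])
qed

lemma frechet_derivative_add:
  assumes "f differentiable (at x)" "g differentiable (at x)"
  shows "frechet_derivative (\<lambda>x. f x + g x) (at x) v = frechet_derivative f (at x) v + frechet_derivative g (at x) v"
proof -
  have "((\<lambda>x. f x + g x) has_derivative (\<lambda>v. frechet_derivative f (at x) v + frechet_derivative g (at x) v)) (at x)"
    using assms unfolding frechet_derivative_works by (rule has_derivative_add)
  from frechet_derivative_at[OF this, symmetric] show ?thesis by simp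
qed

locale gauss_green_domain =
  fixes \<Omega> :: "(real^3) set" and n :: "real^3 \<Rightarrow> real^3" and S :: "(real^3) measure"
  assumes \<Omega>: "C1_domain \<Omega>" "bounded \<Omega>"
    and n: "\<And>x. x \<in> frontier \<Omega> \<Longrightarrow> outward_unit_normal \<Omega> x (n x)"
    and S: "surface_measure \<Omega> S"
begin

lemma open_\<Omega>: "open \<Omega>" using \<Omega> unfolding C1_domain_def by blast

lemma \<Omega>_sets [measurable]: "\<Omega> \<in> sets borel" using open_\<Omega> by simp

text \<open>Integrability is part of the notion: with a possibly discontinuous derivative it is not
  automatic, and it makes the identity additive in \<open>g\<close>.\<close>

definition gauss_green :: "(real^3 \<Rightarrow> real) \<Rightarrow> real^3 \<Rightarrow> bool" where
  "gauss_green g v \<longleftrightarrow>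
     set_integrable lborel \<Omega> (\<lambda>x. frechet_derivative g (at x) v) \<and>
     set_integrable S (frontier \<Omega>) (\<lambda>x. g x * (v \<bullet> n x)) \<and>
     (LINT x:\<Omega>|lborel. frechet_derivative g (at x) v) = (LINT x:frontier \<Omega>|S. g x * (v \<bullet> n x))"

lemma gauss_green_zero:
  assumes "\<And>x. x \<in> closure \<Omega> \<Longrightarrow> g x = 0"
  shows "gauss_green g v"
proof -
  have "frechet_derivative g (at x) v = 0" if "x \<in> \<Omega>" for x
    using frechet_derivative_zero_on_open(2)[OF open_\<Omega> that] assms closure_subset by blast
  then have "(\<lambda>x. indicator \<Omega> x *\<^sub>R frechet_derivative g (at x) v) = (\<lambda>_. 0)"
    by (auto simp: indicator_def)
  moreover have "(\<lambda>x. indicator (frontier \<Omega>) x *\<^sub>R (g x * (v \<bullet> n x))) = (\<lambda>_. 0)"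
    using assms by (auto simp: indicator_def frontier_def)
  ultimately show ?thesis
    unfolding gauss_green_def set_integrable_def set_lebesgue_integral_def by simp
qed

lemma gauss_green_add:
  assumes f: "gauss_green f v" "\<And>x. x \<in> \<Omega> \<Longrightarrow> f differentiable (at x)"
    and g: "gauss_green g v" "\<And>x. x \<in> \<Omega> \<Longrightarrow> g differentiable (at x)"
  shows "gauss_green (\<lambda>x. f x + g x) v"
proof -
  have eq: "frechet_derivative (\<lambda>x. f x + g x) (at x) v = frechet_derivative f (at x) v + frechet_derivative g (at x) v"
    if "x \<in> \<Omega>" for x
    using that f(2) g(2) by (intro frechet_derivative_add)
  have "set_integrable lborel \<Omega> (\<lambda>x. frechet_derivative (\<lambda>x. f x + g x) (at x) v)
      \<longleftrightarrow> set_integrable lborel \<Omega> (\<lambda>x. frechet_derivative f (at x) v + frechet_derivative g (at x) v)"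
    by (intro set_integrable_cong) (auto simp: eq)
  moreover have "(LINT x:\<Omega>|lborel. frechet_derivative (\<lambda>x. f x + g x) (at x) v)
      = (LINT x:\<Omega>|lborel. frechet_derivative f (at x) v + frechet_derivative g (at x) v)"
    by (intro set_lebesgue_integral_cong) (auto simp: eq)
  ultimately show ?thesis
    using f(1) g(1) unfolding gauss_green_def by (auto simp: distrib_right)
qed

text \<open>Within \<open>cball a r\<close> the domain coincides with the full region
  \<open>D\<close> below the graph, and outside it \<open>g\<close> and its derivative vanish, so
  the formula for \<open>D\<close> applies. On the boundary the area element cancels the
  normalisation of the graph normal.\<close>

lemma gauss_green_patch:
  assumes patch: "graph_patch \<Omega> U i s \<phi>" and r: "cball a r \<subseteq> U"
    and lip: "L-lipschitz_on UNIV g" and supp: "\<And>x. x \<notin> cball a r \<Longrightarrow> g x = 0"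
    and diff: "\<And>x. x \<in> \<Omega> \<Longrightarrow> g differentiable (at x)"
  shows "gauss_green g v"
proof -
  have s: "s = 1 \<or> s = -1" and \<phi>: "Ck_on 1 \<phi> UNIV"
    and \<Omega>U: "\<Omega> \<inter> U = {x \<in> U. s * x $ i < s * \<phi> (drop_axis i x)}"
    using patch unfolding graph_patch_def by blast+
  define D where "D = {x. s * x $ i < s * \<phi> (drop_axis i x)}"
  have zero: "g differentiable (at x)" "frechet_derivative g (at x) v = 0" if "x \<notin> cball a r" for x
    using frechet_derivative_zero_on_open[of "- cball a r" x g] that supp by auto
  have eq: "(\<lambda>x. indicator D x *\<^sub>R frechet_derivative g (at x) v)
      = (\<lambda>x. indicator \<Omega> x *\<^sub>R frechet_derivative g (at x) v)"
  proof
    fix x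
    show "indicat_real D x *\<^sub>R frechet_derivative g (at x) v = indicat_real \<Omega> x *\<^sub>R frechet_derivative g (at x) v"
    proof (cases "x \<in> cball a r")
      case True
      then have "x \<in> D \<longleftrightarrow> x \<in> \<Omega>" using r \<Omega>U unfolding D_def by blast
      then show ?thesis by (simp add: indicator_def)
    qed (simp add: zero)
  qed
  have diff': "g differentiable (at x)" if "x \<in> D" for x
  proof (cases "x \<in> cball a r")
    case True
    then have "x \<in> \<Omega>" using r \<Omega>U that unfolding D_def by blast
    then show ?thesis by (rule diff)
  qed (rule zero)
  have supp': "g x = 0" if "x \<notin> cball 0 (norm a + r)" for x
  proof (rule supp)
    show "x \<notin> cball a r" using that norm_triangle_sub[of x a] by (auto simp: dist_norm norm_minus_commute)
  qed
  note GG = graph_gauss_green[OF s \<phi> lip supp' D_def diff', where v = v]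
  have cont: "continuous_on (frontier \<Omega>) (\<lambda>x. g x * (v \<bullet> n x))"
    using continuous_on_outward_unit_normal[OF \<Omega>(1) n] lipschitz_on_continuous_on[OF lipschitz_on_subset[OF lip]]
    by (intro continuous_intros) auto
  have "(LINT x:frontier \<Omega>|S. g x * (v \<bullet> n x))
      = (LINT y|lborel. graph_weight \<phi> y * (indicator U (insert_axis i y (\<phi> y))
          * (g (insert_axis i y (\<phi> y)) * (v \<bullet> n (insert_axis i y (\<phi> y))))))"
  proof (rule surface_integral_graph_patch[OF S open_\<Omega> patch])
    show "set_borel_measurable borel (frontier \<Omega>) (\<lambda>x. g x * (v \<bullet> n x))"
      unfolding set_borel_measurable_def
      by (rule borel_measurable_continuous_on_indicator[OF _ cont]) auto
    show "g x * (v \<bullet> n x) = 0" if "x \<in> frontier \<Omega> - U" for x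
    proof -
      have "x \<notin> cball a r" using that r by blast
      then show ?thesis by (simp add: supp)
    qed
  qed
  also have "\<dots> = (LINT y|lborel. s * g (insert_axis i y (\<phi> y)) * (v $ i - grad \<phi> y \<bullet> drop_axis i v))"
  proof (intro Bochner_Integration.integral_cong refl)
    fix y
    let ?x = "insert_axis i y (\<phi> y)"
    show "graph_weight \<phi> y * (indicator U ?x * (g ?x * (v \<bullet> n ?x)))
        = s * g ?x * (v $ i - grad \<phi> y \<bullet> drop_axis i v)"
    proof (cases "?x \<in> U")
      case True
      then have x: "?x \<in> frontier \<Omega> \<inter> U"
        unfolding frontier_graph_patch[OF patch open_\<Omega>] by simp
      have "n ?x = graph_normal i s \<phi> (drop_axis i ?x)"
        using x by (intro outward_unit_normal_graph_patch[OF patch open_\<Omega> x] n) simp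
      then show ?thesis
        using True graph_weight_pos[of \<phi> y] by (simp add: inner_graph_normal)
    next
      case False
      then have "?x \<notin> cball a r" using r by blast
      then show ?thesis by (simp add: supp)
    qed
  qed
  also have "\<dots> = (LINT x:\<Omega>|lborel. frechet_derivative g (at x) v)"
    using GG(2) eq by (simp add: set_lebesgue_integral_def)
  finally show ?thesis
    using GG(1) eq set_integrable_frontier_continuous[OF S \<Omega> cont]
    by (simp add: gauss_green_def set_integrable_def)
qed

text \<open>Puts interior and boundary points on the same footing in the covering argument.\<close>

lemma closure_graph_patch:
  assumes x: "x \<in> closure \<Omega>"
  shows "\<exists>U i s \<phi>. x \<in> U \<and> graph_patch \<Omega> U i s \<phi>"
proof (cases "x \<in> frontier \<Omega>")
  case True
  then show ?thesis using \<Omega> unfolding C1_domain_def by blast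
next
  case False
  then have "x \<in> \<Omega>" using x open_\<Omega> by (simp add: frontier_def interior_open)
  \<comment> \<open>A bounded open set lies below a constant graph, hence is a graph patch of its own.\<close>
  obtain B where B: "\<And>y. y \<in> \<Omega> \<Longrightarrow> norm y < B"
    using \<Omega>(2) bounded_pos_less by blast
  have "y $ 1 < B" if "y \<in> \<Omega>" for y
    using B[OF that] component_le_norm_cart[of y 1] by linarith
  then have "graph_patch \<Omega> \<Omega> 1 1 (\<lambda>_. B)"
    using open_\<Omega> by (auto simp: graph_patch_def)
  with \<open>x \<in> \<Omega>\<close> show ?thesis by blast
qed

theorem gauss_green_lipschitz:
  assumes lip: "\<And>x. x \<in> closure \<Omega> \<Longrightarrow> \<exists>e>0. \<exists>L. L-lipschitz_on (cball x e) g"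
    and diff: "\<And>x. x \<in> \<Omega> \<Longrightarrow> g differentiable (at x)"
  shows "gauss_green g v"
proof -
  have "\<exists>r>0. (\<exists>U i s \<phi>. graph_patch \<Omega> U i s \<phi> \<and> cball x r \<subseteq> U) \<and> (\<exists>L. L-lipschitz_on (cball x r) g)"
    if x: "x \<in> closure \<Omega>" for x
  proof -
    obtain U i s \<phi> where U: "x \<in> U" "graph_patch \<Omega> U i s \<phi>" using closure_graph_patch[OF x] by blast
    then have "open U" unfolding graph_patch_def by blast
    then obtain d where d: "d > 0" "cball x d \<subseteq> U" using U open_contains_cball by blast
    obtain e L where e: "e > 0" "L-lipschitz_on (cball x e) g" using lip[OF x] by blast
    have "cball x (min d e) \<subseteq> U" "cball x (min d e) \<subseteq> cball x e" using d by auto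
    then show ?thesis
      using d e(1) U(2) lipschitz_on_subset[OF e(2), of "cball x (min d e)"]
      by (intro exI[of _ "min d e"]) auto
  qed
  then obtain r where r0: "\<And>x. x \<in> closure \<Omega> \<Longrightarrow> r x > 0"
    and patch: "\<And>x. x \<in> closure \<Omega> \<Longrightarrow> \<exists>U i s \<phi>. graph_patch \<Omega> U i s \<phi> \<and> cball x (r x) \<subseteq> U"
    and glip: "\<And>x. x \<in> closure \<Omega> \<Longrightarrow> \<exists>L. L-lipschitz_on (cball x (r x)) g"
    by metis
  \<comment> \<open>Half radii leave room for a bump that is 1 on the half ball and vanishes off the
    full closed ball, which still lies in a single patch and in a set where \<open>g\<close> is
    Lipschitz.\<close>
  have "closure \<Omega> \<subseteq> (\<Union>x\<in>closure \<Omega>. ball x (r x / 2))"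
    using r0 by force
  moreover have "compact (closure \<Omega>)" using \<Omega>(2) by simp
  ultimately obtain A where A: "A \<subseteq> closure \<Omega>" "finite A" "closure \<Omega> \<subseteq> (\<Union>x\<in>A. ball x (r x / 2))"
    using compactE_image[of "closure \<Omega>" "closure \<Omega>" "\<lambda>x. ball x (r x / 2)"] open_ball by blast
  \<comment> \<open>Peel off the balls one at a time: \<open>g = \<psi> g + (1 - \<psi>) g\<close> with a bump \<open>\<psi>\<close> equal to 1 on the ball.\<close>
  have "gauss_green g v"
    if "finite B" "B \<subseteq> A" "\<And>a. a \<in> A \<Longrightarrow> \<exists>L. L-lipschitz_on (cball a (r a)) g"
      "\<And>x. x \<in> \<Omega> \<Longrightarrow> g differentiable (at x)"
      "\<And>x. x \<in> closure \<Omega> \<Longrightarrow> x \<notin> (\<Union>a\<in>B. ball a (r a / 2)) \<Longrightarrow> g x = 0" for B g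
    using that
  proof (induction B arbitrary: g rule: finite_induct)
    case empty
    then show ?case by (intro gauss_green_zero) auto
  next
    case (insert a B)
    then have a: "a \<in> A" "a \<in> closure \<Omega>" using A(1) by auto
    obtain \<psi> K where \<psi>: "\<And>x. \<psi> differentiable (at x)" "K-lipschitz_on UNIV \<psi>"
      "\<And>x. x \<in> ball a (r a / 2) \<Longrightarrow> \<psi> x = 1" "\<And>x. x \<notin> cball a (r a) \<Longrightarrow> \<psi> x = (0::real)"
      using differentiable_bump[OF r0[OF a(2)]] by blast
    obtain U i s \<phi> where U: "graph_patch \<Omega> U i s \<phi>" "cball a (r a) \<subseteq> U" using patch[OF a(2)] by blast
    obtain L where L: "L-lipschitz_on (cball a (r a)) g" using insert.prems(2)[OF a(1)] by blast
    obtain M where M: "M-lipschitz_on UNIV (\<lambda>x. \<psi> x * g x)"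
      using lipschitz_on_UNIV_mult_support[OF L \<psi>(2) bounded_cball \<psi>(4)] by blast
    have 1: "gauss_green (\<lambda>x. \<psi> x * g x) v"
      using \<psi>(1,4) insert.prems(3) by (intro gauss_green_patch[OF U M]) auto
    have 2: "gauss_green (\<lambda>x. (1 - \<psi> x) * g x) v"
    proof (rule insert.IH)
      show "B \<subseteq> A" using insert.prems by blast
      show "\<exists>L. L-lipschitz_on (cball b (r b)) (\<lambda>x. (1 - \<psi> x) * g x)" if "b \<in> A" for b
      proof -
        obtain L where "L-lipschitz_on (cball b (r b)) g" using insert.prems(2)[OF \<open>b \<in> A\<close>] by blast
        moreover have "(0 + K)-lipschitz_on (cball b (r b)) (\<lambda>x. 1 - \<psi> x)"
          using \<psi>(2) by (intro lipschitz_on_diff lipschitz_on_constant) (auto intro: lipschitz_on_subset)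
        ultimately show ?thesis using lipschitz_on_mult_exists bounded_cball by blast
      qed
      show "(\<lambda>x. (1 - \<psi> x) * g x) differentiable (at x)" if "x \<in> \<Omega>" for x
        using \<psi>(1) insert.prems(3)[OF that] by auto
      show "(1 - \<psi> x) * g x = 0" if "x \<in> closure \<Omega>" "x \<notin> (\<Union>a\<in>B. ball a (r a / 2))" for x
        using \<psi>(3)[of x] insert.prems(4)[of x] that by (cases "x \<in> ball a (r a / 2)") auto
    qed
    have "gauss_green (\<lambda>x. \<psi> x * g x + (1 - \<psi> x) * g x) v"
      using \<psi>(1) insert.prems(3) by (intro gauss_green_add 1 2) auto
    then show ?case by (simp add: algebra_simps)
  qed
  from this[OF A(2) order_refl _ diff] glip A(1,3) show ?thesis by blast
qed

end

subsection \<open>Divergence\<close>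

text \<open>Differentiability is carried along because \<open>divergence\<close> is meaningful only
  with it; the pair obeys the product rule, so divergences can be computed by introduction
  rules.\<close>

definition has_divergence :: "(real^'n \<Rightarrow> real^'n) \<Rightarrow> real \<Rightarrow> real^'n \<Rightarrow> bool" where
  "has_divergence F d x \<longleftrightarrow> F differentiable (at x) \<and> divergence F x = d"

lemma has_divergenceI: "F differentiable (at x) \<Longrightarrow> has_divergence F (divergence F x) x"
  by (simp add: has_divergence_def)

lemma has_divergence_add:
  assumes "has_divergence F d x" "has_divergence G e x"
  shows "has_divergence (\<lambda>y. F y + G y) (d + e) x"
  using assms unfolding has_divergence_def divergence_def
  by (auto simp: frechet_derivative_add sum.distrib)

lemma has_divergence_scaleR:
  fixes f :: "real^'n \<Rightarrow> real"
  assumes f: "f differentiable (at x)" and F: "has_divergence F d x"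
  shows "has_divergence (\<lambda>y. f y *\<^sub>R F y) (f x * d + grad f x \<bullet> F x) x"
proof -
  have F': "F differentiable (at x)" using F by (simp add: has_divergence_def)
  have "((\<lambda>y. f y *\<^sub>R F y) has_derivative
      (\<lambda>h. f x *\<^sub>R frechet_derivative F (at x) h + frechet_derivative f (at x) h *\<^sub>R F x)) (at x)"
    using f F' unfolding frechet_derivative_works by (rule has_derivative_scaleR)
  from frechet_derivative_at[OF this, symmetric] f F F' show ?thesis
    unfolding has_divergence_def divergence_def
    by (auto simp: sum.distrib sum_distrib_left inner_vec_def grad_def)
qed

lemma has_divergence_minus:
  fixes F :: "real^'n \<Rightarrow> real^'n"
  assumes "has_divergence F d x"
  shows "has_divergence (\<lambda>y. - F y) (- d) x"
  using has_divergence_scaleR[OF differentiable_const assms, of "-1"] by (simp add: grad_def inner_vec_def)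

lemma has_divergence_diff:
  fixes F G :: "real^'n \<Rightarrow> real^'n"
  assumes "has_divergence F d x" "has_divergence G e x"
  shows "has_divergence (\<lambda>y. F y - G y) (d - e) x"
  using has_divergence_add[OF assms(1) has_divergence_minus[OF assms(2)]] by simp

lemma has_divergence_sum:
  fixes F :: "'i \<Rightarrow> real^'n \<Rightarrow> real^'n"
  assumes "finite A" "\<And>i. i \<in> A \<Longrightarrow> has_divergence (F i) (d i) x"
  shows "has_divergence (\<lambda>y. \<Sum>i\<in>A. F i y) (\<Sum>i\<in>A. d i) x"
  using assms
proof (induction A rule: finite_induct)
  case empty
  then show ?case by (simp add: has_divergence_def divergence_def)
qed (simp add: has_divergence_add)

lemma grad_nth_eq:
  fixes F :: "real^'n \<Rightarrow> real^'n"
  assumes "F differentiable (at x)"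
  shows "grad (\<lambda>y. F y $ i) x = (\<chi> j. frechet_derivative F (at x) (axis j 1) $ i)"
proof -
  have "((\<lambda>y. F y $ i) has_derivative (\<lambda>h. frechet_derivative F (at x) h $ i)) (at x)"
    using assms unfolding frechet_derivative_works
    by (rule bounded_linear.has_derivative[OF bounded_linear_vec_nth])
  from frechet_derivative_at[OF this, symmetric] show ?thesis by (simp add: grad_def)
qed

subsection \<open>Locally Lipschitz functions\<close>

text \<open>The balls are full balls of the ambient space, not cut down to \<open>C\<close>: on the
  closure of a domain this is a Lipschitz bound slightly beyond it, as multiplication by bumps
  requires.\<close>

definition lipschitz_near :: "'a::metric_space set \<Rightarrow> ('a \<Rightarrow> 'b::metric_space) \<Rightarrow> bool" where
  "lipschitz_near C g \<longleftrightarrow> (\<forall>x\<in>C. \<exists>e>0. \<exists>L. L-lipschitz_on (cball x e) g)"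

lemma lipschitz_near_combine:
  assumes f: "lipschitz_near C f" and g: "lipschitz_near C g"
    and comb: "\<And>x e K L. K-lipschitz_on (cball x e) f \<Longrightarrow> L-lipschitz_on (cball x e) g
        \<Longrightarrow> \<exists>M. M-lipschitz_on (cball x e) h"
  shows "lipschitz_near C h"
  unfolding lipschitz_near_def
proof
  fix x assume "x \<in> C"
  then obtain d K e L where d: "d > 0" "K-lipschitz_on (cball x d) f" and e: "e > 0" "L-lipschitz_on (cball x e) g"
    using f g unfolding lipschitz_near_def by meson
  have "K-lipschitz_on (cball x (min d e)) f" "L-lipschitz_on (cball x (min d e)) g"
    using d e by (auto elim: lipschitz_on_subset)
  then show "\<exists>e>0. \<exists>L. L-lipschitz_on (cball x e) h"
    using comb d e by (intro exI[of _ "min d e"]) auto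
qed

lemma lipschitz_near_const: "lipschitz_near C (\<lambda>_. a)"
  unfolding lipschitz_near_def using lipschitz_on_constant zero_less_one by blast

lemma lipschitz_near_add:
  fixes f g :: "'a::metric_space \<Rightarrow> 'b::real_normed_vector"
  assumes "lipschitz_near C f" "lipschitz_near C g"
  shows "lipschitz_near C (\<lambda>x. f x + g x)"
  by (rule lipschitz_near_combine[OF assms]) (blast intro: lipschitz_on_add)

lemma lipschitz_near_diff:
  fixes f g :: "'a::metric_space \<Rightarrow> 'b::real_normed_vector"
  assumes "lipschitz_near C f" "lipschitz_near C g"
  shows "lipschitz_near C (\<lambda>x. f x - g x)"
  by (rule lipschitz_near_combine[OF assms]) (blast intro: lipschitz_on_diff)

lemma lipschitz_near_mult:
  fixes f g :: "'a::metric_space \<Rightarrow> real"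
  assumes "lipschitz_near C f" "lipschitz_near C g"
  shows "lipschitz_near C (\<lambda>x. f x * g x)"
  by (rule lipschitz_near_combine[OF assms]) (blast intro: lipschitz_on_mult_exists bounded_cball)

lemma lipschitz_near_sum:
  fixes f :: "'i \<Rightarrow> 'a::metric_space \<Rightarrow> 'b::real_normed_vector"
  assumes "finite A" "\<And>i. i \<in> A \<Longrightarrow> lipschitz_near C (f i)"
  shows "lipschitz_near C (\<lambda>x. \<Sum>i\<in>A. f i x)"
  using assms by (induction A rule: finite_induct) (auto intro: lipschitz_near_const lipschitz_near_add)

lemma lipschitz_near_compose:
  assumes "K-lipschitz_on UNIV h" "lipschitz_near C f"
  shows "lipschitz_near C (\<lambda>x. h (f x))"
  by (rule lipschitz_near_combine[OF assms(2,2)])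
     (blast intro: lipschitz_on_compose2[where g = h] lipschitz_on_subset[OF assms(1)])

lemma lipschitz_near_nth:
  fixes f :: "'a::metric_space \<Rightarrow> real^'n"
  assumes "lipschitz_near C f" shows "lipschitz_near C (\<lambda>x. f x $ i)"
proof (rule lipschitz_near_compose[OF _ assms])
  show "1-lipschitz_on UNIV (\<lambda>v::real^'n. v $ i)"
    by (rule lipschitz_onI) (auto simp: dist_vec_nth_le)
qed

lemma lipschitz_near_continuous_on:
  assumes "lipschitz_near C f" shows "continuous_on C f"
  unfolding continuous_on_eq_continuous_within
proof
  fix x assume "x \<in> C"
  then obtain e L where e: "e > 0" "L-lipschitz_on (cball x e) f" using assms unfolding lipschitz_near_def by blast
  then have "continuous (at x within ball x e) f"
    by (intro lipschitz_on_continuous_within[OF lipschitz_on_subset[OF e(2) ball_subset_cball]]) auto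
  then have "continuous (at x) f"
    using e(1) at_within_open[of x "ball x e"] by simp
  then show "continuous (at x within C) f" by (rule continuous_at_imp_continuous_at_within)
qed

text \<open>A closed ball in space-time is compact and convex, so the C^1 field has a Lipschitz
  constant on it, which the time slice inherits.\<close>

lemma lipschitz_near_slice:
  fixes F :: "real \<times> 'a::euclidean_space \<Rightarrow> 'b::real_normed_vector"
  assumes F: "Ck_on 1 F W" and W: "open W" and C: "\<And>x. x \<in> C \<Longrightarrow> (t, x) \<in> W"
  shows "lipschitz_near C (\<lambda>x. F (t, x))"
  unfolding lipschitz_near_def
proof
  fix x assume "x \<in> C"
  then obtain e where e: "e > 0" "cball (t, x) e \<subseteq> W"
    using W C open_contains_cball by blast
  obtain L where L: "L-lipschitz_on (cball (t, x) e) F"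
    using Ck_on_1_lipschitz_on_compact_convex[OF F compact_cball convex_cball e(2)] by blast
  have "L-lipschitz_on (cball x e) (\<lambda>y. F (t, y))"
  proof (rule lipschitz_onI)
    show "dist (F (t, y)) (F (t, z)) \<le> L * dist y z" if "y \<in> cball x e" "z \<in> cball x e" for y z
      using lipschitz_onD[OF L, of "(t, y)" "(t, z)"] that by (simp add: dist_Pair_Pair)
  qed (rule lipschitz_on_nonneg[OF L])
  with e(1) show "\<exists>e>0. \<exists>L. L-lipschitz_on (cball x e) (\<lambda>x. F (t, x))" by blast
qed

subsection \<open>Partial derivatives\<close>

lemma Ck_on_Suc_imp: "Ck_on (Suc k) f W \<Longrightarrow> Ck_on k f W"
proof (induction k arbitrary: f)
  case 0
  then show ?case
    by (auto intro!: differentiable_imp_continuous_on simp: differentiable_on_def differentiable_at_withinI)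
next
  case (Suc k)
  then show ?case by (metis Ck_on.simps(2))
qed

lemma Ck_on_2_imp_1: "Ck_on 2 f W \<Longrightarrow> Ck_on 1 f W"
  using Ck_on_Suc_imp[of 1 f W] by (simp add: numeral_2_eq_2)

lemma Ck_on_2_frechet_derivative: "Ck_on 2 f W \<Longrightarrow> Ck_on 1 (\<lambda>x. frechet_derivative f (at x) v) W"
  by (simp add: numeral_2_eq_2)

lemma has_real_derivative_along_line:
  fixes f :: "'a::real_normed_vector \<Rightarrow> real"
  assumes "f differentiable (at (a + s *\<^sub>R v))"
  shows "((\<lambda>s. f (a + s *\<^sub>R v)) has_real_derivative frechet_derivative f (at (a + s *\<^sub>R v)) v) (at s)"
proof -
  have "((\<lambda>s. a + s *\<^sub>R v) has_derivative (\<lambda>h. h *\<^sub>R v)) (at s)"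
    by (auto intro!: derivative_eq_intros)
  from diff_chain_at[OF this assms[unfolded frechet_derivative_works]]
  show ?thesis
    unfolding o_def
    by (rule has_derivative_imp_has_field_derivative)
       (simp add: linear_scale[OF linear_frechet_derivative[OF assms]])
qed

text \<open>The mean value theorem along \<open>v\<close>, applied to the increment of
  \<open>f\<close> by \<open>h w\<close>, and then along \<open>w\<close>, applied to the
  \<open>v\<close>-derivative, produces the mixed derivative at an intermediate point. The bound on
  \<open>h\<close> keeps the whole parallelogram in the ball.\<close>

lemma second_difference:
  fixes f :: "'a::real_normed_vector \<Rightarrow> real"
  assumes d: "ball x d \<subseteq> W" and h: "h > 0" "h * (norm v + norm w) < d"
    and f: "\<And>y. y \<in> W \<Longrightarrow> f differentiable (at y)"
    and fv: "\<And>y. y \<in> W \<Longrightarrow> (\<lambda>y. frechet_derivative f (at y) v) differentiable (at y)"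
  shows "\<exists>y\<in>ball x d. f (x + h *\<^sub>R v + h *\<^sub>R w) - f (x + h *\<^sub>R v) - f (x + h *\<^sub>R w) + f x
    = h\<^sup>2 * frechet_derivative (\<lambda>y. frechet_derivative f (at y) v) (at y) w"
proof -
  let ?fv = "\<lambda>y. frechet_derivative f (at y) v"
  have in_ball: "x + r *\<^sub>R v + s *\<^sub>R w \<in> ball x d" if "0 \<le> r" "r \<le> h" "0 \<le> s" "s \<le> h" for r s
  proof -
    have "norm (r *\<^sub>R v + s *\<^sub>R w) \<le> r * norm v + s * norm w"
      using norm_triangle_ineq[of "r *\<^sub>R v" "s *\<^sub>R w"] that by simp
    also have "\<dots> \<le> h * norm v + h * norm w" using that by (intro add_mono mult_right_mono) auto
    also have "\<dots> < d" using h(2) by (simp add: algebra_simps)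
    finally have "norm (r *\<^sub>R v + s *\<^sub>R w) < d" .
    moreover have "dist x (x + r *\<^sub>R v + s *\<^sub>R w) = norm (r *\<^sub>R v + s *\<^sub>R w)"
      by (metis add.assoc add_diff_cancel_left' dist_commute dist_norm)
    ultimately show ?thesis by simp
  qed
  define \<phi> where "\<phi> r = f ((x + h *\<^sub>R w) + r *\<^sub>R v) - f (x + r *\<^sub>R v)" for r
  have "(\<phi> has_real_derivative ?fv ((x + h *\<^sub>R w) + r *\<^sub>R v) - ?fv (x + r *\<^sub>R v)) (at r)"
    if "0 \<le> r" "r \<le> h" for r
    unfolding \<phi>_def
    using in_ball[of r h] in_ball[of r 0] that h(1) d
    by (intro DERIV_diff has_real_derivative_along_line f) (auto simp: add_ac)
  from MVT2[OF h(1) this]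
  obtain r where r: "0 < r" "r < h" "\<phi> h - \<phi> 0 = h * (?fv ((x + h *\<^sub>R w) + r *\<^sub>R v) - ?fv (x + r *\<^sub>R v))"
    by auto
  have "((\<lambda>s. ?fv ((x + r *\<^sub>R v) + s *\<^sub>R w)) has_real_derivative
      frechet_derivative ?fv (at ((x + r *\<^sub>R v) + s *\<^sub>R w)) w) (at s)"
    if "0 \<le> s" "s \<le> h" for s
    using in_ball[of r s] that r d by (intro has_real_derivative_along_line fv) auto
  from MVT2[OF h(1) this]
  obtain s where s: "0 < s" "s < h" "?fv ((x + r *\<^sub>R v) + h *\<^sub>R w) - ?fv ((x + r *\<^sub>R v) + 0 *\<^sub>R w)
      = h * frechet_derivative ?fv (at ((x + r *\<^sub>R v) + s *\<^sub>R w)) w"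
    by auto
  have "f (x + h *\<^sub>R v + h *\<^sub>R w) - f (x + h *\<^sub>R v) - f (x + h *\<^sub>R w) + f x = \<phi> h - \<phi> 0"
    by (simp add: \<phi>_def add_ac)
  also have "\<dots> = h\<^sup>2 * frechet_derivative ?fv (at ((x + r *\<^sub>R v) + s *\<^sub>R w)) w"
    using r(3) s(3) by (simp add: power2_eq_square add_ac)
  finally show ?thesis using in_ball[of r s] r s by (intro bexI[of _ "x + r *\<^sub>R v + s *\<^sub>R w"]) auto
qed

text \<open>The second difference is symmetric in \<open>v\<close> and \<open>w\<close>, so the two
  mixed derivatives agree at points close to \<open>x\<close>, and continuity transfers this to
  \<open>x\<close>. Later it interchanges time and space derivatives of \<open>c\<close>.\<close>

lemma frechet_derivative_symmetric:
  fixes f :: "'a::euclidean_space \<Rightarrow> real"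
  assumes f: "Ck_on 2 f W" and W: "open W" and x: "x \<in> W"
  shows "frechet_derivative (\<lambda>y. frechet_derivative f (at y) v) (at x) w
    = frechet_derivative (\<lambda>y. frechet_derivative f (at y) w) (at x) v"
proof -
  define D where "D v w y = frechet_derivative (\<lambda>y. frechet_derivative f (at y) v) (at y) w" for v w y
  have f1: "\<And>y. y \<in> W \<Longrightarrow> f differentiable (at y)"
    using Ck_on_2_imp_1[OF f] unfolding Ck_on_1_iff by blast
  have f2: "\<And>y v. y \<in> W \<Longrightarrow> (\<lambda>y. frechet_derivative f (at y) v) differentiable (at y)"
    and cont: "\<And>v w. continuous_on W (D v w)"
    using Ck_on_2_frechet_derivative[OF f] unfolding Ck_on_1_iff D_def by blast+
  have "\<bar>D v w x - D w v x\<bar> \<le> 2 * e" if e: "e > 0" for e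
  proof -
    have near: "\<exists>d>0. \<forall>y\<in>ball x d. \<bar>D v w y - D v w x\<bar> < e" for v w
    proof -
      have "isCont (D v w) x" using cont W x continuous_on_eq_continuous_at by blast
      then show ?thesis using e unfolding continuous_at_eps_delta
        by (metis dist_commute dist_real_def mem_ball)
    qed
    obtain d1 d2 where d: "d1 > 0" "\<forall>y\<in>ball x d1. \<bar>D v w y - D v w x\<bar> < e"
      "d2 > 0" "\<forall>y\<in>ball x d2. \<bar>D w v y - D w v x\<bar> < e" using near by meson
    obtain d3 where d3: "d3 > 0" "ball x d3 \<subseteq> W" using W x open_contains_ball by blast
    define d where "d = min d3 (min d1 d2)"
    have d0: "d > 0" and dW: "ball x d \<subseteq> W" using d d3 by (auto simp: d_def)
    \<comment> \<open>The added 1 keeps the denominator positive even if both vectors vanish and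
      makes \<open>hd\<close> strict.\<close>
    define h where "h = d / (norm v + norm w + 1)"
    have N: "norm v + norm w + 1 > 0" by (simp add: add_nonneg_pos)
    have h: "h > 0" using d0 N by (simp add: h_def)
    have hd: "h * (norm v + norm w) < d"
    proof -
      have "h * (norm v + norm w) < h * (norm v + norm w + 1)" using h by simp
      also have "\<dots> = d" using N by (simp add: h_def)
      finally show ?thesis .
    qed
    then have hd': "h * (norm w + norm v) < d" by (simp add: add.commute)
    obtain y where y: "y \<in> ball x d"
      "f (x + h *\<^sub>R v + h *\<^sub>R w) - f (x + h *\<^sub>R v) - f (x + h *\<^sub>R w) + f x = h\<^sup>2 * D v w y"
      using second_difference[OF dW h hd f1 f2] unfolding D_def by blast
    obtain z where z: "z \<in> ball x d"
      "f (x + h *\<^sub>R w + h *\<^sub>R v) - f (x + h *\<^sub>R w) - f (x + h *\<^sub>R v) + f x = h\<^sup>2 * D w v z"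
      using second_difference[OF dW h hd' f1 f2] unfolding D_def by blast
    have "h\<^sup>2 * D v w y = h\<^sup>2 * D w v z" using y(2) z(2) add.assoc[of x "h *\<^sub>R w" "h *\<^sub>R v"] add.assoc[of x "h *\<^sub>R v" "h *\<^sub>R w"]
      by (simp only: add.commute[of "h *\<^sub>R w" "h *\<^sub>R v"])
    then have "D v w y = D w v z" using h by simp
    moreover have "\<bar>D v w y - D v w x\<bar> < e" "\<bar>D w v z - D w v x\<bar> < e"
      using d y(1) z(1) by (auto simp: d_def)
    ultimately show ?thesis by linarith
  qed
  \<comment> \<open>With \<open>e\<close> a quarter of the gap, the gap would be at most half of
    itself.\<close>
  from this[of "\<bar>D v w x - D w v x\<bar> / 4"] have "D v w x = D w v x"
    by (cases "D v w x = D w v x") auto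
  then show ?thesis by (simp add: D_def)
qed

lemma has_derivative_slice_space:
  fixes F :: "real \<times> 'a::real_normed_vector \<Rightarrow> 'b::real_normed_vector"
  assumes "F differentiable (at (t, x))"
  shows "((\<lambda>y. F (t, y)) has_derivative (\<lambda>v. frechet_derivative F (at (t, x)) (0, v))) (at x)"
proof -
  have "((\<lambda>y. (t, y)) has_derivative (\<lambda>v. (0, v))) (at x)"
    by (intro has_derivative_Pair has_derivative_const has_derivative_ident)
  from diff_chain_at[OF this assms[unfolded frechet_derivative_works]] show ?thesis by (simp add: o_def)
qed

lemma has_vector_derivative_slice_time:
  fixes F :: "real \<times> 'a::real_normed_vector \<Rightarrow> 'b::real_normed_vector"
  assumes "F differentiable (at (t, x))"
  shows "((\<lambda>s. F (s, x)) has_vector_derivative frechet_derivative F (at (t, x)) (1, 0)) (at t)"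
proof -
  have "((\<lambda>s. (s, x)) has_derivative (\<lambda>h. (h, 0))) (at t)"
    by (intro has_derivative_Pair has_derivative_const has_derivative_ident)
  from diff_chain_at[OF this assms[unfolded frechet_derivative_works]]
  have "((\<lambda>s. F (s, x)) has_derivative (\<lambda>h. frechet_derivative F (at (t, x)) (h, 0))) (at t)"
    by (simp add: o_def)
  moreover have "(\<lambda>h. frechet_derivative F (at (t, x)) (h, 0)) = (\<lambda>h. h *\<^sub>R frechet_derivative F (at (t, x)) (1, 0))"
  proof
    show "frechet_derivative F (at (t, x)) (h, 0) = h *\<^sub>R frechet_derivative F (at (t, x)) (1, 0)" for h
      using linear_scale[OF linear_frechet_derivative[OF assms], of h "(1, 0)"] by simp
  qed
  ultimately show ?thesis unfolding has_vector_derivative_def by metis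
qed

subsection \<open>Functions that are Lipschitz in time uniformly in space\<close>

text \<open>One constant bounds values and increments, which makes the notion stable under products.
  It provides dominating functions in time for quantities such as \<open>\<rho>\<close>, whose time
  derivative may fail to exist where the cutoff sets in.\<close>

definition uniformly_lipschitz :: "real set \<Rightarrow> 'a set \<Rightarrow> (real \<Rightarrow> 'a \<Rightarrow> real) \<Rightarrow> bool" where
  "uniformly_lipschitz T C f \<longleftrightarrow>
     (\<exists>L. \<forall>x\<in>C. \<forall>s\<in>T. \<forall>t\<in>T. \<bar>f s x\<bar> \<le> L \<and> \<bar>f s x - f t x\<bar> \<le> L * \<bar>s - t\<bar>)"

lemma uniformly_lipschitzE:
  assumes "uniformly_lipschitz T C f"
  obtains L where "L \<ge> 0" "\<And>x s. x \<in> C \<Longrightarrow> s \<in> T \<Longrightarrow> \<bar>f s x\<bar> \<le> L"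
    "\<And>x s t. x \<in> C \<Longrightarrow> s \<in> T \<Longrightarrow> t \<in> T \<Longrightarrow> \<bar>f s x - f t x\<bar> \<le> L * \<bar>s - t\<bar>"
proof -
  obtain L where L: "\<forall>x\<in>C. \<forall>s\<in>T. \<forall>t\<in>T. \<bar>f s x\<bar> \<le> L \<and> \<bar>f s x - f t x\<bar> \<le> L * \<bar>s - t\<bar>"
    using assms unfolding uniformly_lipschitz_def by blast
  have "L * \<bar>s - t\<bar> \<le> \<bar>L\<bar> * \<bar>s - t\<bar>" for s t by (intro mult_right_mono) auto
  note le = this
  show ?thesis
  proof (rule that[of "\<bar>L\<bar>"])
    show "\<bar>f s x\<bar> \<le> \<bar>L\<bar>" if "x \<in> C" "s \<in> T" for x s
      using L that by force
    show "\<bar>f s x - f t x\<bar> \<le> \<bar>L\<bar> * \<bar>s - t\<bar>" if "x \<in> C" "s \<in> T" "t \<in> T" for x s t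
      using L that le[of s t] by force
  qed simp
qed

lemma uniformly_lipschitz_const: "uniformly_lipschitz T C (\<lambda>_ _. a)"
  unfolding uniformly_lipschitz_def by (intro exI[of _ "\<bar>a\<bar>"]) auto

lemma uniformly_lipschitz_add:
  assumes f: "uniformly_lipschitz T C f" and g: "uniformly_lipschitz T C g"
  shows "uniformly_lipschitz T C (\<lambda>s x. f s x + g s x)"
proof -
  from f obtain K where K: "\<And>x s. x \<in> C \<Longrightarrow> s \<in> T \<Longrightarrow> \<bar>f s x\<bar> \<le> K"
    "\<And>x s t. x \<in> C \<Longrightarrow> s \<in> T \<Longrightarrow> t \<in> T \<Longrightarrow> \<bar>f s x - f t x\<bar> \<le> K * \<bar>s - t\<bar>" by (rule uniformly_lipschitzE) blast
  from g obtain L where L: "\<And>x s. x \<in> C \<Longrightarrow> s \<in> T \<Longrightarrow> \<bar>g s x\<bar> \<le> L"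
    "\<And>x s t. x \<in> C \<Longrightarrow> s \<in> T \<Longrightarrow> t \<in> T \<Longrightarrow> \<bar>g s x - g t x\<bar> \<le> L * \<bar>s - t\<bar>" by (rule uniformly_lipschitzE) blast
  show ?thesis unfolding uniformly_lipschitz_def
  proof (intro exI[of _ "K + L"] ballI conjI)
    fix x s t assume x: "x \<in> C" "s \<in> T" "t \<in> T"
    show "\<bar>f s x + g s x\<bar> \<le> K + L" using K(1)[OF x(1,2)] L(1)[OF x(1,2)] by linarith
    show "\<bar>f s x + g s x - (f t x + g t x)\<bar> \<le> (K + L) * \<bar>s - t\<bar>"
      using K(2)[OF x] L(2)[OF x] unfolding distrib_right by linarith
  qed
qed

lemma uniformly_lipschitz_mult:
  assumes f: "uniformly_lipschitz T C f" and g: "uniformly_lipschitz T C g"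
  shows "uniformly_lipschitz T C (\<lambda>s x. f s x * g s x)"
proof -
  from f obtain K where K: "K \<ge> 0" "\<And>x s. x \<in> C \<Longrightarrow> s \<in> T \<Longrightarrow> \<bar>f s x\<bar> \<le> K"
    "\<And>x s t. x \<in> C \<Longrightarrow> s \<in> T \<Longrightarrow> t \<in> T \<Longrightarrow> \<bar>f s x - f t x\<bar> \<le> K * \<bar>s - t\<bar>" by (rule uniformly_lipschitzE) blast
  from g obtain L where L: "L \<ge> 0" "\<And>x s. x \<in> C \<Longrightarrow> s \<in> T \<Longrightarrow> \<bar>g s x\<bar> \<le> L"
    "\<And>x s t. x \<in> C \<Longrightarrow> s \<in> T \<Longrightarrow> t \<in> T \<Longrightarrow> \<bar>g s x - g t x\<bar> \<le> L * \<bar>s - t\<bar>" by (rule uniformly_lipschitzE) blast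
  show ?thesis unfolding uniformly_lipschitz_def
  proof (intro exI[of _ "2 * K * L"] ballI conjI)
    fix x s t assume x: "x \<in> C" "s \<in> T" "t \<in> T"
    have "\<bar>f s x * g s x\<bar> \<le> K * L"
      unfolding abs_mult using K L x by (intro mult_mono) auto
    then show "\<bar>f s x * g s x\<bar> \<le> 2 * K * L" using K(1) L(1) mult_nonneg_nonneg[of K L] by linarith
    have "f s x * g s x - f t x * g t x = (f s x - f t x) * g s x + f t x * (g s x - g t x)"
      by (simp add: algebra_simps)
    then have "\<bar>f s x * g s x - f t x * g t x\<bar> \<le> \<bar>f s x - f t x\<bar> * \<bar>g s x\<bar> + \<bar>f t x\<bar> * \<bar>g s x - g t x\<bar>"
      by (metis abs_mult abs_triangle_ineq)
    also have "\<dots> \<le> (K * \<bar>s - t\<bar>) * L + K * (L * \<bar>s - t\<bar>)"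
      using K L x by (intro add_mono mult_mono) auto
    finally show "\<bar>f s x * g s x - f t x * g t x\<bar> \<le> 2 * K * L * \<bar>s - t\<bar>" by (simp add: mult_ac)
  qed
qed

lemma uniformly_lipschitz_diff:
  assumes "uniformly_lipschitz T C f" "uniformly_lipschitz T C g"
  shows "uniformly_lipschitz T C (\<lambda>s x. f s x - g s x)"
  using uniformly_lipschitz_add[OF assms(1) uniformly_lipschitz_mult[OF uniformly_lipschitz_const[of _ _ "-1"] assms(2)]]
  by simp

lemma uniformly_lipschitz_sum:
  assumes "finite A" "\<And>i. i \<in> A \<Longrightarrow> uniformly_lipschitz T C (f i)"
  shows "uniformly_lipschitz T C (\<lambda>s x. \<Sum>i\<in>A. f i s x)"
  using assms by (induction A rule: finite_induct) (auto intro: uniformly_lipschitz_const uniformly_lipschitz_add)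

lemma uniformly_lipschitz_compose:
  assumes h: "M-lipschitz_on UNIV h" and f: "uniformly_lipschitz T C f"
  shows "uniformly_lipschitz T C (\<lambda>s x. h (f s x) :: real)"
proof -
  from f obtain K where K: "K \<ge> 0" "\<And>x s. x \<in> C \<Longrightarrow> s \<in> T \<Longrightarrow> \<bar>f s x\<bar> \<le> K"
    "\<And>x s t. x \<in> C \<Longrightarrow> s \<in> T \<Longrightarrow> t \<in> T \<Longrightarrow> \<bar>f s x - f t x\<bar> \<le> K * \<bar>s - t\<bar>" by (rule uniformly_lipschitzE) blast
  have M: "M \<ge> 0" using h by (rule lipschitz_on_nonneg)
  have hl: "\<bar>h a - h b\<bar> \<le> M * \<bar>a - b\<bar>" for a b
    using lipschitz_onD[OF h, of a b] by (simp add: dist_real_def)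
  show ?thesis unfolding uniformly_lipschitz_def
  proof (intro exI[of _ "\<bar>h 0\<bar> + M * K"] ballI conjI)
    fix x s t assume x: "x \<in> C" "s \<in> T" "t \<in> T"
    have "\<bar>h (f s x) - h 0\<bar> \<le> M * K"
      using hl[of "f s x" 0] mult_left_mono[OF K(2)[OF x(1,2)] M] by simp
    then show "\<bar>h (f s x)\<bar> \<le> \<bar>h 0\<bar> + M * K" by linarith
    have "\<bar>h (f s x) - h (f t x)\<bar> \<le> M * (K * \<bar>s - t\<bar>)"
      using hl[of "f s x" "f t x"] mult_left_mono[OF K(3)[OF x] M] by linarith
    also have "\<dots> \<le> (\<bar>h 0\<bar> + M * K) * \<bar>s - t\<bar>" by (simp add: algebra_simps)
    finally show "\<bar>h (f s x) - h (f t x)\<bar> \<le> (\<bar>h 0\<bar> + M * K) * \<bar>s - t\<bar>" .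
  qed
qed

text \<open>Mean value theorem with a bounded, possibly discontinuous derivative, the form in which
  the wall energy uses it.\<close>

lemma uniformly_lipschitz_bounded_derivative:
  assumes B: "\<And>s x. s \<in> {a..b} \<Longrightarrow> x \<in> C \<Longrightarrow> \<bar>f s x\<bar> \<le> B"
    and D: "\<And>s x. s \<in> {a..b} \<Longrightarrow> x \<in> C \<Longrightarrow> ((\<lambda>s. f s x) has_real_derivative f' s x) (at s)"
    and D_le: "\<And>s x. s \<in> {a..b} \<Longrightarrow> x \<in> C \<Longrightarrow> \<bar>f' s x\<bar> \<le> B'"
  shows "uniformly_lipschitz {a..b} C f"
  unfolding uniformly_lipschitz_def
proof (intro exI[of _ "max B B'"] ballI conjI)
  fix x s t assume x: "x \<in> C" "s \<in> {a..b}" "t \<in> {a..b}"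
  show "\<bar>f s x\<bar> \<le> max B B'" using B[OF x(2,1)] by simp
  have "norm (f s x - f t x) \<le> B' * norm (s - t)"
    by (rule field_differentiable_bound[where S = "{a..b}" and f' = "\<lambda>s. f' s x"])
       (use x D D_le in \<open>auto intro: has_field_derivative_at_within\<close>)
  also have "\<dots> \<le> max B B' * norm (s - t)" by (intro mult_right_mono) auto
  finally show "\<bar>f s x - f t x\<bar> \<le> max B B' * \<bar>s - t\<bar>" by simp
qed

lemma bounded_on_compact_slab:
  fixes f :: "real \<times> 'a::euclidean_space \<Rightarrow> real"
  assumes "continuous_on W f" "{a..b} \<times> C \<subseteq> W" "compact C"
  obtains B where "\<And>s x. s \<in> {a..b} \<Longrightarrow> x \<in> C \<Longrightarrow> \<bar>f (s, x)\<bar> \<le> B"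
proof -
  have "bounded (f ` ({a..b} \<times> C))"
    using assms by (intro compact_imp_bounded compact_continuous_image compact_Times)
      (auto intro: continuous_on_subset)
  then obtain B where "\<forall>y\<in>f ` ({a..b} \<times> C). \<bar>y\<bar> \<le> B" unfolding bounded_real by blast
  then show ?thesis by (intro that[of B]) auto
qed

lemma uniformly_lipschitz_Ck_on_1:
  fixes f :: "real \<times> 'a::euclidean_space \<Rightarrow> real"
  assumes f: "Ck_on 1 f W" and W: "{a..b} \<times> C \<subseteq> W" and C: "compact C"
  shows "uniformly_lipschitz {a..b} C (\<lambda>s x. f (s, x))"
proof -
  have df: "\<And>z. z \<in> W \<Longrightarrow> f differentiable (at z)"
    and cont: "continuous_on W (\<lambda>z. frechet_derivative f (at z) (1, 0))"
    using f unfolding Ck_on_1_iff by blast+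
  obtain B where B: "\<And>s x. s \<in> {a..b} \<Longrightarrow> x \<in> C \<Longrightarrow> \<bar>f (s, x)\<bar> \<le> B"
    using bounded_on_compact_slab[OF Ck_on_1_continuous_on[OF f] W C] by blast
  obtain B' where B': "\<And>s x. s \<in> {a..b} \<Longrightarrow> x \<in> C \<Longrightarrow> \<bar>frechet_derivative f (at (s, x)) (1, 0)\<bar> \<le> B'"
    using bounded_on_compact_slab[OF cont W C] by blast
  show ?thesis
  proof (rule uniformly_lipschitz_bounded_derivative[OF B _ B'])
    show "((\<lambda>s. f (s, x)) has_real_derivative frechet_derivative f (at (s, x)) (1, 0)) (at s)"
      if "s \<in> {a..b}" "x \<in> C" for s x
    proof -
      have "(s, x) \<in> W" using that W by blast
      from has_vector_derivative_slice_time[OF df[OF this]] show ?thesis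
        by (simp add: has_real_derivative_iff_has_vector_derivative)
    qed
  qed auto
qed

subsection \<open>The divergence theorem\<close>

lemma set_integral_sum:
  fixes f :: "'i \<Rightarrow> 'a \<Rightarrow> 'b::{banach, second_countable_topology}"
  assumes "\<And>i. i \<in> J \<Longrightarrow> set_integrable M A (f i)"
  shows "set_integrable M A (\<lambda>x. \<Sum>i\<in>J. f i x)"
    and "(LINT x:A|M. \<Sum>i\<in>J. f i x) = (\<Sum>i\<in>J. LINT x:A|M. f i x)"
  using assms unfolding set_integrable_def set_lebesgue_integral_def
  by (auto simp: scaleR_sum_right)

context gauss_green_domain
begin

text \<open>The Gauss-Green identity for the component \<open>F x $ i\<close> in direction
  \<open>axis i 1\<close>, summed over \<open>i\<close>.\<close>

theorem divergence_theorem: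
  assumes lip: "\<And>i. lipschitz_near (closure \<Omega>) (\<lambda>x. F x $ i)"
    and diff: "\<And>x. x \<in> \<Omega> \<Longrightarrow> F differentiable (at x)"
  shows "set_integrable lborel \<Omega> (divergence F)"
    and "set_integrable S (frontier \<Omega>) (\<lambda>x. F x \<bullet> n x)"
    and "(LINT x:\<Omega>|lborel. divergence F x) = (LINT x:frontier \<Omega>|S. F x \<bullet> n x)"
proof -
  have comp: "((\<lambda>y. F y $ i) has_derivative (\<lambda>h. frechet_derivative F (at x) h $ i)) (at x)" if "x \<in> \<Omega>" for x i
    using diff[OF that] unfolding frechet_derivative_works
    by (rule bounded_linear.has_derivative[OF bounded_linear_vec_nth])
  have gg: "gauss_green (\<lambda>x. F x $ i) (axis i 1)" for i
    using lip[of i] by (intro gauss_green_lipschitz differentiableI[OF comp]) (auto simp: lipschitz_near_def)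
  have div: "divergence F x = (\<Sum>i\<in>UNIV. frechet_derivative (\<lambda>y. F y $ i) (at x) (axis i 1))" if "x \<in> \<Omega>" for x
    unfolding divergence_def using frechet_derivative_at[OF comp[OF that]]
    by (intro sum.cong refl) metis
  have dot: "F x \<bullet> n x = (\<Sum>i\<in>UNIV. F x $ i * (axis i 1 \<bullet> n x))" for x
    by (simp add: inner_vec_def[of "F x"] inner_axis')
  have int: "set_integrable lborel \<Omega> (\<lambda>x. \<Sum>i\<in>UNIV. frechet_derivative (\<lambda>y. F y $ i) (at x) (axis i 1))"
    using gg unfolding gauss_green_def by (intro set_integral_sum) auto
  show "set_integrable lborel \<Omega> (divergence F)"
    by (rule set_integrable_cong[THEN iffD1, OF refl refl _ int]) (simp add: div)
  show "set_integrable S (frontier \<Omega>) (\<lambda>x. F x \<bullet> n x)"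
    unfolding dot using gg unfolding gauss_green_def by (intro set_integral_sum) auto
  have "(LINT x:\<Omega>|lborel. divergence F x)
      = (LINT x:\<Omega>|lborel. \<Sum>i\<in>UNIV. frechet_derivative (\<lambda>y. F y $ i) (at x) (axis i 1))"
    by (intro set_lebesgue_integral_cong) (auto simp: div)
  also have "\<dots> = (\<Sum>i\<in>UNIV. LINT x:\<Omega>|lborel. frechet_derivative (\<lambda>y. F y $ i) (at x) (axis i 1))"
    using gg unfolding gauss_green_def by (intro set_integral_sum) auto
  also have "\<dots> = (\<Sum>i\<in>UNIV. LINT x:frontier \<Omega>|S. F x $ i * (axis i 1 \<bullet> n x))"
    using gg unfolding gauss_green_def by (intro sum.cong) auto
  also have "\<dots> = (LINT x:frontier \<Omega>|S. F x \<bullet> n x)"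
    unfolding dot using gg unfolding gauss_green_def by (intro set_integral_sum(2)[symmetric]) auto
  finally show "(LINT x:\<Omega>|lborel. divergence F x) = (LINT x:frontier \<Omega>|S. F x \<bullet> n x)" .
qed

lemma set_integrable_continuous_closure:
  fixes f :: "real^3 \<Rightarrow> real"
  assumes "continuous_on (closure \<Omega>) f"
  shows "set_integrable lborel \<Omega> f"
proof (rule set_integrable_subset)
  show "set_integrable lborel (closure \<Omega>) f"
    unfolding set_integrable_def using \<Omega>(2) assms by (intro borel_integrable_compact) auto
qed (auto simp: closure_subset)

end

text \<open>Agreement is required on an open superset of \<open>C\<close> because the balls in
  \<open>lipschitz_near\<close> reach beyond \<open>C\<close>.\<close>

lemma lipschitz_near_cong_open:
  assumes f: "lipschitz_near C f" and V: "open V" "C \<subseteq> V" and eq: "\<And>y. y \<in> V \<Longrightarrow> f y = g y"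
  shows "lipschitz_near C g"
  unfolding lipschitz_near_def
proof
  fix x assume x: "x \<in> C"
  then obtain e L where e: "e > 0" "L-lipschitz_on (cball x e) f"
    using f unfolding lipschitz_near_def by blast
  obtain d where d: "d > 0" "cball x d \<subseteq> V" using x V open_contains_cball by blast
  have "L-lipschitz_on (cball x (min d e)) f" by (rule lipschitz_on_subset[OF e(2)]) auto
  moreover have "f y = g y" if "y \<in> cball x (min d e)" for y using that d(2) by (intro eq) auto
  ultimately have "L-lipschitz_on (cball x (min d e)) g" using lipschitz_on_transform by metis
  then show "\<exists>e>0. \<exists>L. L-lipschitz_on (cball x e) g" using d e by (intro exI[of _ "min d e"]) auto
qed

subsection \<open>Fields on space-time\<close>

text \<open>Regularity is assumed jointly in time and space, while the equations use curried fields
  with separate derivatives. The directions \<open>(0, v)\<close> and \<open>(1, 0)\<close>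
  translate between the two.\<close>

locale spacetime_field =
  fixes W :: "(real \<times> (real^3)) set" and f :: "real \<Rightarrow> real^3 \<Rightarrow> 'b::real_normed_vector"
  assumes W: "open W" and f1: "Ck_on 1 (\<lambda>(t, x). f t x) W"
begin

abbreviation "D v t x \<equiv> frechet_derivative (\<lambda>(t, x). f t x) (at (t, x)) v"

lemma open_slice: "open {x. (t, x) \<in> W}"
proof -
  have "open (Pair t -` W)" by (rule open_vimage[OF W]) (intro continuous_intros)
  then show ?thesis by (simp add: vimage_def)
qed

lemma differentiable: "(t, x) \<in> W \<Longrightarrow> (\<lambda>(t, x). f t x) differentiable (at (t, x))"
  using f1 unfolding Ck_on_1_iff by blast

lemma has_derivative_space: "(t, x) \<in> W \<Longrightarrow> (f t has_derivative (\<lambda>v. D (0, v) t x)) (at x)"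
  using has_derivative_slice_space[OF differentiable] by simp

lemma frechet_derivative_space: "(t, x) \<in> W \<Longrightarrow> frechet_derivative (f t) (at x) v = D (0, v) t x"
  using frechet_derivative_at[OF has_derivative_space] by metis

lemma differentiable_space: "(t, x) \<in> W \<Longrightarrow> f t differentiable (at x)"
  using has_derivative_space differentiableI by blast

lemma has_vector_derivative_time: "(t, x) \<in> W \<Longrightarrow> ((\<lambda>s. f s x) has_vector_derivative D (1, 0) t x) (at t)"
  using has_vector_derivative_slice_time[OF differentiable] by simp

lemma continuous_on_slice: "(\<And>x. x \<in> C \<Longrightarrow> (t, x) \<in> W) \<Longrightarrow> continuous_on C (f t)"
  using differentiable_space differentiable_imp_continuous_within
  by (metis continuous_on_eq_continuous_within differentiable_at_withinI)

lemma lipschitz_near_space: "(\<And>x. x \<in> C \<Longrightarrow> (t, x) \<in> W) \<Longrightarrow> lipschitz_near C (f t)"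
  using lipschitz_near_slice[OF f1 W, of C t] by simp

end

locale spacetime_field2 = spacetime_field W f for W and f :: "real \<Rightarrow> real^3 \<Rightarrow> 'b::real_normed_vector" +
  assumes f2: "Ck_on 2 (\<lambda>(t, x). f t x) W"
begin

text \<open>Directional derivatives of a C^2 field are C^1 fields, so every fact of
  \<open>spacetime_field\<close> is available for them as well.\<close>

sublocale D: spacetime_field W "D v" for v
  using W Ck_on_2_frechet_derivative[OF f2, of v] by unfold_locales (simp_all add: case_prod_beta')

lemma lipschitz_near_frechet_derivative:
  assumes "\<And>x. x \<in> C \<Longrightarrow> (t, x) \<in> W"
  shows "lipschitz_near C (\<lambda>x. frechet_derivative (f t) (at x) v)"
proof (rule lipschitz_near_cong_open[OF D.lipschitz_near_space])
  show "open {x. (t, x) \<in> W}" by (rule open_slice)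
qed (use assms frechet_derivative_space in auto)

lemma differentiable_frechet_derivative:
  assumes "(t, x) \<in> W"
  shows "(\<lambda>x. frechet_derivative (f t) (at x) v) differentiable (at x)"
proof -
  have "((\<lambda>x. frechet_derivative (f t) (at x) v) has_derivative frechet_derivative (D (0, v) t) (at x)) (at x)"
    by (rule has_derivative_transform_within_open[OF
          D.differentiable_space[OF assms, unfolded frechet_derivative_works] open_slice[of t]])
       (use assms frechet_derivative_space in auto)
  then show ?thesis by (rule differentiableI)
qed

end

lemma differentiable_vec_nth:
  fixes f :: "'a::real_normed_vector \<Rightarrow> real^'n"
  shows "f differentiable (at x) \<Longrightarrow> (\<lambda>y. f y $ i) differentiable (at x)"
  unfolding differentiable_def
  using bounded_linear.has_derivative[OF bounded_linear_vec_nth] by blast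

lemma differentiable_vec_lambda:
  fixes f :: "'i::finite \<Rightarrow> 'a::real_normed_vector \<Rightarrow> real"
  assumes "\<And>i. f i differentiable (at x)"
  shows "(\<lambda>y. \<chi> i. f i y) differentiable (at x)"
proof -
  have eq: "(\<lambda>y. \<chi> i. f i y) = (\<lambda>y. \<Sum>i\<in>UNIV. f i y *\<^sub>R axis i 1)"
    by (simp add: fun_eq_iff vec_eq_iff axis_def if_distrib cong: if_cong)
  show ?thesis unfolding eq
    by (intro differentiable_sum differentiable_scaleR differentiable_const) (auto simp: assms)
qed

locale spacetime_scalar2 = spacetime_field2 W f for W and f :: "real \<Rightarrow> real^3 \<Rightarrow> real"
begin

lemma deriv_time: "(t, x) \<in> W \<Longrightarrow> deriv (\<lambda>s. f s x) t = D (1, 0) t x"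
  using has_vector_derivative_time
  by (simp add: DERIV_imp_deriv has_real_derivative_iff_has_vector_derivative)

lemma has_real_derivative_time:
  "(t, x) \<in> W \<Longrightarrow> ((\<lambda>s. f s x) has_real_derivative deriv (\<lambda>s. f s x) t) (at t)"
  using has_vector_derivative_time deriv_time by (simp add: has_real_derivative_iff_has_vector_derivative)

lemma grad_nth: "grad (f t) x $ i = frechet_derivative (f t) (at x) (axis i 1)"
  by (simp add: grad_def)

lemma lipschitz_near_grad:
  "(\<And>x. x \<in> C \<Longrightarrow> (t, x) \<in> W) \<Longrightarrow> lipschitz_near C (\<lambda>x. grad (f t) x $ i)"
  unfolding grad_nth by (rule lipschitz_near_frechet_derivative)

lemma differentiable_grad: "(t, x) \<in> W \<Longrightarrow> grad (f t) differentiable (at x)"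
  unfolding grad_def[abs_def] by (intro differentiable_vec_lambda differentiable_frechet_derivative)

lemma lipschitz_near_deriv:
  assumes "\<And>x. x \<in> C \<Longrightarrow> (t, x) \<in> W"
  shows "lipschitz_near C (\<lambda>x. deriv (\<lambda>s. f s x) t)"
proof (rule lipschitz_near_cong_open[OF D.lipschitz_near_space])
  show "open {x. (t, x) \<in> W}" by (rule open_slice)
qed (use assms deriv_time in auto)

lemma differentiable_deriv:
  assumes "(t, x) \<in> W"
  shows "(\<lambda>x. deriv (\<lambda>s. f s x) t) differentiable (at x)"
    and "grad (\<lambda>x. deriv (\<lambda>s. f s x) t) x $ i = frechet_derivative (D (1, 0) t) (at x) (axis i 1)"
proof -
  have "((\<lambda>x. deriv (\<lambda>s. f s x) t) has_derivative frechet_derivative (D (1, 0) t) (at x)) (at x)"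
    by (rule has_derivative_transform_within_open[OF
          D.differentiable_space[OF assms, unfolded frechet_derivative_works] open_slice[of t]])
       (use assms deriv_time in auto)
  then show "(\<lambda>x. deriv (\<lambda>s. f s x) t) differentiable (at x)"
    "grad (\<lambda>x. deriv (\<lambda>s. f s x) t) x $ i = frechet_derivative (D (1, 0) t) (at x) (axis i 1)"
    by (auto intro: differentiableI simp: grad_def frechet_derivative_at[symmetric])
qed

text \<open>Symmetry of second derivatives in the directions \<open>(0, axis i 1)\<close> and
  \<open>(1, 0)\<close>. It differentiates the gradient energy in time.\<close>

lemma has_real_derivative_grad_time:
  assumes "(t, x) \<in> W"
  shows "((\<lambda>s. grad (f s) x $ i) has_real_derivative grad (\<lambda>x. deriv (\<lambda>s. f s x) t) x $ i) (at t)"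
proof -
  let ?F = "\<lambda>(t, x). f t x"
  have "open ((\<lambda>s. (s, x)) -` W)" by (rule open_vimage[OF W]) (intro continuous_intros)
  then have op: "open {s. (s, x) \<in> W}" by (simp add: vimage_def)
  have "((\<lambda>s. D (0, axis i 1) s x) has_real_derivative
      frechet_derivative (\<lambda>(t, x). D (0, axis i 1) t x) (at (t, x)) (1, 0)) (at t)"
    using D.has_vector_derivative_time[OF assms] by (simp add: has_real_derivative_iff_has_vector_derivative)
  then have "((\<lambda>s. grad (f s) x $ i) has_real_derivative
      frechet_derivative (\<lambda>(t, x). D (0, axis i 1) t x) (at (t, x)) (1, 0)) (at t)"
    by (rule has_field_derivative_transform_within_open[OF _ op])
       (use assms in \<open>auto simp: grad_nth frechet_derivative_space\<close>)
  moreover have "frechet_derivative (\<lambda>(t, x). D (0, axis i 1) t x) (at (t, x)) (1, 0)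
      = frechet_derivative (D (1, 0) t) (at x) (axis i 1)"
    unfolding D.frechet_derivative_space[OF assms]
    using frechet_derivative_symmetric[OF f2 W assms, of "(0, axis i 1)" "(1, 0)"] by (simp add: case_prod_beta')
  ultimately show ?thesis using differentiable_deriv(2)[OF assms] by simp
qed

lemma uniformly_lipschitz_grad:
  assumes C: "{a..b} \<times> C \<subseteq> W" "compact C"
  shows "uniformly_lipschitz {a..b} C (\<lambda>s x. grad (f s) x $ i)"
proof -
  have "uniformly_lipschitz {a..b} C (\<lambda>s x. D (0, axis i 1) s x)"
    using uniformly_lipschitz_Ck_on_1[OF D.f1 C] by simp
  moreover have "grad (f s) x $ i = D (0, axis i 1) s x" if "s \<in> {a..b}" "x \<in> C" for s x
  proof -
    have "(s, x) \<in> W" using that C(1) by blast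
    then show ?thesis by (simp add: grad_nth frechet_derivative_space)
  qed
  ultimately show ?thesis unfolding uniformly_lipschitz_def by simp
qed

end

subsection \<open>The energy balance\<close>

text \<open>
  Here \<open>c'\<close> stands for \<open>c\<^sub>t\<close>. The divergence of the flux is the rate of change of the energy density
  plus the dissipation density.
\<close>

definition energy_flux ::
    "real \<Rightarrow> real \<Rightarrow> (real^3 \<Rightarrow> real) \<Rightarrow> (real^3 \<Rightarrow> real) \<Rightarrow> (real^3 \<Rightarrow> real) \<Rightarrow> (real^3 \<Rightarrow> real)
      \<Rightarrow> (real^3 \<Rightarrow> real) \<Rightarrow> (real^3 \<Rightarrow> real) \<Rightarrow> (real^3 \<Rightarrow> real^3) \<Rightarrow> real^3 \<Rightarrow> real^3" where
  "energy_flux \<kappa> M c c' \<mu> \<rho> \<eta> p u = (\<lambda>y.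
     (\<kappa> * c' y) *\<^sub>R grad c y + (M * \<mu> y) *\<^sub>R grad \<mu> y - \<mu> y *\<^sub>R (c y *\<^sub>R u y)
     - (\<Sum>i\<in>UNIV. u y $ i *\<^sub>R ((1/2 * \<rho> y * u y $ i) *\<^sub>R u y)) - p y *\<^sub>R u y
     + (\<Sum>i\<in>UNIV. u y $ i *\<^sub>R ((2 * \<eta> y) *\<^sub>R (strain u y $ i))))"

text \<open>The divergences that occur in the equations stay unexpanded, so that the equations can
  be substituted as they stand; the momentum flux is differentiable as a whole, while
  \<open>\<rho>\<close> may not be.\<close>

lemma has_divergence_energy_flux:
  assumes "c differentiable (at x)" "c' differentiable (at x)" "\<mu> differentiable (at x)"
    "p differentiable (at x)" "u differentiable (at x)" "\<eta> differentiable (at x)"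
    "grad c differentiable (at x)" "grad \<mu> differentiable (at x)"
    "\<And>i. (\<lambda>y. strain u y $ i) differentiable (at x)"
    "\<And>i. (\<lambda>y. (1/2 * \<rho> y * u y $ i) *\<^sub>R u y) differentiable (at x)"
  shows "has_divergence (energy_flux \<kappa> M c c' \<mu> \<rho> \<eta> p u)
    (\<kappa> * (c' x * laplacian c x + grad c' x \<bullet> grad c x) + M * (\<mu> x * laplacian \<mu> x + grad \<mu> x \<bullet> grad \<mu> x)
     - (\<mu> x * divergence (\<lambda>y. c y *\<^sub>R u y) x + grad \<mu> x \<bullet> (c x *\<^sub>R u x))
     - (\<Sum>i\<in>UNIV. u x $ i * divergence (\<lambda>y. (1/2 * \<rho> y * u y $ i) *\<^sub>R u y) x
          + grad (\<lambda>y. u y $ i) x \<bullet> ((1/2 * \<rho> x * u x $ i) *\<^sub>R u x))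
     - (p x * divergence u x + grad p x \<bullet> u x)
     + (\<Sum>i\<in>UNIV. u x $ i * divergence (\<lambda>y. (2 * \<eta> y) *\<^sub>R (strain u y $ i)) x
          + grad (\<lambda>y. u y $ i) x \<bullet> ((2 * \<eta> x) *\<^sub>R (strain u x $ i)))) x"
proof -
  have cmul: "has_divergence (\<lambda>y. (k * f y) *\<^sub>R F y) (k * (f x * divergence F x + grad f x \<bullet> F x)) x"
    if "f differentiable (at x)" "F differentiable (at x)" for k f and F :: "real^3 \<Rightarrow> real^3"
    using has_divergence_scaleR[OF differentiable_const has_divergence_scaleR[OF that(1) has_divergenceI[OF that(2)]], of k]
    by (simp add: grad_def[of "\<lambda>y. k"] inner_vec_def[of "\<chi> i. 0"])
  show ?thesis
    unfolding energy_flux_def laplacian_def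
    by (intro has_divergence_add has_divergence_diff has_divergence_sum cmul has_divergence_scaleR
        has_divergenceI differentiable_vec_nth differentiable_scaleR differentiable_mult differentiable_const finite assms)
qed

text \<open>The strain is symmetric, so its contraction with the velocity gradient sees only the
  symmetric part of the latter, which is the strain itself.\<close>

lemma sum_grad_inner_strain:
  fixes u :: "real^3 \<Rightarrow> real^3"
  assumes u: "u differentiable (at x)"
  shows "(\<Sum>i\<in>UNIV. grad (\<lambda>y. u y $ i) x \<bullet> strain u x $ i) = strain u x \<bullet> strain u x"
  unfolding grad_nth_eq[OF u]
  by (simp add: strain_def inner_vec_def sum_3 matrix_def transpose_def algebra_simps)

lemma f0_has_real_derivative: "(f0 \<sigma> \<epsilon> has_real_derivative deriv (f0 \<sigma> \<epsilon>) r) (at r)"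
proof -
  have "((\<lambda>r. r\<^sup>2 * (1 - r)\<^sup>2) has_real_derivative 2 * r * (1 - r)\<^sup>2 - r\<^sup>2 * (2 * (1 - r))) (at r)"
    by (auto intro!: derivative_eq_intros simp: algebra_simps)
  from DERIV_cmult[OF this, of "12 * \<sigma> / \<epsilon>"]
  have "(f0 \<sigma> \<epsilon> has_real_derivative 12 * \<sigma> / \<epsilon> * (2 * r * (1 - r)\<^sup>2 - r\<^sup>2 * (2 * (1 - r)))) (at r)"
    by (simp add: f0_def[abs_def] mult.assoc)
  then show ?thesis by (metis DERIV_imp_deriv)
qed

lemma lipschitz_on_density_mix: "\<exists>L. L-lipschitz_on UNIV (density_mix \<rho>\<^sub>1 \<rho>\<^sub>2)"
proof -
  have "density_mix \<rho>\<^sub>1 \<rho>\<^sub>2 r - density_mix \<rho>\<^sub>1 \<rho>\<^sub>2 s = (\<rho>\<^sub>1 - \<rho>\<^sub>2) * (cutoff r - cutoff s)" for r s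
    by (simp add: density_mix_def algebra_simps)
  moreover have "\<bar>cutoff r - cutoff s\<bar> \<le> \<bar>r - s\<bar>" for r s
    by (auto simp: cutoff_def)
  ultimately have "\<bar>\<rho>\<^sub>1 - \<rho>\<^sub>2\<bar>-lipschitz_on UNIV (density_mix \<rho>\<^sub>1 \<rho>\<^sub>2)"
    by (intro lipschitz_onI) (auto simp: dist_real_def abs_mult intro: mult_left_mono)
  then show ?thesis by blast
qed

lemma density_mix_nonneg: "\<rho>\<^sub>1 > 0 \<Longrightarrow> \<rho>\<^sub>2 > 0 \<Longrightarrow> density_mix \<rho>\<^sub>1 \<rho>\<^sub>2 r \<ge> 0"
  unfolding density_mix_def cutoff_def by (intro add_nonneg_nonneg mult_nonneg_nonneg) auto

lemma Ck_on_1_vec_nth: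
  fixes f :: "'a::euclidean_space \<Rightarrow> real^'n"
  assumes f: "Ck_on 1 f W"
  shows "Ck_on 1 (\<lambda>z. f z $ i) W"
proof -
  have *: "((\<lambda>z. f z $ i) has_derivative (\<lambda>v. frechet_derivative f (at z) v $ i)) (at z)" if "z \<in> W" for z
    using f that unfolding Ck_on_1_iff frechet_derivative_works
    by (intro bounded_linear.has_derivative[OF bounded_linear_vec_nth]) blast
  have "continuous_on W (\<lambda>z. frechet_derivative (\<lambda>z. f z $ i) (at z) v)" for v
  proof (rule continuous_on_eq)
    show "continuous_on W (\<lambda>z. frechet_derivative f (at z) v $ i)"
      using f unfolding Ck_on_1_iff by (intro continuous_intros) blast
    show "frechet_derivative f (at z) v $ i = frechet_derivative (\<lambda>z. f z $ i) (at z) v" if "z \<in> W" for z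
      using frechet_derivative_at[OF *[OF that]] by metis
  qed
  then show ?thesis using * differentiableI unfolding Ck_on_1_iff by blast
qed

lemma has_real_derivative_inner_self:
  fixes q :: "real \<Rightarrow> 'a::real_inner"
  assumes "(q has_vector_derivative w) (at t)"
  shows "((\<lambda>s. q s \<bullet> q s) has_real_derivative 2 * (q t \<bullet> w)) (at t)"
proof -
  have "((\<lambda>s. q s \<bullet> q s) has_derivative (\<lambda>h. q t \<bullet> (h *\<^sub>R w) + (h *\<^sub>R w) \<bullet> q t)) (at t)"
    using assms unfolding has_vector_derivative_def by (intro has_derivative_inner)
  then show ?thesis
    by (rule has_derivative_imp_has_field_derivative) (simp add: inner_commute)
qed

lemma strain_nth:
  "strain u x $ i $ j = 1/2 * (frechet_derivative u (at x) (axis j 1) $ i + frechet_derivative u (at x) (axis i 1) $ j)"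
  by (simp add: strain_def matrix_def transpose_def)

text \<open>
  The pointwise energy balance: the equations enter multiplied by \<open>\<mu>\<close>, \<open>u\<close> and \<open>p\<close>; the terms \<open>c u \<bullet> \<nabla>\<mu>\<close>
  and \<open>p \<nabla>\<bullet>u\<close> cancel.
\<close>

lemma energy_balance_algebra:
  fixes u w A B T gp g\<mu> gc gct :: "real^3"
  assumes ch: "ct + divcu = M * L\<mu>" "\<mu> = f' - \<kappa> * Lc"
    and mom: "q *\<^sub>R w + A + (1/2 * \<rho>) *\<^sub>R B + c *\<^sub>R g\<mu> = - gp + T"
    and pres: "pt + r * divu = 0" "r \<noteq> 0"
  shows "f' * ct + \<kappa> * (gc \<bullet> gct) + (q *\<^sub>R u) \<bullet> w + p * pt / r
    = \<kappa> * (ct * Lc + gct \<bullet> gc) + M * (\<mu> * L\<mu> + g\<mu> \<bullet> g\<mu>) - (\<mu> * divcu + g\<mu> \<bullet> (c *\<^sub>R u))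
      - (u \<bullet> A + 1/2 * \<rho> * (u \<bullet> B)) - (p * divu + gp \<bullet> u) + u \<bullet> T - M * (g\<mu> \<bullet> g\<mu>)"
proof -
  have "u \<bullet> (q *\<^sub>R w + A + (1/2 * \<rho>) *\<^sub>R B + c *\<^sub>R g\<mu>) = u \<bullet> (- gp + T)"
    by (simp only: mom)
  then have mom': "q * (u \<bullet> w) + u \<bullet> A + 1/2 * \<rho> * (u \<bullet> B) + c * (u \<bullet> g\<mu>) = - (u \<bullet> gp) + u \<bullet> T"
    by (simp add: inner_add_right inner_diff_right)
  have "pt = - (r * divu)" using pres(1) by simp
  then have p: "p * pt / r = - (p * divu)" using pres(2) by simp
  have f': "f' = \<mu> + \<kappa> * Lc" using ch(2) by simp
  have ct: "M * L\<mu> = ct + divcu" using ch(1) by simp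
  have "M * (\<mu> * L\<mu>) = \<mu> * (M * L\<mu>)" by simp
  also have "\<dots> = \<mu> * ct + \<mu> * divcu" unfolding ct by (simp add: distrib_left)
  finally have "M * (\<mu> * L\<mu>) = \<mu> * ct + \<mu> * divcu" .
  with mom' show ?thesis
    unfolding p f' by (simp add: algebra_simps inner_commute)
qed

theorem mainTheorem2:
  fixes \<sigma> \<epsilon> M\<^sub>0 c\<^sub>0 \<rho>\<^sub>0 \<rho>\<^sub>1 \<rho>\<^sub>2 \<eta>\<^sub>1 \<eta>\<^sub>2 :: real
    and f\<^sub>w :: "real \<Rightarrow> real"
    and \<Omega> :: "(real^3) set" and n :: "real^3 \<Rightarrow> real^3" and S :: "(real^3) measure"
    and I :: "real set" and W :: "(real \<times> (real^3)) set"
    and c \<mu> p :: "real \<Rightarrow> real^3 \<Rightarrow> real" and u :: "real \<Rightarrow> real^3 \<Rightarrow> real^3"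
    and \<rho> \<eta> :: "real \<Rightarrow> real^3 \<Rightarrow> real"
  assumes material: "\<rho> = (\<lambda>t x. density_mix \<rho>\<^sub>1 \<rho>\<^sub>2 (c t x))"
      "\<eta> = (\<lambda>t x. viscosity_mix \<eta>\<^sub>1 \<eta>\<^sub>2 (c t x))" "\<rho>\<^sub>0 = max \<rho>\<^sub>1 \<rho>\<^sub>2"
    and constants: "\<sigma> > 0" "\<epsilon> > 0" "M\<^sub>0 > 0" "c\<^sub>0 > 0" "\<rho>\<^sub>1 > 0" "\<rho>\<^sub>2 > 0"
    and f\<^sub>w: "\<And>r. f\<^sub>w differentiable (at r)"
    and domain: "C1_domain \<Omega>" "bounded \<Omega>"
    and normal: "\<And>x. x \<in> frontier \<Omega> \<Longrightarrow> outward_unit_normal \<Omega> x (n x)"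
    and surface: "surface_measure \<Omega> S"
    and time: "open I" "is_interval I"
    and nbhd: "open W" "I \<times> closure \<Omega> \<subseteq> W"
    and smooth: "Ck_on 2 (\<lambda>(t, x). c t x) W" "Ck_on 2 (\<lambda>(t, x). \<mu> t x) W"
      "Ck_on 2 (\<lambda>(t, x). u t x) W" "Ck_on 1 (\<lambda>(t, x). p t x) W"
    and smooth_momentum:
      "\<And>t x. t \<in> I \<Longrightarrow> x \<in> \<Omega> \<Longrightarrow> (\<lambda>s. sqrt (\<rho> s x) *\<^sub>R u s x) differentiable (at t)"
      "\<And>t x i. t \<in> I \<Longrightarrow> x \<in> \<Omega> \<Longrightarrow>
         (\<lambda>y. (1/2 * \<rho> t y * u t y $ i) *\<^sub>R u t y) differentiable (at x)"
    and cahn_hilliard: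
      "\<And>t x. t \<in> I \<Longrightarrow> x \<in> \<Omega> \<Longrightarrow>
         deriv (\<lambda>s. c s x) t + divergence (\<lambda>y. c t y *\<^sub>R u t y) x = M\<^sub>0 * laplacian (\<mu> t) x"
      "\<And>t x. t \<in> I \<Longrightarrow> x \<in> \<Omega> \<Longrightarrow>
         \<mu> t x = deriv (f0 \<sigma> \<epsilon>) (c t x) - 3/2 * \<sigma> * \<epsilon> * laplacian (c t) x"
    and momentum:
      "\<And>t x. t \<in> I \<Longrightarrow> x \<in> \<Omega> \<Longrightarrow>
         sqrt (\<rho> t x) *\<^sub>R vector_derivative (\<lambda>s. sqrt (\<rho> s x) *\<^sub>R u s x) (at t)
         + (\<chi> i. divergence (\<lambda>y. (1/2 * \<rho> t y * u t y $ i) *\<^sub>R u t y) x)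
         + (1/2 * \<rho> t x) *\<^sub>R (\<chi> i. u t x \<bullet> grad (\<lambda>y. u t y $ i) x)
         + c t x *\<^sub>R grad (\<mu> t) x
         = - grad (p t) x
           + (\<chi> i. divergence (\<lambda>y. (2 * \<eta> t y) *\<^sub>R (strain (u t) y $ i)) x)"
    and pressure:
      "\<And>t x. t \<in> I \<Longrightarrow> x \<in> \<Omega> \<Longrightarrow>
         deriv (\<lambda>s. p s x) t + \<rho>\<^sub>0 * c\<^sub>0\<^sup>2 * divergence (u t) x = 0"
    and bc_cahn_hilliard:
      "\<And>t x. t \<in> I \<Longrightarrow> x \<in> frontier \<Omega> \<Longrightarrow>
         - (3/2 * \<sigma> * \<epsilon> * (grad (c t) x \<bullet> n x)) = deriv f\<^sub>w (c t x)"
      "\<And>t x. t \<in> I \<Longrightarrow> x \<in> frontier \<Omega> \<Longrightarrow> grad (\<mu> t) x \<bullet> n x = 0"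
    and bc_momentum:
      "(\<forall>t\<in>I. \<forall>x\<in>frontier \<Omega>. u t x \<bullet> n x = 0 \<and> strain (u t) x *v n x = 0) \<or>
       (\<forall>t\<in>I. \<forall>x\<in>frontier \<Omega>. u t x = 0)"
  shows "\<forall>t\<in>I.
     ((\<lambda>t. (LINT x:\<Omega>|lborel.
               f0 \<sigma> \<epsilon> (c t x) + 3/4 * \<sigma> * \<epsilon> * (norm (grad (c t) x))\<^sup>2
               + 1/2 * \<rho> t x * (norm (u t x))\<^sup>2 + (p t x)\<^sup>2 / (2 * \<rho>\<^sub>0 * c\<^sub>0\<^sup>2))
            + (LINT x:frontier \<Omega>|S. f\<^sub>w (c t x)))
        has_real_derivative
          - (LINT x:\<Omega>|lborel. M\<^sub>0 * (norm (grad (\<mu> t) x))\<^sup>2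
               + 2 * \<eta> t x * (strain (u t) x \<bullet> strain (u t) x))) (at t) \<and>
     ((\<forall>x\<in>\<Omega>. 0 \<le> \<eta> t x) \<longrightarrow>
        - (LINT x:\<Omega>|lborel. M\<^sub>0 * (norm (grad (\<mu> t) x))\<^sup>2
               + 2 * \<eta> t x * (strain (u t) x \<bullet> strain (u t) x)) \<le> 0)"
proof (intro ballI)
  fix t assume t: "t \<in> I"
  \<comment> \<open>The energy coefficient \<open>3/4 * \<sigma> * \<epsilon>\<close> is half of
    \<open>\<kappa>\<close>; the factor 2 from differentiating a square restores
    \<open>\<kappa>\<close>, the coefficient in the chemical potential and in the wall
    condition.\<close>
  define \<kappa> where "\<kappa> = 3/2 * \<sigma> * \<epsilon>"
  define r where "r = \<rho>\<^sub>0 * c\<^sub>0\<^sup>2"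
  define ct where "ct x = deriv (\<lambda>s. c s x) t" for x
  define pt where "pt x = deriv (\<lambda>s. p s x) t" for x
  define w where "w x = vector_derivative (\<lambda>s. sqrt (\<rho> s x) *\<^sub>R u s x) (at t)" for x
  define E where "E s x = f0 \<sigma> \<epsilon> (c s x) + 3/4 * \<sigma> * \<epsilon> * (norm (grad (c s) x))\<^sup>2
      + 1/2 * \<rho> s x * (norm (u s x))\<^sup>2 + (p s x)\<^sup>2 / (2 * \<rho>\<^sub>0 * c\<^sub>0\<^sup>2)" for s x
  define E' where "E' x = deriv (f0 \<sigma> \<epsilon>) (c t x) * ct x + \<kappa> * (grad (c t) x \<bullet> grad ct x)
      + (sqrt (\<rho> t x) *\<^sub>R u t x) \<bullet> w x + p t x * pt x / r" for x
  define Diss where "Diss x = M\<^sub>0 * (norm (grad (\<mu> t) x))\<^sup>2 + 2 * \<eta> t x * (strain (u t) x \<bullet> strain (u t) x)" for x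
  define F where "F = energy_flux \<kappa> M\<^sub>0 (c t) ct (\<mu> t) (\<rho> t) (\<eta> t) (p t) (u t)"
  have r: "r \<noteq> 0" using constants material(3) by (auto simp: r_def max_def)

  interpret gauss_green_domain \<Omega> n S
    using domain normal surface by unfold_locales
  interpret C: spacetime_scalar2 W c
    using nbhd(1) smooth(1) Ck_on_2_imp_1[OF smooth(1)] by unfold_locales
  interpret M: spacetime_scalar2 W \<mu>
    using nbhd(1) smooth(2) Ck_on_2_imp_1[OF smooth(2)] by unfold_locales
  interpret U: spacetime_field2 W u
    using nbhd(1) smooth(3) Ck_on_2_imp_1[OF smooth(3)] by unfold_locales
  interpret P: spacetime_field W p
    using nbhd(1) smooth(4) by unfold_locales

  have inW: "(s, x) \<in> W" if "s \<in> I" "x \<in> closure \<Omega>" for s x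
    using nbhd(2) that by blast
  have \<Omega>_closure: "x \<in> closure \<Omega>" if "x \<in> \<Omega>" for x
    using that closure_subset by blast
  have frontier_closure: "x \<in> closure \<Omega>" if "x \<in> frontier \<Omega>" for x
    using that by (simp add: frontier_def)
  have \<rho>_nonneg: "\<rho> s x \<ge> 0" for s x
    using constants by (simp add: material(1) density_mix_nonneg)
  obtain L\<rho> where L\<rho>: "L\<rho>-lipschitz_on UNIV (density_mix \<rho>\<^sub>1 \<rho>\<^sub>2)"
    using lipschitz_on_density_mix by blast
  have fw_deriv: "(f\<^sub>w has_real_derivative deriv f\<^sub>w a) (at a)" for a
    using f\<^sub>w by (simp add: DERIV_deriv_iff_real_differentiable)
  have grad_sq: "(norm (grad g x))\<^sup>2 = (\<Sum>i\<in>UNIV. grad g x $ i * grad g x $ i)" for g :: "real^3 \<Rightarrow> real" and x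
    by (simp add: power2_norm_eq_inner inner_vec_def)
  have u_sq: "(norm (u s x))\<^sup>2 = (\<Sum>i\<in>UNIV. u s x $ i * u s x $ i)" for s x
    by (simp add: power2_norm_eq_inner inner_vec_def)

  have lip_\<rho>: "lipschitz_near (closure \<Omega>) (\<rho> s)" if "s \<in> I" for s
    unfolding material(1) using inW that by (intro lipschitz_near_compose[OF L\<rho>] C.lipschitz_near_space)
  have lip_u: "lipschitz_near (closure \<Omega>) (\<lambda>x. u s x $ i)" if "s \<in> I" for s i
    using inW that by (intro lipschitz_near_nth U.lipschitz_near_space)
  have lip_strain: "lipschitz_near (closure \<Omega>) (\<lambda>x. strain (u t) x $ i $ j)" for i j
    unfolding strain_nth using inW t
    by (intro lipschitz_near_mult lipschitz_near_const lipschitz_near_add lipschitz_near_nth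
        U.lipschitz_near_frechet_derivative)
  have lip_\<eta>: "lipschitz_near (closure \<Omega>) (\<eta> t)"
    unfolding material(2) viscosity_mix_def using inW t
    by (intro lipschitz_near_mult lipschitz_near_const lipschitz_near_add lipschitz_near_diff C.lipschitz_near_space)
  have lip_ct: "lipschitz_near (closure \<Omega>) ct"
    unfolding ct_def using inW t by (intro C.lipschitz_near_deriv)
  have lip_F: "lipschitz_near (closure \<Omega>) (\<lambda>x. F x $ j)" for j
    unfolding F_def energy_flux_def
      vector_add_component vector_minus_component vector_scaleR_component sum_component real_scaleR_def
    using inW t
    by (intro lipschitz_near_add lipschitz_near_diff lipschitz_near_sum finite lipschitz_near_mult lipschitz_near_const
        lip_\<rho> lip_u lip_strain lip_\<eta> lip_ct C.lipschitz_near_grad M.lipschitz_near_grad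
        C.lipschitz_near_space M.lipschitz_near_space P.lipschitz_near_space)
  have E_cont: "continuous_on (closure \<Omega>) (E s)" if "s \<in> I" for s
  proof (rule lipschitz_near_continuous_on)
    \<comment> \<open>Squares and quotients are unfolded into products, under which
      \<open>lipschitz_near\<close> is closed.\<close>
    show "lipschitz_near (closure \<Omega>) (E s)"
      unfolding E_def f0_def grad_sq u_sq unfolding power2_eq_square divide_inverse using inW that
      by (intro lipschitz_near_add lipschitz_near_diff lipschitz_near_sum finite lipschitz_near_mult lipschitz_near_const
          lip_\<rho> lip_u C.lipschitz_near_grad C.lipschitz_near_space P.lipschitz_near_space)
  qed
  have Diss_int: "set_integrable lborel \<Omega> Diss"
  proof (intro set_integrable_continuous_closure lipschitz_near_continuous_on)
    show "lipschitz_near (closure \<Omega>) Diss"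
      unfolding Diss_def grad_sq inner_vec_def inner_real_def using inW t
      by (intro lipschitz_near_add lipschitz_near_sum finite lipschitz_near_mult lipschitz_near_const
          lip_\<eta> lip_strain M.lipschitz_near_grad)
  qed

  \<comment> \<open>A closed time interval inside \<open>I\<close> makes the slab compact, so one
    constant serves for all nearby times.\<close>
  obtain e where e: "e > 0" "cball t e \<subseteq> I"
    using time(1) t open_contains_cball by blast
  have slab: "{t - e..t + e} \<times> closure \<Omega> \<subseteq> W"
    using e(2) nbhd(2) by (auto simp: subset_iff dist_real_def)
  have slab_I: "s \<in> I" if "s \<in> {t - e..t + e}" for s
    using e(2) that by (auto simp: subset_iff dist_real_def)
  have compact: "compact (closure \<Omega>)" using domain(2) by simp
  have ul_c: "uniformly_lipschitz {t - e..t + e} (closure \<Omega>) c"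
    using uniformly_lipschitz_Ck_on_1[OF C.f1 slab compact] by simp
  have ul_p: "uniformly_lipschitz {t - e..t + e} (closure \<Omega>) p"
    using uniformly_lipschitz_Ck_on_1[OF P.f1 slab compact] by simp
  have ul_u: "uniformly_lipschitz {t - e..t + e} (closure \<Omega>) (\<lambda>s x. u s x $ i)" for i
    using uniformly_lipschitz_Ck_on_1[OF Ck_on_1_vec_nth[OF U.f1] slab compact] by simp
  have ul_grad: "uniformly_lipschitz {t - e..t + e} (closure \<Omega>) (\<lambda>s x. grad (c s) x $ i)" for i
    by (rule C.uniformly_lipschitz_grad[OF slab compact])
  have ul_\<rho>: "uniformly_lipschitz {t - e..t + e} (closure \<Omega>) \<rho>"
    unfolding material(1) by (intro uniformly_lipschitz_compose[OF L\<rho>] ul_c)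
  have "uniformly_lipschitz {t - e..t + e} (closure \<Omega>) E"
    unfolding E_def f0_def grad_sq u_sq unfolding power2_eq_square divide_inverse
    by (intro uniformly_lipschitz_add uniformly_lipschitz_diff uniformly_lipschitz_sum finite uniformly_lipschitz_mult
        uniformly_lipschitz_const ul_c ul_p ul_u ul_grad ul_\<rho>)
  then obtain LE where LE: "\<And>x s s'. x \<in> closure \<Omega> \<Longrightarrow> s \<in> {t - e..t + e} \<Longrightarrow> s' \<in> {t - e..t + e}
      \<Longrightarrow> \<bar>E s x - E s' x\<bar> \<le> LE * \<bar>s - s'\<bar>"
    by (rule uniformly_lipschitzE) blast
  have E_deriv: "((\<lambda>s. E s x) has_real_derivative E' x) (at t)" if x: "x \<in> \<Omega>" for x
  proof -
    have xW: "(t, x) \<in> W" using inW t x \<Omega>_closure by blast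
    have c': "((\<lambda>s. c s x) has_real_derivative ct x) (at t)"
      unfolding ct_def by (rule C.has_real_derivative_time[OF xW])
    have d1: "((\<lambda>s. f0 \<sigma> \<epsilon> (c s x)) has_real_derivative deriv (f0 \<sigma> \<epsilon>) (c t x) * ct x) (at t)"
      using DERIV_chain2[OF f0_has_real_derivative c'] .
    have "((\<lambda>s. \<Sum>i\<in>UNIV. grad (c s) x $ i * grad (c s) x $ i) has_real_derivative
        (\<Sum>i\<in>UNIV. grad ct x $ i * grad (c t) x $ i + grad ct x $ i * grad (c t) x $ i)) (at t)"
      unfolding ct_def by (intro DERIV_sum DERIV_mult C.has_real_derivative_grad_time[OF xW])
    then have d2: "((\<lambda>s. (norm (grad (c s) x))\<^sup>2) has_real_derivative 2 * (grad (c t) x \<bullet> grad ct x)) (at t)"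
      unfolding grad_sq by (simp add: inner_vec_def sum_distrib_left mult_ac)
    \<comment> \<open>Differentiated as one quantity: \<open>\<rho>\<close> alone may have no time
      derivative when \<open>c\<close> crosses 0 or 1.\<close>
    have "((\<lambda>s. sqrt (\<rho> s x) *\<^sub>R u s x) has_vector_derivative w x) (at t)"
      unfolding w_def using smooth_momentum(1)[OF t x] by (simp add: vector_derivative_works)
    from has_real_derivative_inner_self[OF this]
    have d3: "((\<lambda>s. \<rho> s x * (norm (u s x))\<^sup>2) has_real_derivative 2 * ((sqrt (\<rho> t x) *\<^sub>R u t x) \<bullet> w x)) (at t)"
      using \<rho>_nonneg by (simp add: power2_norm_eq_inner mult.assoc[symmetric])
    have p': "((\<lambda>s. p s x) has_real_derivative pt x) (at t)"
      using P.has_vector_derivative_time[OF xW] unfolding pt_def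
      by (metis DERIV_imp_deriv has_real_derivative_iff_has_vector_derivative)
    have "((\<lambda>s. f0 \<sigma> \<epsilon> (c s x) + 3/4 * \<sigma> * \<epsilon> * (norm (grad (c s) x))\<^sup>2
        + 1/2 * (\<rho> s x * (norm (u s x))\<^sup>2) + (p s x)\<^sup>2 / (2 * r)) has_real_derivative
        deriv (f0 \<sigma> \<epsilon>) (c t x) * ct x + 3/4 * \<sigma> * \<epsilon> * (2 * (grad (c t) x \<bullet> grad ct x))
        + 1/2 * (2 * ((sqrt (\<rho> t x) *\<^sub>R u t x) \<bullet> w x)) + (2 * p t x * pt x) / (2 * r)) (at t)"
      using r p' by (intro DERIV_add DERIV_cmult d1 d2 d3) (auto intro!: derivative_eq_intros)
    then show ?thesis
      by (simp add: E_def E'_def \<kappa>_def r_def mult_ac)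
  qed
  have set_int_const: "set_integrable lborel \<Omega> (\<lambda>_. a)" for a :: real
    by (rule set_integrable_continuous_closure) auto
  have E_der: "set_integrable lborel \<Omega> E'"
    "((\<lambda>s. LINT x:\<Omega>|lborel. E s x) has_real_derivative (LINT x:\<Omega>|lborel. E' x)) (at t)"
  proof -
    have "\<bar>E s x - E t x\<bar> \<le> LE * \<bar>s - t\<bar>" if "\<bar>s - t\<bar> < e" "x \<in> \<Omega>" for s x
      using that e(1) by (intro LE \<Omega>_closure) auto
    moreover have "set_integrable lborel \<Omega> (E s)" if "\<bar>s - t\<bar> < e" for s
      using that by (intro set_integrable_continuous_closure E_cont slab_I) auto
    ultimately show "set_integrable lborel \<Omega> E'"
      "((\<lambda>s. LINT x:\<Omega>|lborel. E s x) has_real_derivative (LINT x:\<Omega>|lborel. E' x)) (at t)"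
      using has_real_derivative_set_integral[of \<Omega> lborel e t E E' "\<lambda>_. LE"] e(1) E_deriv set_int_const by auto
  qed

  \<comment> \<open>The wall energy: \<open>f\<^sub>w'\<close> need not be continuous, but the boundary condition bounds it along the solution.\<close>
  have fw_der: "((\<lambda>s. f\<^sub>w (c s x)) has_real_derivative deriv f\<^sub>w (c s x) * deriv (\<lambda>s. c s x) s) (at s)"
    if "s \<in> I" "x \<in> frontier \<Omega>" for s x
    by (rule DERIV_chain2[OF fw_deriv C.has_real_derivative_time[OF inW[OF that(1) frontier_closure[OF that(2)]]]])
  have fw_cont: "continuous_on UNIV f\<^sub>w"
    using fw_deriv DERIV_isCont by (auto simp: continuous_on_eq_continuous_at)
  have "uniformly_lipschitz {t - e..t + e} (frontier \<Omega>) (\<lambda>s x. f\<^sub>w (c s x))"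
  proof -
    have slab': "{t - e..t + e} \<times> frontier \<Omega> \<subseteq> W"
      using slab frontier_closure by blast
    have compact': "compact (frontier \<Omega>)" using domain(2) by (rule compact_frontier_bounded)
    have "continuous_on W (\<lambda>z. f\<^sub>w (case z of (s, x) \<Rightarrow> c s x))"
      by (intro continuous_on_compose2[OF fw_cont Ck_on_1_continuous_on[OF C.f1]]) auto
    from bounded_on_compact_slab[OF this slab' compact']
    obtain B where B: "\<And>s x. s \<in> {t - e..t + e} \<Longrightarrow> x \<in> frontier \<Omega> \<Longrightarrow> \<bar>f\<^sub>w (c s x)\<bar> \<le> B"
      by auto
    have "continuous_on W (\<lambda>z. frechet_derivative (\<lambda>(t, x). c t x) (at z) (1, 0))"
      using C.f1 unfolding Ck_on_1_iff by blast
    from bounded_on_compact_slab[OF this slab' compact']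
    obtain B1 where B1: "\<And>s x. s \<in> {t - e..t + e} \<Longrightarrow> x \<in> frontier \<Omega> \<Longrightarrow> \<bar>C.D (1, 0) s x\<bar> \<le> B1"
      by auto
    \<comment> \<open>The squared norm is a polynomial in the components and thus within the
      \<open>uniformly_lipschitz\<close> calculus; what is extracted is its bound
      \<open>B2\<close>.\<close>
    have "uniformly_lipschitz {t - e..t + e} (closure \<Omega>) (\<lambda>s x. (norm (grad (c s) x))\<^sup>2)"
      unfolding grad_sq by (intro uniformly_lipschitz_sum finite uniformly_lipschitz_mult ul_grad)
    then obtain B2 where B2: "\<And>s x. x \<in> closure \<Omega> \<Longrightarrow> s \<in> {t - e..t + e} \<Longrightarrow> (norm (grad (c s) x))\<^sup>2 \<le> B2"
      by (rule uniformly_lipschitzE) auto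
    have \<kappa>: "\<kappa> > 0" using constants by (simp add: \<kappa>_def)
    show ?thesis
    proof (rule uniformly_lipschitz_bounded_derivative[OF B])
      fix s x assume s: "s \<in> {t - e..t + e}" and x: "x \<in> frontier \<Omega>"
      show "((\<lambda>s. f\<^sub>w (c s x)) has_real_derivative deriv f\<^sub>w (c s x) * deriv (\<lambda>s. c s x) s) (at s)"
        using fw_der slab_I[OF s] x .
      have sW: "(s, x) \<in> W" using inW slab_I[OF s] frontier_closure[OF x] .
      have "norm (n x) = 1" using normal[OF x] unfolding outward_unit_normal_def by blast
      then have "\<bar>grad (c s) x \<bullet> n x\<bar> \<le> norm (grad (c s) x)"
        using Cauchy_Schwarz_ineq2[of "grad (c s) x" "n x"] by simp
      \<comment> \<open>With \<open>a\<close> the norm, \<open>(a - 1/2)^2 \<ge> 0\<close> gives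
        \<open>a \<le> a^2 + 1/4\<close>, which trades the norm for the bounded square.\<close>
      also have "\<dots> \<le> 1 + (norm (grad (c s) x))\<^sup>2"
        using power2_diff[of "norm (grad (c s) x)" "1/2"] zero_le_power2[of "norm (grad (c s) x) - 1/2"]
        by (simp add: power2_eq_square)
      also have "\<dots> \<le> 1 + B2" using B2[OF frontier_closure[OF x] s] by simp
      finally have "\<kappa> * \<bar>grad (c s) x \<bullet> n x\<bar> \<le> \<kappa> * (1 + B2)" using \<kappa> by simp
      moreover have "deriv f\<^sub>w (c s x) = - (\<kappa> * (grad (c s) x \<bullet> n x))"
        using bc_cahn_hilliard(1)[OF slab_I[OF s] x] by (simp add: \<kappa>_def)
      ultimately have "\<bar>deriv f\<^sub>w (c s x)\<bar> \<le> \<kappa> * (1 + B2)" using \<kappa> by (simp add: abs_mult)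
      moreover have "\<bar>deriv (\<lambda>s. c s x) s\<bar> \<le> B1" using B1[OF s x] C.deriv_time[OF sW] by simp
      ultimately show "\<bar>deriv f\<^sub>w (c s x) * deriv (\<lambda>s. c s x) s\<bar> \<le> \<kappa> * (1 + B2) * B1"
        unfolding abs_mult by (intro mult_mono) auto
    qed
  qed
  then obtain Lw where Lw: "\<And>x s s'. x \<in> frontier \<Omega> \<Longrightarrow> s \<in> {t - e..t + e} \<Longrightarrow> s' \<in> {t - e..t + e}
      \<Longrightarrow> \<bar>f\<^sub>w (c s x) - f\<^sub>w (c s' x)\<bar> \<le> Lw * \<bar>s - s'\<bar>"
    by (rule uniformly_lipschitzE) blast
  have wall_der: "((\<lambda>s. LINT x:frontier \<Omega>|S. f\<^sub>w (c s x)) has_real_derivative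
      (LINT x:frontier \<Omega>|S. deriv f\<^sub>w (c t x) * ct x)) (at t)"
  proof (rule has_real_derivative_set_integral(2)[where e = e and k = "\<lambda>_. Lw"])
    show "frontier \<Omega> \<in> sets S" using surface unfolding surface_measure_def by auto
    show "set_integrable S (frontier \<Omega>) (\<lambda>x. f\<^sub>w (c s x))" if "\<bar>s - t\<bar> < e" for s
    proof (rule set_integrable_frontier_continuous[OF surface domain])
      have "s \<in> I" using that by (intro slab_I) auto
      then show "continuous_on (frontier \<Omega>) (\<lambda>x. f\<^sub>w (c s x))"
        by (intro continuous_on_compose2[OF fw_cont] C.continuous_on_slice inW frontier_closure) auto
    qed
    \<comment> \<open>A constant can dominate because the surface measure of the frontier is
      finite.\<close>
    show "set_integrable S (frontier \<Omega>) (\<lambda>_. Lw)"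
      by (rule set_integrable_frontier_continuous[OF surface domain]) auto
    show "((\<lambda>s. f\<^sub>w (c s x)) has_real_derivative deriv f\<^sub>w (c t x) * ct x) (at t)" if "x \<in> frontier \<Omega>" for x
      unfolding ct_def by (rule fw_der[OF t that])
    show "\<bar>f\<^sub>w (c s x) - f\<^sub>w (c t x)\<bar> \<le> Lw * \<bar>s - t\<bar>" if "\<bar>s - t\<bar> < e" "x \<in> frontier \<Omega>" for s x
      using that e(1) by (intro Lw) auto
  qed (rule e(1))

  have div: "has_divergence F (E' x + Diss x) x" if x: "x \<in> \<Omega>" for x
  proof -
    have xW: "(t, x) \<in> W" using inW t x \<Omega>_closure by blast
    note u' = U.differentiable_space[OF xW] and c' = C.differentiable_space[OF xW]
    have \<eta>': "\<eta> t differentiable (at x)"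
      unfolding material(2) viscosity_mix_def using c'
      by (intro differentiable_add differentiable_mult differentiable_diff differentiable_const)
    have strain': "(\<lambda>y. strain (u t) y $ i) differentiable (at x)" for i
    proof -
      have "(\<lambda>y. \<chi> j. strain (u t) y $ i $ j) differentiable (at x)"
        unfolding strain_nth
        by (intro differentiable_vec_lambda differentiable_mult differentiable_const differentiable_add
            differentiable_vec_nth U.differentiable_frechet_derivative[OF xW])
      then show ?thesis by simp
    qed
    have ct': "ct differentiable (at x)" unfolding ct_def by (rule C.differentiable_deriv(1)[OF xW])
    note hd = has_divergence_energy_flux[OF c' ct' M.differentiable_space[OF xW]
        P.differentiable_space[OF xW] u' \<eta>' C.differentiable_grad[OF xW] M.differentiable_grad[OF xW]
        strain' smooth_momentum(2)[OF t x], of \<kappa> M\<^sub>0]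
    have kin: "(\<Sum>i\<in>UNIV. u t x $ i * divergence (\<lambda>y. (1/2 * \<rho> t y * u t y $ i) *\<^sub>R u t y) x
          + grad (\<lambda>y. u t y $ i) x \<bullet> ((1/2 * \<rho> t x * u t x $ i) *\<^sub>R u t x))
        = u t x \<bullet> (\<chi> i. divergence (\<lambda>y. (1/2 * \<rho> t y * u t y $ i) *\<^sub>R u t y) x)
          + 1/2 * \<rho> t x * (u t x \<bullet> (\<chi> i. u t x \<bullet> grad (\<lambda>y. u t y $ i) x))"
      by (simp add: inner_vec_def[of "u t x" "\<chi> i. _ i"] sum.distrib sum_distrib_left inner_commute mult_ac)
    have visc: "(\<Sum>i\<in>UNIV. u t x $ i * divergence (\<lambda>y. (2 * \<eta> t y) *\<^sub>R (strain (u t) y $ i)) x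
          + grad (\<lambda>y. u t y $ i) x \<bullet> ((2 * \<eta> t x) *\<^sub>R (strain (u t) x $ i)))
        = u t x \<bullet> (\<chi> i. divergence (\<lambda>y. (2 * \<eta> t y) *\<^sub>R (strain (u t) y $ i)) x)
          + 2 * \<eta> t x * (strain (u t) x \<bullet> strain (u t) x)"
      unfolding sum_grad_inner_strain[OF u', symmetric]
      by (simp add: inner_vec_def[of "u t x" "\<chi> i. _ i"] sum.distrib sum_distrib_left)
    have ch2: "\<mu> t x = deriv (f0 \<sigma> \<epsilon>) (c t x) - \<kappa> * laplacian (c t) x"
      using cahn_hilliard(2)[OF t x] by (simp add: \<kappa>_def)
    have pr: "pt x + r * divergence (u t) x = 0" using pressure[OF t x] by (simp add: pt_def r_def)
    note balance = energy_balance_algebra[OF cahn_hilliard(1)[OF t x, folded ct_def] ch2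
        momentum[OF t x, folded w_def] pr r, where gc = "grad (c t) x" and gct = "grad ct x" and p = "p t x" and u = "u t x"]
    \<comment> \<open>\<open>balance\<close> ends with minus the diffusive dissipation, which the
      first part of \<open>Diss\<close> cancels; the second part supplies the strain term that
      \<open>visc\<close> contains.\<close>
    have "E' x + Diss x = (\<kappa> * (ct x * laplacian (c t) x + grad ct x \<bullet> grad (c t) x)
       + M\<^sub>0 * (\<mu> t x * laplacian (\<mu> t) x + grad (\<mu> t) x \<bullet> grad (\<mu> t) x)
       - (\<mu> t x * divergence (\<lambda>y. c t y *\<^sub>R u t y) x + grad (\<mu> t) x \<bullet> (c t x *\<^sub>R u t x))
       - (\<Sum>i\<in>UNIV. u t x $ i * divergence (\<lambda>y. (1/2 * \<rho> t y * u t y $ i) *\<^sub>R u t y) x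
          + grad (\<lambda>y. u t y $ i) x \<bullet> ((1/2 * \<rho> t x * u t x $ i) *\<^sub>R u t x))
       - (p t x * divergence (u t) x + grad (p t) x \<bullet> u t x)
       + (\<Sum>i\<in>UNIV. u t x $ i * divergence (\<lambda>y. (2 * \<eta> t y) *\<^sub>R (strain (u t) y $ i)) x
          + grad (\<lambda>y. u t y $ i) x \<bullet> ((2 * \<eta> t x) *\<^sub>R (strain (u t) x $ i))))"
      unfolding E'_def Diss_def kin visc balance power2_norm_eq_inner by simp
    with hd show ?thesis unfolding F_def by simp
  qed
  have wall: "F x \<bullet> n x = - (deriv f\<^sub>w (c t x) * ct x)" if x: "x \<in> frontier \<Omega>" for x
  proof -
    \<comment> \<open>Both wall conditions annihilate the same two terms: free slip because normal
      velocity and normal stress vanish, no slip because \<open>u\<close> does.\<close>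
    have un: "u t x \<bullet> n x = 0" and visc: "(\<Sum>i\<in>UNIV. u t x $ i * (strain (u t) x $ i \<bullet> n x)) = 0"
    proof -
      have "(strain (u t) x *v n x) $ i = strain (u t) x $ i \<bullet> n x" for i
        by (simp add: matrix_vector_mult_def inner_vec_def)
      then show "u t x \<bullet> n x = 0" "(\<Sum>i\<in>UNIV. u t x $ i * (strain (u t) x $ i \<bullet> n x)) = 0"
        using bc_momentum t x by (metis (no_types, lifting) inner_zero_left mult_zero_left mult_zero_right sum.neutral zero_index)+
    qed
    have visc': "(\<Sum>i\<in>UNIV. u t x $ i * (2 * \<eta> t x * (strain (u t) x $ i \<bullet> n x))) = 0"
      using arg_cong[OF visc, of "\<lambda>a. 2 * \<eta> t x * a"] by (simp add: sum_distrib_left mult_ac)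
    \<comment> \<open>Every flux term except the first carries \<open>u \<bullet> n\<close>,
      \<open>grad \<mu> \<bullet> n\<close> or the product of \<open>u\<close> with the normal
      stress.\<close>
    have "F x \<bullet> n x = \<kappa> * ct x * (grad (c t) x \<bullet> n x)"
      unfolding F_def energy_flux_def
      using un visc' bc_cahn_hilliard(2)[OF t x]
      by (simp add: inner_add_left inner_diff_left inner_sum_left mult.assoc)
    also have "\<dots> = - (deriv f\<^sub>w (c t x) * ct x)"
      using bc_cahn_hilliard(1)[OF t x, symmetric] by (simp add: \<kappa>_def)
    finally show ?thesis .
  qed
  have F_diff: "F differentiable (at x)" if "x \<in> \<Omega>" for x
    using div[OF that] by (simp add: has_divergence_def)
  have "(LINT x:\<Omega>|lborel. E' x) = (LINT x:\<Omega>|lborel. divergence F x - Diss x)"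
    using div by (intro set_lebesgue_integral_cong) (auto simp: has_divergence_def)
  also have "\<dots> = (LINT x:\<Omega>|lborel. divergence F x) - (LINT x:\<Omega>|lborel. Diss x)"
    using divergence_theorem(1)[OF lip_F F_diff] Diss_int by (rule set_integral_diff(2))
  also have "(LINT x:\<Omega>|lborel. divergence F x) = (LINT x:frontier \<Omega>|S. F x \<bullet> n x)"
    by (rule divergence_theorem(3)[OF lip_F F_diff])
  also have "\<dots> = (LINT x:frontier \<Omega>|S. - (deriv f\<^sub>w (c t x) * ct x))"
    using surface wall by (intro set_lebesgue_integral_cong) (auto simp: surface_measure_def)
  also have "\<dots> = - (LINT x:frontier \<Omega>|S. deriv f\<^sub>w (c t x) * ct x)"
    unfolding set_lebesgue_integral_def by simp
  finally have total: "(LINT x:\<Omega>|lborel. E' x) + (LINT x:frontier \<Omega>|S. deriv f\<^sub>w (c t x) * ct x)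
      = - (LINT x:\<Omega>|lborel. Diss x)" by simp
  have "((\<lambda>s. (LINT x:\<Omega>|lborel. E s x) + (LINT x:frontier \<Omega>|S. f\<^sub>w (c s x))) has_real_derivative
      - (LINT x:\<Omega>|lborel. Diss x)) (at t)"
    using DERIV_add[OF E_der(2) wall_der] unfolding total .
  \<comment> \<open>\<open>viscosity_mix\<close> has no cutoff, so the viscosity can become negative
    where \<open>c\<close> leaves the unit interval; its sign is therefore a premise.\<close>
  moreover have "0 \<le> (LINT x:\<Omega>|lborel. Diss x)" if "\<forall>x\<in>\<Omega>. 0 \<le> \<eta> t x"
  proof -
    have "0 \<le> Diss x" if "x \<in> \<Omega>" for x
      using \<open>\<forall>x\<in>\<Omega>. 0 \<le> \<eta> t x\<close> that constants(3) by (simp add: Diss_def)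
    then show ?thesis
      unfolding set_lebesgue_integral_def
      by (intro Bochner_Integration.integral_nonneg) (auto simp: indicator_def)
  qed
  ultimately show "((\<lambda>t. (LINT x:\<Omega>|lborel.
               f0 \<sigma> \<epsilon> (c t x) + 3/4 * \<sigma> * \<epsilon> * (norm (grad (c t) x))\<^sup>2
               + 1/2 * \<rho> t x * (norm (u t x))\<^sup>2 + (p t x)\<^sup>2 / (2 * \<rho>\<^sub>0 * c\<^sub>0\<^sup>2))
            + (LINT x:frontier \<Omega>|S. f\<^sub>w (c t x)))
        has_real_derivative
          - (LINT x:\<Omega>|lborel. M\<^sub>0 * (norm (grad (\<mu> t) x))\<^sup>2
               + 2 * \<eta> t x * (strain (u t) x \<bullet> strain (u t) x))) (at t) \<and>
     ((\<forall>x\<in>\<Omega>. 0 \<le> \<eta> t x) \<longrightarrow>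
        - (LINT x:\<Omega>|lborel. M\<^sub>0 * (norm (grad (\<mu> t) x))\<^sup>2
               + 2 * \<eta> t x * (strain (u t) x \<bullet> strain (u t) x)) \<le> 0)"
    unfolding E_def Diss_def by simp
qed

end
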